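(* Let $0 \le \alpha \le 1$. There exists a constant $c_\alpha>0$ depending only on $\alpha$ such that for every $n\ge 1$ and every cluster $\{x_1,\dots,x_n\}\subset\mathbb{R}^2$ of $n$ particles satisfying property (P), $$\max_{1\le i\le n}\mathbb{P}\left(\text{new particle hits } x_i\right)\le c_\alpha\, n^{\frac{\alpha-1}{2\alpha+2}}.$$
   Context: Energy: for $0<\alpha<\infty$, $E(x)=\sum_{i=1}^n \|x-x_i\|^{-\alpha}$; for $\alpha=0$, $E(x)=\sum_{i=1}^n \log(1/\|x-x_i\|)$. Cluster: particles are disks of radius $1/2$ identified with their centers. A cluster of $n$ particles is a set $\{x_1,\dots,x_n\}\subset\mathbb{R}^2$ with $x_1=0$, with $\|x_i-x_j\|\ge 1$ for $i\neq j$, and such that the graph joining $x_i$ and $x_j$ whenever $\|x_i-x_j\|=1$ is connected (as is always the case for configurations produced by Gradient Flow Aggregation). Property (P): the function $E$ has only finitely many critical points (points $x$ with $\nabla E(x)=0$). Hitting probability: the gradient ascent flow is $\dot{x}(t)=\nabla E(x(t))$. A flow attaches to (hits) $x_i$ if it reaches distance $1$ from $x_i$ and this is the first time that it is at distance $1$ from any of the points $x_1,\dots,x_n$. Let $p_i(r)$ be the probability that the flow started at a uniformly random point of the circle $\{\|x\|=r\}$ attaches to $x_i$. Then $\mathbb{P}(\text{new particle hits }x_i):=\lim_{r\to\infty}p_i(r)$ (this limit exists under property (P)). *)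

theory Defs
  imports "HOL-Probability.Probability"
begin

definition cluster :: "nat \<Rightarrow> (nat \<Rightarrow> real^2) \<Rightarrow> bool" where
  "cluster n x \<longleftrightarrow>
     n \<ge> 1 \<and> x 1 = 0 \<and>
     (\<forall>i\<in>{1..n}. \<forall>j\<in>{1..n}. i \<noteq> j \<longrightarrow> dist (x i) (x j) \<ge> 1) \<and>
     (\<forall>i\<in>{1..n}. \<forall>j\<in>{1..n}.
        (i, j) \<in> {(k, l). k \<in> {1..n} \<and> l \<in> {1..n} \<and> dist (x k) (x l) = 1}\<^sup>*)"

definition energy :: "real \<Rightarrow> nat \<Rightarrow> (nat \<Rightarrow> real^2) \<Rightarrow> real^2 \<Rightarrow> real" where
  "energy \<alpha> n x y =
     (\<Sum>i=1..n. if \<alpha> = 0 then ln (1 / norm (y - x i)) else norm (y - x i) powr (- \<alpha>))"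

text \<open>The energy is defined only off the cluster; its HOL value at a cluster point is an
  artefact, so such points are excluded explicitly.\<close>

definition critical_points :: "real \<Rightarrow> nat \<Rightarrow> (nat \<Rightarrow> real^2) \<Rightarrow> (real^2) set" where
  "critical_points \<alpha> n x = {y. y \<notin> x ` {1..n} \<and> GDERIV (energy \<alpha> n x) y :> 0}"

definition property_P :: "real \<Rightarrow> nat \<Rightarrow> (nat \<Rightarrow> real^2) \<Rightarrow> bool" where
  "property_P \<alpha> n x \<longleftrightarrow> finite (critical_points \<alpha> n x)"

definition ascent_flow ::
    "real \<Rightarrow> nat \<Rightarrow> (nat \<Rightarrow> real^2) \<Rightarrow> (real \<Rightarrow> real^2) \<Rightarrow> real \<Rightarrow> bool" where
  "ascent_flow \<alpha> n x \<phi> T \<longleftrightarrow>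
     (\<forall>t\<in>{0..T}. \<phi> t \<notin> x ` {1..n} \<and>
        (\<exists>g. GDERIV (energy \<alpha> n x) (\<phi> t) :> g \<and>
             (\<phi> has_vector_derivative g) (at t within {0..T})))"

text \<open>Off the cluster the gradient is smooth, so the flow started at a point \<open>y\<close> is unique
  and the existential quantifier over \<open>\<phi>\<close> just names it.\<close>

definition attaches ::
    "real \<Rightarrow> nat \<Rightarrow> (nat \<Rightarrow> real^2) \<Rightarrow> nat \<Rightarrow> real^2 \<Rightarrow> bool" where
  "attaches \<alpha> n x i y \<longleftrightarrow>
     (\<exists>T\<ge>0. \<exists>\<phi>. \<phi> 0 = y \<and> ascent_flow \<alpha> n x \<phi> T \<and> dist (\<phi> T) (x i) = 1 \<and>
        (\<forall>t\<in>{0..<T}. \<forall>j\<in>{1..n}. dist (\<phi> t) (x j) \<noteq> 1))"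

definition circle_point :: "real \<Rightarrow> real \<Rightarrow> real^2" where
  "circle_point r \<theta> = vector [r * cos \<theta>, r * sin \<theta>]"

definition hit_prob_from ::
    "real \<Rightarrow> nat \<Rightarrow> (nat \<Rightarrow> real^2) \<Rightarrow> nat \<Rightarrow> real \<Rightarrow> real" where
  "hit_prob_from \<alpha> n x i r =
     measure (uniform_measure lborel {0..2*pi})
       {\<theta>\<in>{0..2*pi}. attaches \<alpha> n x i (circle_point r \<theta>)}"

definition hit_prob :: "real \<Rightarrow> nat \<Rightarrow> (nat \<Rightarrow> real^2) \<Rightarrow> nat \<Rightarrow> real" where
  "hit_prob \<alpha> n x i = Lim at_top (hit_prob_from \<alpha> n x i)"

end

theory Submission
  imports Defs
begin

text \<open>Far from the cluster the flow is almost radial.  Written with the radius as parameter, the angular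
  equation has Lipschitz constant \<open>O(n / \<rho>\<^sup>2)\<close>, so passing from a circle to a larger one changes arc
  lengths by a factor \<open>exp (O(n / r))\<close> only.  Hence the limit defining the hitting probability \<open>p\<close>
  exists, and on each circle of radius \<open>\<rho> \<ge> 4 n\<close> the starting points that hit a given particle have angular
  measure at least a constant times \<open>p\<close>.

  Since \<open>div (grad E) \<ge> 0\<close> off the cluster, the flow does not decrease area.  The points in a thin
  annulus of radius about \<open>4 n\<close> that hit \<open>x\<^sub>i\<close> cross the annulus at speed at least of order
  \<open>n powr (- \<alpha>)\<close>, and they have to enter a disk at whose boundary the speed is of order at most
  \<open>n powr ((1 - \<alpha>) / 2)\<close>, because the particles are separated.  Comparing the two areas swept per unit
  time gives \<open>p \<le> C n powr ((\<alpha> - 1) / 2)\<close>, which is stronger than the claim.\<close>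

section \<open>Ordinary differential equations with a bounded Lipschitz field\<close>

text \<open>The gradient is singular at the particles, whereas a flow is wanted that exists for all
  times and from every point. Each summand of the field is therefore capped inside radius 1/2. Until
  the hit the trajectory stays at distance at least 1 from every particle, where nothing has
  changed, so the capped flow decides every attachment. The obstacle in the area argument is that
  the set hitting a particle is only known to be Borel, and no bound on its hitting times is at
  hand. Hence the slicing by time steps, the passage to compact subsets of each slice, and an area
  inequality for compact sets only. No limit of small time steps is taken: a step \<delta> with
  \<open>M * \<delta> \<le> 1\<close> costs just a constant factor. The exponent (\<alpha> - 1) / 2
  appears because the outer circle has length of order n, so the inflow carries the factor n powr (1
  - \<alpha>). The constant blows up as \<alpha> tends to 1, where the sum of inverse squared
  distances over a planar packing becomes logarithmic; at \<alpha> = 1 the claimed exponent is 0 and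
  \<open>p \<le> 1\<close> suffices.\<close>

lemma gronwall_two_sided:
  fixes w :: "real \<Rightarrow> 'a::real_inner"
  assumes "a \<le> b" and cont: "continuous_on {a..b} w" "continuous_on {a..b} \<Lambda>"
    and der: "\<And>t. \<lbrakk>a < t; t < b\<rbrakk> \<Longrightarrow> (w has_vector_derivative w' t) (at t)"
    and der\<Lambda>: "\<And>t. \<lbrakk>a < t; t < b\<rbrakk> \<Longrightarrow> (\<Lambda> has_real_derivative l t) (at t)"
    and bound: "\<And>t. \<lbrakk>a < t; t < b\<rbrakk> \<Longrightarrow> norm (w' t) \<le> l t * norm (w t)"
  shows "norm (w b) \<le> exp (\<Lambda> b - \<Lambda> a) * norm (w a)"
    and "norm (w a) \<le> exp (\<Lambda> b - \<Lambda> a) * norm (w b)"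
proof -
  \<comment> \<open>Squared norm times an integrating factor; the square avoids the point where the
    norm is not differentiable. Since \<open>w t \<bullet> w' t\<close> is bounded on both sides,
    \<sigma> = -1 gives a nonincreasing function and \<sigma> = 1 a nondecreasing one, hence the two
    inequalities.\<close>
  define f where "f = (\<lambda>\<sigma> t. (w t \<bullet> w t) * exp (2 * \<sigma> * \<Lambda> t))"
  define f' where "f' = (\<lambda>\<sigma> t. (2 * (w t \<bullet> w' t) + 2 * \<sigma> * l t * (w t \<bullet> w t)) * exp (2 * \<sigma> * \<Lambda> t))"
  have cf: "continuous_on {a..b} (f \<sigma>)" for \<sigma>
    unfolding f_def by (intro continuous_intros cont)
  have df: "(f \<sigma> has_real_derivative f' \<sigma> t) (at t)" if "a < t" "t < b" for \<sigma> t
  proof -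
    have "((\<lambda>t. w t \<bullet> w t) has_real_derivative 2 * (w t \<bullet> w' t)) (at t)"
      using bounded_bilinear.has_vector_derivative
        [OF bounded_bilinear_inner der[OF that] der[OF that]]
      by (simp add: has_real_derivative_iff_has_vector_derivative inner_commute)
    then show ?thesis
      unfolding f_def f'_def
      by (auto intro!: derivative_eq_intros der\<Lambda> that simp: algebra_simps)
  qed
  have ineq: "\<bar>w t \<bullet> w' t\<bar> \<le> l t * (w t \<bullet> w t)" if "a < t" "t < b" for t
  proof -
    have "\<bar>w t \<bullet> w' t\<bar> \<le> norm (w t) * norm (w' t)" by (rule Cauchy_Schwarz_ineq2)
    also have "\<dots> \<le> norm (w t) * (l t * norm (w t))"
      by (intro mult_left_mono bound that) auto
    finally show ?thesis by (simp add: dot_square_norm power2_eq_square algebra_simps)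
  qed
  have up: "f (-1) b \<le> f (-1) a"
  proof (rule DERIV_nonpos_imp_decreasing_open[OF \<open>a \<le> b\<close> _ cf])
    fix t assume t: "a < t" "t < b"
    have "f' (-1) t \<le> 0"
      using ineq[OF t] unfolding f'_def by (intro mult_nonpos_nonneg) auto
    with df[OF t] show "\<exists>y. (f (-1) has_real_derivative y) (at t) \<and> y \<le> 0" by blast
  qed
  have lo: "f 1 a \<le> f 1 b"
  proof (rule DERIV_nonneg_imp_increasing_open[OF \<open>a \<le> b\<close> _ cf])
    fix t assume t: "a < t" "t < b"
    have "0 \<le> f' 1 t"
      using ineq[OF t] unfolding f'_def by (intro mult_nonneg_nonneg) auto
    with df[OF t] show "\<exists>y. (f 1 has_real_derivative y) (at t) \<and> 0 \<le> y" by blast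
  qed
  have sq: "x \<le> exp d * y" if "x\<^sup>2 * exp (- (2 * d)) \<le> y\<^sup>2" "y \<ge> 0" for x y d :: real
  proof -
    have "(x * exp (- d))\<^sup>2 \<le> y\<^sup>2"
      using that(1) by (simp add: power_mult_distrib exp_double[symmetric])
    then have "x * exp (- d) \<le> y" using that(2) power2_le_imp_le by blast
    then show ?thesis by (simp add: exp_minus field_simps)
  qed
  show "norm (w b) \<le> exp (\<Lambda> b - \<Lambda> a) * norm (w a)"
  proof (rule sq)
    have "(norm (w b))\<^sup>2 * exp (- (2 * \<Lambda> b)) * exp (2 * \<Lambda> a)
        \<le> (norm (w a))\<^sup>2 * exp (- (2 * \<Lambda> a)) * exp (2 * \<Lambda> a)"
      using up unfolding f_def by (intro mult_right_mono) (auto simp: dot_square_norm)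
    then show "(norm (w b))\<^sup>2 * exp (- (2 * (\<Lambda> b - \<Lambda> a))) \<le> (norm (w a))\<^sup>2"
      by (simp add: algebra_simps exp_add[symmetric] flip: exp_minus)
  qed auto
  show "norm (w a) \<le> exp (\<Lambda> b - \<Lambda> a) * norm (w b)"
  proof (rule sq)
    have "(norm (w a))\<^sup>2 * exp (2 * \<Lambda> a) * exp (- (2 * \<Lambda> b))
        \<le> (norm (w b))\<^sup>2 * exp (2 * \<Lambda> b) * exp (- (2 * \<Lambda> b))"
      using lo unfolding f_def by (intro mult_right_mono) (auto simp: dot_square_norm)
    then show "(norm (w a))\<^sup>2 * exp (- (2 * (\<Lambda> b - \<Lambda> a))) \<le> (norm (w b))\<^sup>2"
      by (simp add: algebra_simps exp_add[symmetric] flip: exp_minus)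
  qed auto
qed

text \<open>The case of a constant rate. The first inequality gives uniqueness forward in time, the
  second uniqueness backward, hence injectivity of the flow.\<close>

lemma ode_solutions_dist:
  fixes u v :: "real \<Rightarrow> 'a::real_inner"
  assumes "a \<le> b" and "continuous_on {a..b} u" "continuous_on {a..b} v"
    and "\<And>t. \<lbrakk>a < t; t < b\<rbrakk> \<Longrightarrow> (u has_vector_derivative u' t) (at t)"
    and "\<And>t. \<lbrakk>a < t; t < b\<rbrakk> \<Longrightarrow> (v has_vector_derivative v' t) (at t)"
    and "\<And>t. \<lbrakk>a < t; t < b\<rbrakk> \<Longrightarrow> norm (u' t - v' t) \<le> L * norm (u t - v t)"
  shows "norm (u b - v b) \<le> exp (L * (b - a)) * norm (u a - v a)"
    and "norm (u a - v a) \<le> exp (L * (b - a)) * norm (u b - v b)"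
proof -
  have *: "continuous_on {a..b} (\<lambda>t. u t - v t)" "continuous_on {a..b} (\<lambda>t. L * t)"
    "\<And>t. \<lbrakk>a < t; t < b\<rbrakk> \<Longrightarrow> ((\<lambda>t. u t - v t) has_vector_derivative u' t - v' t) (at t)"
    "\<And>t. \<lbrakk>a < t; t < b\<rbrakk> \<Longrightarrow> ((\<lambda>t. L * t) has_real_derivative L) (at t)"
    using assms by (auto intro!: continuous_intros derivative_eq_intros)
  show "norm (u b - v b) \<le> exp (L * (b - a)) * norm (u a - v a)"
    "norm (u a - v a) \<le> exp (L * (b - a)) * norm (u b - v b)"
    using gronwall_two_sided[OF \<open>a \<le> b\<close> *, of ] assms(6) by (simp_all add: algebra_simps)
qed

text \<open>Contraction in a weighted supremum norm over the whole half line, so that no local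
  solutions have to be glued. Boundedness of \<open>g\<close> makes candidates grow at most
  linearly, which the exponential weight turns into bounded functions.\<close>

theorem picard_global:
  fixes g :: "real \<Rightarrow> 'a \<Rightarrow> 'a::banach" and x0 :: 'a
  assumes cont: "\<And>u. continuous_on UNIV u \<Longrightarrow> continuous_on UNIV (\<lambda>t. g t (u t))"
    and lip: "\<And>t x y. norm (g t x - g t y) \<le> L * norm (x - y)"
    and bdd: "\<And>t x. norm (g t x) \<le> B"
  obtains u where "u 0 = x0" "continuous_on UNIV u"
    "\<And>t. t \<ge> 0 \<Longrightarrow> (u has_vector_derivative g t (u t)) (at t within {0..})"
proof -
  \<comment> \<open>Positive even if \<open>L\<close> is not, so that the weight
    \<open>exp (- (2 * K * t))\<close> decays and division by \<open>K\<close> is possible.\<close>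
  define K where "K = max L 1"
  have K: "K > 0" "K \<ge> L" by (auto simp: K_def)
  have lipK: "norm (g t x - g t y) \<le> K * norm (x - y)" for t x y
    using lip[of t x y] K(2) by (meson mult_right_mono norm_ge_zero order_trans)
  have B0: "B \<ge> 0" using bdd[of 0 0] norm_ge_zero order_trans by blast
  \<comment> \<open>The unknown \<open>b\<close> stands for the weighted solution
    \<open>exp (- (2 * K * t)) *\<^sub>R u t\<close>; \<open>G\<close> undoes the weight before
    applying \<open>g\<close>. Below, \<open>max t 0\<close> freezes the integral at negative times,
    because bounded continuous functions are taken on the whole line.\<close>
  define G where "G = (\<lambda>b s. g s (exp (2 * K * s) *\<^sub>R apply_bcontfun b s))"
  define I where "I = (\<lambda>b t. x0 + integral {0..max t 0} (G b))"
  define \<Psi> where "\<Psi> = (\<lambda>b t. exp (- (2 * K * max t 0)) *\<^sub>R I b t)"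
  have Gc: "continuous_on UNIV (G b)" for b
    unfolding G_def by (intro cont continuous_intros continuous_on_apply_bcontfun)
  have Gi: "G b integrable_on {0..t}" for b t
    by (intro integrable_continuous_real continuous_on_subset[OF Gc]) auto
  have Ic: "continuous_on UNIV (I b)" for b
  proof -
    have "continuous_on {..n} (I b)" for n :: real
    proof -
      have "continuous_on {0..max n 0} (\<lambda>t. integral {0..t} (G b))"
        by (rule indefinite_integral_continuous_1) (rule Gi)
      then have "continuous_on {..n} (\<lambda>t. integral {0..max t 0} (G b))"
        by (rule continuous_on_compose2) (auto intro!: continuous_intros)
      then show ?thesis unfolding I_def by (intro continuous_intros)
    qed
    then have "continuous (at t) (I b)" for t
      by (rule continuous_on_interior[of "{..t+1}"]) auto
    then show ?thesis by (simp add: continuous_at_imp_continuous_on)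
  qed
  have \<Psi>c: "continuous_on UNIV (\<Psi> b)" for b
    unfolding \<Psi>_def by (intro continuous_intros Ic)
  have \<Psi>b: "\<Psi> b \<in> bcontfun" for b
  proof (rule bcontfun_normI[OF \<Psi>c])
    fix t :: real
    define s where "s = max t 0"
    have s: "s \<ge> 0" by (auto simp: s_def)
    have "norm (integral {0..s} (G b)) \<le> B * (s - 0)"
      by (rule integral_bound[OF s]) (auto simp: G_def intro!: bdd continuous_on_subset[OF Gc[unfolded G_def]])
    then have 1: "norm (I b t) \<le> norm x0 + B * s"
      unfolding I_def s_def[symmetric] using norm_triangle_le[of x0 "integral {0..s} (G b)"] by auto
    have "2 * K * s \<le> exp (2 * K * s)"
      using exp_ge_add_one_self[of "2 * K * s"] by linarith
    then have 2: "exp (- (2 * K * s)) * s \<le> 1 / (2 * K)"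
      using K by (simp add: exp_minus field_simps)
    have 3: "exp (- (2 * K * s)) \<le> 1" using K s by auto
    have "norm (\<Psi> b t) = exp (- (2 * K * s)) * norm (I b t)"
      by (simp add: \<Psi>_def s_def)
    also have "\<dots> \<le> exp (- (2 * K * s)) * (norm x0 + B * s)"
      by (intro mult_left_mono 1) auto
    also have "\<dots> = exp (- (2 * K * s)) * norm x0 + B * (exp (- (2 * K * s)) * s)"
      by (simp add: algebra_simps)
    also have "\<dots> \<le> 1 * norm x0 + B * (1 / (2 * K))"
      by (intro add_mono mult_right_mono mult_left_mono 2 3 B0) auto
    finally show "norm (\<Psi> b t) \<le> 1 * norm x0 + B * (1 / (2 * K))" .
  qed
  define \<Phi> where "\<Phi> = (\<lambda>b. Bcontfun (\<Psi> b))"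
  have ap: "apply_bcontfun (\<Phi> b) = \<Psi> b" for b
    unfolding \<Phi>_def by (rule Bcontfun_inverse[OF \<Psi>b])
  have contr: "dist (\<Phi> b) (\<Phi> c) \<le> 1/2 * dist b c" for b c
  proof (rule dist_bound)
    fix t :: real
    define s where "s = max t 0"
    have s: "s \<ge> 0" by (auto simp: s_def)
    define D where "D = dist b c"
    have D: "D \<ge> 0" by (auto simp: D_def)
    \<comment> \<open>Integrating the Lipschitz bound \<open>K\<close> against the weight of rate
      \<open>2 * K\<close> leaves the factor 1/2, the contraction constant.\<close>
    have "((\<lambda>r. D/2 * exp (2 * K * r)) has_vector_derivative D * K * exp (2 * K * r)) (at r within {0..s})" for r
      unfolding has_real_derivative_iff_has_vector_derivative[symmetric]
      by (auto intro!: derivative_eq_intros)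
    then have hi: "((\<lambda>r. D * K * exp (2 * K * r)) has_integral D/2 * exp (2 * K * s) - D/2 * exp (2 * K * 0)) {0..s}"
      by (intro fundamental_theorem_of_calculus s) auto
    have "norm (integral {0..s} (\<lambda>r. G b r - G c r)) \<le> integral {0..s} (\<lambda>r. D * K * exp (2 * K * r))"
    proof (rule integral_norm_bound_integral)
      show "(\<lambda>r. G b r - G c r) integrable_on {0..s}" by (intro integrable_diff Gi)
      show "(\<lambda>r. D * K * exp (2 * K * r)) integrable_on {0..s}" using hi by blast
      fix r assume "r \<in> {0..s}"
      have "norm (G b r - G c r) \<le> K * norm (exp (2 * K * r) *\<^sub>R apply_bcontfun b r - exp (2 * K * r) *\<^sub>R apply_bcontfun c r)"
        unfolding G_def by (rule lipK)
      also have "\<dots> = K * (exp (2 * K * r) * dist (apply_bcontfun b r) (apply_bcontfun c r))"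
        by (simp add: scaleR_diff_right[symmetric] dist_norm)
      also have "\<dots> \<le> K * (exp (2 * K * r) * D)"
        unfolding D_def using K by (intro mult_left_mono dist_bounded) auto
      finally show "norm (G b r - G c r) \<le> D * K * exp (2 * K * r)" by (simp add: algebra_simps)
    qed
    also have "\<dots> = D/2 * exp (2 * K * s) - D/2" using integral_unique[OF hi] by simp
    also have "\<dots> \<le> D/2 * exp (2 * K * s)" using D by simp
    finally have 1: "norm (integral {0..s} (\<lambda>r. G b r - G c r)) \<le> D/2 * exp (2 * K * s)" .
    have "\<Psi> b t - \<Psi> c t = exp (- (2 * K * s)) *\<^sub>R integral {0..s} (\<lambda>r. G b r - G c r)"
      unfolding \<Psi>_def I_def s_def[symmetric] by (simp add: integral_diff Gi scaleR_diff_right[symmetric])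
    then have "norm (\<Psi> b t - \<Psi> c t) \<le> exp (- (2 * K * s)) * (D/2 * exp (2 * K * s))"
      using 1 by simp
    also have "\<dots> = D / 2" by (simp add: exp_minus)
    finally show "dist (apply_bcontfun (\<Phi> b) t) (apply_bcontfun (\<Phi> c) t) \<le> 1/2 * dist b c"
      by (simp add: ap dist_norm D_def)
  qed
  obtain b where b: "\<Phi> b = b"
    using banach_fix_type[of "1/2" \<Phi>] contr by auto
  define u where "u = I b"
  have ub: "u t = exp (2 * K * t) *\<^sub>R apply_bcontfun b t" if "t \<ge> 0" for t
  proof -
    have "apply_bcontfun b t = \<Psi> b t" using ap[of b] b by simp
    then show ?thesis using that by (simp add: \<Psi>_def u_def exp_minus)
  qed
  show thesis
  proof
    show "u 0 = x0" by (simp add: u_def I_def)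
    show "continuous_on UNIV u" unfolding u_def by (rule Ic)
    fix t :: real assume t: "t \<ge> 0"
    have "((\<lambda>t. integral {0..t} (G b)) has_vector_derivative G b t) (at t within {0..t+1})"
      by (rule integral_has_vector_derivative) (use t in \<open>auto intro: continuous_on_subset[OF Gc]\<close>)
    then have "((\<lambda>t. x0 + integral {0..t} (G b)) has_vector_derivative G b t) (at t within {0..t+1})"
      using has_vector_derivative_add[OF has_vector_derivative_const] by fastforce
    moreover have "at t within {0..t+1} = at t within {0..}"
      by (rule at_within_nhd[of t "{..<t+1}"]) (use t in auto)
    ultimately have "((\<lambda>t. x0 + integral {0..t} (G b)) has_vector_derivative G b t) (at t within {0..})"
      by simp
    moreover have "G b t = g t (u t)" by (simp add: G_def ub t)
    moreover have "x0 + integral {0..s} (G b) = u s" if "s \<ge> 0" for s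
      using that by (simp add: u_def I_def)
    ultimately show "(u has_vector_derivative g t (u t)) (at t within {0..})"
      using t by (auto elim!: has_vector_derivative_transform[rotated 2])
  qed
qed

section \<open>Areas and lengths\<close>

text \<open>A cover of \<open>A\<close> by nonoverlapping intervals of almost the same total length
  is mapped to intervals, each at most \<open>K\<close> times as long. The factor has to be exactly
  \<open>K\<close>: the existence of the limiting hitting probability rests on it. The set
  \<open>B\<close> inside the image spares a proof that the image is measurable.\<close>

lemma lipschitz_image_measure_le:
  fixes h :: "real \<Rightarrow> real"
  assumes lip: "\<And>x y. \<bar>h x - h y\<bar> \<le> K * \<bar>x - y\<bar>"
    and A: "A \<in> lmeasurable" "A \<subseteq> {a..b}" and B: "B \<in> sets lebesgue" "B \<subseteq> h ` A"
  shows "measure lebesgue B \<le> K * measure lebesgue A"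
proof (rule field_le_epsilon)
  fix e :: real assume e: "e > 0"
  have K0: "K \<ge> 0" using order_trans[OF abs_ge_zero lip[of 0 1]] by simp
  define e' where "e' = e / (K + 1)"
  have e': "e' > 0" using e K0 by (simp add: e'_def)
  have "A \<subseteq> cbox a b" using A(2) by simp
  obtain \<D> where \<D>: "countable \<D>" "\<And>D. D \<in> \<D> \<Longrightarrow> D \<subseteq> cbox a b \<and> D \<noteq> {} \<and> (\<exists>c d. D = cbox c d)"
    "pairwise (\<lambda>A B. interior A \<inter> interior B = {}) \<D>"
    and "\<And>u v. cbox u v \<in> \<D> \<Longrightarrow> \<exists>n. \<forall>i\<in>Basis. v \<bullet> i - u \<bullet> i = (b \<bullet> i - a \<bullet> i) / 2 ^ n"
    "\<And>D. \<lbrakk>D \<in> \<D>; box a b \<noteq> {}\<rbrakk> \<Longrightarrow> interior D \<noteq> {}"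
    and \<D>': "A \<subseteq> \<Union>\<D>" "\<Union>\<D> \<in> lmeasurable" "measure lebesgue (\<Union>\<D>) \<le> measure lebesgue A + e'"
    by (rule measurable_outer_intervals_bounded[OF A(1) \<open>A \<subseteq> cbox a b\<close> e'], rule that)
  have ch: "continuous_on S h" for S
  proof -
    have "K-lipschitz_on S h" unfolding lipschitz_on_def dist_real_def using lip K0 by blast
    then show ?thesis by (rule lipschitz_on_continuous_on)
  qed
  have img: "h ` D \<in> lmeasurable \<and> measure lebesgue (h ` D) \<le> K * measure lebesgue D" if D: "D \<in> \<D>" for D
  proof -
    obtain c d where "D = cbox c d" "D \<noteq> {}" using \<D>(2)[OF D] by blast
    then have cd: "D = {c..d}" "c \<le> d" by auto
    have "compact (h ` D)" unfolding cd(1) by (rule compact_continuous_image[OF ch compact_Icc])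
    moreover have "connected (h ` D)" unfolding cd(1) by (rule connected_continuous_image[OF ch connected_Icc])
    ultimately have "connected (h ` D) \<and> compact (h ` D)" by (rule conjI[rotated])
    then obtain p q where pq: "h ` D = {p..q}" unfolding connected_compact_interval_1 by (elim exE)
    have "h ` D \<noteq> {}" using \<open>D \<noteq> {}\<close> by blast
    then have "p \<le> q" unfolding pq by simp
    then have "p \<in> h ` D" "q \<in> h ` D" unfolding pq by simp_all
    then obtain x y where xy: "x \<in> D" "y \<in> D" "p = h x" "q = h y" by blast
    have "q - p \<le> K * \<bar>y - x\<bar>" using lip[of y x] xy(3,4) by linarith
    also have "\<dots> \<le> K * (d - c)" using xy(1,2) K0 unfolding cd(1) by (intro mult_left_mono) auto
    finally show ?thesis unfolding pq using cd \<open>p \<le> q\<close> by simp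
  qed
  have Dm: "D \<in> lmeasurable" if "D \<in> \<D>" for D using \<D>(2)[OF that] by auto
  show "measure lebesgue B \<le> K * measure lebesgue A + e"
  proof (cases "\<D> = {}")
    case True
    then have "B = {}" using \<D>'(1) B by auto
    then show ?thesis using K0 e by simp
  next
    case False
    define X where "X = from_nat_into \<D>"
    have X: "X i \<in> \<D>" for i unfolding X_def using False by (rule from_nat_into)
    have rX: "range X = \<D>" unfolding X_def using False \<D>(1) by (rule range_from_nat_into)
    have fin: "measure lebesgue (\<Union>i\<le>n. h ` X i) \<le> K * (measure lebesgue A + e')" for n
    proof -
      \<comment> \<open>Taken as a set, so that repetitions in the enumeration of a finite
        \<open>\<D>\<close> are not counted twice.\<close>
      define F where "F = X ` {..n}"
      have F: "finite F" "F \<subseteq> \<D>" using X by (auto simp: F_def)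
      have "(\<Union>i\<le>n. h ` X i) = (\<Union>D\<in>F. h ` D)" by (auto simp: F_def)
      also have "measure lebesgue \<dots> \<le> (\<Sum>D\<in>F. measure lebesgue (h ` D))"
        using F img by (intro measure_UNION_le) (auto intro: fmeasurableD)
      also have "\<dots> \<le> (\<Sum>D\<in>F. K * measure lebesgue D)"
        using F img by (intro sum_mono) auto
      also have "\<dots> = K * measure lebesgue (\<Union>F)"
      proof -
        have "measure lebesgue (\<Union>F) = (\<Sum>D\<in>F. measure lebesgue D)"
        proof (rule measure_negligible_finite_Union)
          show "pairwise (\<lambda>S T. negligible (S \<inter> T)) F"
          proof (clarsimp simp: pairwise_def)
            fix S T assume ST: "S \<in> F" "T \<in> F" "S \<noteq> T"
            then have i: "interior S \<inter> interior T = {}" using \<D>(3) F by (auto simp: pairwise_def)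
            have cv: "convex (S \<inter> T)"
            proof -
              have "convex S" "convex T" using \<D>(2)[of S] \<D>(2)[of T] ST F by auto
              then show ?thesis by (rule convex_Int)
            qed
            \<comment> \<open>With empty interior the intersection lies in its own frontier, and the
              frontier of a convex set is negligible.\<close>
            have "S \<inter> T \<subseteq> frontier (S \<inter> T)"
              using i closure_subset[of "S \<inter> T"] unfolding frontier_def interior_Int by blast
            then show "negligible (S \<inter> T)"
              using negligible_convex_frontier[OF cv] negligible_subset by blast
          qed
        qed (use F Dm in auto)
        then show ?thesis by (simp add: sum_distrib_left)
      qed
      also have "\<dots> \<le> K * measure lebesgue (\<Union>\<D>)"
        using F Dm \<D>'(2) K0 by (intro mult_left_mono measure_mono_fmeasurable)
          (auto intro!: sets.finite_Union fmeasurableD)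
      also have "\<dots> \<le> K * (measure lebesgue A + e')" using \<D>'(3) K0 by (intro mult_left_mono) auto
      finally show ?thesis .
    qed
    have m: "h ` X i \<in> lmeasurable" for i using img X by blast
    have "B \<subseteq> (\<Union>i. h ` X i)"
    proof
      fix y assume "y \<in> B"
      then obtain x where x: "x \<in> A" "y = h x" using B(2) by auto
      then obtain D where "D \<in> \<D>" "x \<in> D" using \<D>'(1) by auto
      then obtain i where "x \<in> X i" using rX by (metis rangeE)
      then show "y \<in> (\<Union>i. h ` X i)" using x by auto
    qed
    then have "measure lebesgue B \<le> measure lebesgue (\<Union>i. h ` X i)"
      using fmeasurable_countable_Union[OF m fin] B by (intro measure_mono_fmeasurable) auto
    also have "\<dots> \<le> K * (measure lebesgue A + e')"
      by (rule measure_countable_Union_le[OF m fin])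
    also have "\<dots> \<le> K * measure lebesgue A + e"
    proof -
      have "K * e' \<le> e" using e K0 by (simp add: e'_def field_simps)
      then show ?thesis by (simp add: algebra_simps)
    qed
    finally show ?thesis .
  qed
qed

section \<open>Polar coordinates in the plane\<close>

lemma vector2_eq_axis: "(vector [a, b] :: real^2) = a *\<^sub>R axis 1 1 + b *\<^sub>R axis 2 1"
  by (simp add: vec_eq_iff forall_2 axis_def)

lemma vector2_measurable [measurable]:
  "(\<lambda>(a, b). vector [a, b] :: real^2) \<in> (lborel \<Otimes>\<^sub>M lborel) \<rightarrow>\<^sub>M borel"
proof -
  have "continuous_on UNIV (\<lambda>(a, b). vector [a, b] :: real^2)"
    unfolding vector2_eq_axis case_prod_unfold by (intro continuous_intros)
  then have "(\<lambda>(a, b). vector [a, b] :: real^2) \<in> borel_measurable borel"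
    by (rule borel_measurable_continuous_onI)
  then show ?thesis by (simp add: lborel_prod)
qed

lemma Basis_real2: "(Basis :: (real^2) set) = {axis 1 1, axis 2 1}"
  by (auto simp: Basis_vec_def UNIV_2)

text \<open>Makes Fubini available for \<open>real^2\<close>: the parameter domain of polar
  coordinates can then be sliced by radius. Both measures agree on boxes, which determines
  them.\<close>

lemma lborel_real2_eq_distr:
  "(lborel :: (real^2) measure) = distr (lborel \<Otimes>\<^sub>M lborel) borel (\<lambda>(a, b). vector [a, b])"
proof (rule lborel_eqI)
  fix l u :: "real^2" assume lu: "\<And>b. b \<in> Basis \<Longrightarrow> l \<bullet> b \<le> u \<bullet> b"
  have ne: "axis 1 1 \<noteq> (axis 2 1 :: real^2)" by (simp add: axis_eq_axis)
  have lu': "l $ 1 \<le> u $ 1" "l $ 2 \<le> u $ 2"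
    using lu[of "axis 1 1"] lu[of "axis 2 1"] by (auto simp: inner_axis Basis_real2)
  have "(\<lambda>(a, b). vector [a, b] :: real^2) -` box l u \<inter> space (lborel \<Otimes>\<^sub>M lborel)
      = {l $ 1<..<u $ 1} \<times> {l $ 2<..<u $ 2}"
    by (auto simp: box_def Basis_real2 inner_axis space_pair_measure)
  then have "emeasure (distr (lborel \<Otimes>\<^sub>M lborel) borel (\<lambda>(a, b). vector [a, b])) (box l u)
      = emeasure (lborel \<Otimes>\<^sub>M lborel) ({l $ 1<..<u $ 1} \<times> {l $ 2<..<u $ 2})"
    by (subst emeasure_distr) (auto intro: vector2_measurable)
  also have "\<dots> = ennreal (u $ 1 - l $ 1) * ennreal (u $ 2 - l $ 2)"
    using lu' by (subst lborel.emeasure_pair_measure_Times) auto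
  also have "\<dots> = (\<Prod>b\<in>Basis. (u - l) \<bullet> b)"
    using lu' ne by (simp add: Basis_real2 inner_axis ennreal_mult)
  finally show "emeasure (distr (lborel \<Otimes>\<^sub>M lborel) borel (\<lambda>(a, b). vector [a, b])) (box l u)
      = (\<Prod>b\<in>Basis. (u - l) \<bullet> b)" .
qed simp

lemma circle_point_nth [simp]:
  "circle_point r \<theta> $ 1 = r * cos \<theta>" "circle_point r \<theta> $ 2 = r * sin \<theta>"
  by (simp_all add: circle_point_def)

lemma inner_real2: "(v :: real^2) \<bullet> w = v $ 1 * w $ 1 + v $ 2 * w $ 2"
  by (simp add: inner_vec_def sum_2)

lemma norm_circle_point: "norm (circle_point r \<theta>) = \<bar>r\<bar>"
proof -
  have "(norm (circle_point r \<theta>))\<^sup>2 = r\<^sup>2 * ((cos \<theta>)\<^sup>2 + (sin \<theta>)\<^sup>2)"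
    by (simp only: power2_norm_eq_inner inner_real2 circle_point_nth) (simp only: power2_eq_square algebra_simps)
  then show ?thesis using norm_ge_zero power2_eq_iff_nonneg[of "norm (circle_point r \<theta>)" "\<bar>r\<bar>"] by simp
qed

lemma circle_point_inj:
  assumes "circle_point r \<theta> = circle_point r' \<theta>'" "r > 0" "r' > 0" "\<theta> \<in> {0..<2*pi}" "\<theta>' \<in> {0..<2*pi}"
  shows "r = r'" "\<theta> = \<theta>'"
proof -
  show r: "r = r'" using assms norm_circle_point[of r \<theta>] norm_circle_point[of r' \<theta>'] by simp
  have "cos \<theta> = cos \<theta>'" "sin \<theta> = sin \<theta>'"
    using assms(1) r \<open>r > 0\<close> by (auto simp: vec_eq_iff forall_2)
  then obtain k :: int where k: "\<theta> = \<theta>' + 2 * pi * k" using sin_cos_eq_iff by metis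
  have "\<bar>2 * pi * k\<bar> < 2 * pi" using k assms(4,5) by auto
  then have "\<bar>real_of_int k\<bar> < 1" by (simp add: abs_mult)
  then have "k = 0" by linarith
  then show "\<theta> = \<theta>'" using k by simp
qed

lemma continuous_on_circle_point [continuous_intros]:
  "continuous_on S f \<Longrightarrow> continuous_on S g \<Longrightarrow> continuous_on S (\<lambda>x. circle_point (f x) (g x))"
  unfolding circle_point_def vector2_eq_axis
  by (intro continuous_intros continuous_on_compose2[of UNIV cos S g] continuous_on_compose2[of UNIV sin S g]) auto

text \<open>The Jacobian of polar coordinates is the radius, hence at least \<open>R\<close> on the
  parameter set; that set has area at least \<open>c * (R' - R)\<close> because each of its slices
  at fixed radius has length at least \<open>c\<close>.\<close>

lemma polar_area_ge:
  assumes A: "A \<in> sets borel" "bounded A" and R: "0 < R" "R \<le> R'" and "c \<ge> 0"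
    and arc: "\<And>\<rho>. \<lbrakk>R < \<rho>; \<rho> < R'\<rbrakk> \<Longrightarrow> c \<le> measure lborel {\<theta>\<in>{0..<2*pi}. circle_point \<rho> \<theta> \<in> A}"
  shows "R * c * (R' - R) \<le> measure lborel A"
proof -
  define f where "f = (\<lambda>v :: real^2. circle_point (v $ 1) (v $ 2))"
  define f' where "f' = (\<lambda>(v :: real^2) (w :: real^2). vector [cos (v $ 2) * w $ 1 - v $ 1 * sin (v $ 2) * w $ 2,
    sin (v $ 2) * w $ 1 + v $ 1 * cos (v $ 2) * w $ 2] :: real^2)"
  \<comment> \<open>Half-open angles and positive radii make \<open>f\<close> injective on
    \<open>S\<close>; the open interval of radii matches the range where \<open>arc\<close> is
    assumed.\<close>
  define S where "S = {v :: real^2. v $ 1 \<in> {R<..<R'} \<and> v $ 2 \<in> {0..<2*pi} \<and> f v \<in> A}"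
  have cf: "continuous_on UNIV f" unfolding f_def by (intro continuous_intros)
  have [measurable]: "f \<in> borel_measurable borel"
    using cf by (rule borel_measurable_continuous_onI)
  have [measurable]: "(\<lambda>v :: real^2. v $ i) \<in> borel_measurable borel" for i
    by (intro borel_measurable_continuous_onI continuous_intros)
  have S: "S \<in> sets borel" unfolding S_def using A(1) by measurable
  have "S \<subseteq> cbox (vector [R, 0]) (vector [R', 2*pi])"
    by (auto simp: S_def mem_box_cart forall_2)
  then have bS: "bounded S" using bounded_cbox bounded_subset by blast
  then have lS: "S \<in> lmeasurable" using S by (auto intro!: bounded_set_imp_lmeasurable)
  have fS: "f ` S \<subseteq> A" by (auto simp: S_def)
  have inj: "inj_on f S"
  proof (rule inj_onI)
    fix v w assume vw: "v \<in> S" "w \<in> S" "f v = f w"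
    then have "v $ 1 = w $ 1" "v $ 2 = w $ 2"
      using circle_point_inj[of "v $ 1" "v $ 2" "w $ 1" "w $ 2"] R(1) unfolding f_def S_def by auto
    then show "v = w" by (simp add: vec_eq_iff forall_2)
  qed
  have der: "(f has_derivative f' v) (at v within S)" for v :: "real^2"
  proof -
    have c: "((\<lambda>v :: real^2. v $ i) has_derivative (\<lambda>w :: real^2. w $ i)) (at v within S)" for i
      by (rule bounded_linear_imp_has_derivative[OF bounded_linear_vec_nth])
    have "((\<lambda>v :: real^2. v $ 1 * cos (v $ 2)) has_derivative
        (\<lambda>w :: real^2. cos (v $ 2) * w $ 1 - v $ 1 * sin (v $ 2) * w $ 2)) (at v within S)"
      by (rule has_derivative_eq_rhs[OF has_derivative_mult[OF c has_derivative_cos[OF c]]])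
         (simp add: fun_eq_iff algebra_simps)
    moreover have "((\<lambda>v :: real^2. v $ 1 * sin (v $ 2)) has_derivative
        (\<lambda>w :: real^2. sin (v $ 2) * w $ 1 + v $ 1 * cos (v $ 2) * w $ 2)) (at v within S)"
      by (rule has_derivative_eq_rhs[OF has_derivative_mult[OF c has_derivative_sin[OF c]]])
         (simp add: fun_eq_iff algebra_simps)
    ultimately have "((\<lambda>v :: real^2. circle_point (v $ 1) (v $ 2)) has_derivative f' v) (at v within S)"
      unfolding circle_point_def vector2_eq_axis f'_def
      by (intro has_derivative_add has_derivative_scaleR_left)
    then show ?thesis by (simp add: f_def)
  qed
  have det: "det (matrix (f' v)) = v $ 1" for v
  proof -
    have "det (matrix (f' v)) = v $ 1 * (cos (v $ 2) * cos (v $ 2)) + v $ 1 * (sin (v $ 2) * sin (v $ 2))"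
      by (simp only: det_2 matrix_def f'_def) (simp add: axis_def algebra_simps)
    also have "\<dots> = v $ 1 * ((cos (v $ 2))\<^sup>2 + (sin (v $ 2))\<^sup>2)"
      by (simp only: power2_eq_square distrib_left)
    finally have "det (matrix (f' v)) = v $ 1 * ((cos (v $ 2))\<^sup>2 + (sin (v $ 2))\<^sup>2)" .
    then show ?thesis by simp
  qed
  have int: "(\<lambda>v. \<bar>det (matrix (f' v))\<bar>) integrable_on S"
  proof (rule measurable_bounded_by_integrable_imp_integrable)
    show "(\<lambda>v. \<bar>det (matrix (f' v))\<bar>) \<in> borel_measurable (lebesgue_on S)"
      unfolding det by (intro measurable_restrict_space1 measurable_completion) simp
    show "(\<lambda>v. R') integrable_on S" using lS by (rule integrable_on_const)
    show "norm \<bar>det (matrix (f' v))\<bar> \<le> R'" if "v \<in> S" for v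
      using that R by (auto simp: det S_def)
  qed (use lS in auto)
  have "R * measure lebesgue S = integral S (\<lambda>v. R)"
    using lS by (simp add: lmeasure_integral flip: integral_mult_right)
  also have "\<dots> \<le> integral S (\<lambda>v. \<bar>det (matrix (f' v))\<bar>)"
    by (intro integral_le int integrable_on_const lS) (auto simp: det S_def)
  also have "\<dots> = measure lebesgue (f ` S)"
    by (rule measure_differentiable_image_eq[symmetric, OF _ der inj int]) (use lS in auto)
  also have "\<dots> \<le> measure lebesgue A"
  proof (rule measure_mono_fmeasurable[OF fS])
    show "f ` S \<in> sets lebesgue"
      using measurable_differentiable_image[OF _ der int] lS by blast
    show "A \<in> lmeasurable" using A by (intro bounded_set_imp_lmeasurable) auto
  qed
  finally have 1: "R * measure lebesgue S \<le> measure lebesgue A" .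
  \<comment> \<open>From here on Fubini: the area of \<open>S\<close> is the integral of its slice
    lengths over the radius.\<close>
  have SB: "(\<lambda>(a, b). vector [a, b] :: real^2) -` S \<inter> space (lborel \<Otimes>\<^sub>M lborel) \<in> sets (lborel \<Otimes>\<^sub>M lborel)"
    by (rule measurable_sets[OF vector2_measurable]) (use S in simp)
  have "ennreal (c * (R' - R)) = (\<integral>\<^sup>+\<rho>. ennreal c * indicator {R<..<R'} \<rho> \<partial>lborel)"
    using R \<open>c \<ge> 0\<close> by (simp add: nn_integral_cmult ennreal_mult)
  also have "\<dots> \<le> (\<integral>\<^sup>+\<rho>. emeasure lborel (Pair \<rho> -` ((\<lambda>(a, b). vector [a, b] :: real^2) -` S \<inter> space (lborel \<Otimes>\<^sub>M lborel))) \<partial>lborel)"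
  proof (rule nn_integral_mono)
    fix \<rho> :: real
    have "emeasure lborel {\<theta>\<in>{0..<2*pi}. circle_point \<rho> \<theta> \<in> A} \<le> emeasure lborel {0..2*pi}"
      by (rule emeasure_mono) auto
    then have fin: "emeasure lborel {\<theta>\<in>{0..<2*pi}. circle_point \<rho> \<theta> \<in> A} \<noteq> \<infinity>"
      by (auto simp: top_unique)
    show "ennreal c * indicator {R<..<R'} \<rho> \<le> emeasure lborel (Pair \<rho> -` ((\<lambda>(a, b). vector [a, b] :: real^2) -` S \<inter> space (lborel \<Otimes>\<^sub>M lborel)))"
    proof (cases "\<rho> \<in> {R<..<R'}")
      case True
      have "Pair \<rho> -` ((\<lambda>(a, b). vector [a, b] :: real^2) -` S \<inter> space (lborel \<Otimes>\<^sub>M lborel))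
          = {\<theta>\<in>{0..<2*pi}. circle_point \<rho> \<theta> \<in> A}"
        using True by (auto simp: S_def f_def space_pair_measure)
      then show ?thesis using True arc[of \<rho>] fin
        by (simp add: emeasure_eq_ennreal_measure ennreal_leI)
    qed simp
  qed
  also have "\<dots> = emeasure (lborel \<Otimes>\<^sub>M lborel) ((\<lambda>(a, b). vector [a, b] :: real^2) -` S \<inter> space (lborel \<Otimes>\<^sub>M lborel))"
    by (rule lborel.emeasure_pair_measure_alt[symmetric, OF SB])
  also have "\<dots> = emeasure lborel S"
    by (subst lborel_real2_eq_distr, subst emeasure_distr[OF vector2_measurable]) (use S in auto)
  finally have "ennreal (c * (R' - R)) \<le> ennreal (measure lborel S)"
    using emeasure_bounded_finite[OF bS] by (simp add: emeasure_eq_ennreal_measure)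
  then have "c * (R' - R) \<le> measure lborel S" by simp
  then have "R * (c * (R' - R)) \<le> R * measure lborel S" using R by (intro mult_left_mono) auto
  then show ?thesis using 1 S A(1) by (simp add: algebra_simps)
qed

section \<open>Sums over separated points\<close>

text \<open>If the values are sorted, the m-th smallest one, s, has m elements below or at it, so m
  \<le> C * s^2 and s \<ge> sqrt (m / C). The induction removes a largest value, which has rank
  \<open>card J\<close>.\<close>

lemma sum_powr_le_rank:
  fixes d :: "'a \<Rightarrow> real"
  assumes "finite J" "C > 0" "q \<ge> 0"
    and "\<And>j. j \<in> J \<Longrightarrow> d j \<ge> 1"
    and "\<And>s. s \<ge> 1 \<Longrightarrow> real (card {j\<in>J. d j \<le> s}) \<le> C * s\<^sup>2"
  shows "(\<Sum>j\<in>J. d j powr (- q)) \<le> (\<Sum>m=1..card J. sqrt (real m / C) powr (- q))"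
  using assms
proof (induction "card J" arbitrary: J)
  case 0
  then show ?case by simp
next
  case (Suc k)
  then have "J \<noteq> {}" by auto
  then have "Max (d ` J) \<in> d ` J" using Suc.prems by (intro Max_in) auto
  then obtain i where i: "i \<in> J" "Max (d ` J) = d i" by auto
  have max: "d j \<le> d i" if "j \<in> J" for j using that Suc.prems(1) i(2) Max_ge[of "d ` J" "d j"] by auto
  have k: "card (J - {i}) = k" using Suc i by simp
  have "{j\<in>J. d j \<le> d i} = J" using max by auto
  then have "real (card J) \<le> C * (d i)\<^sup>2" using Suc.prems(5)[of "d i"] Suc.prems(4)[OF i(1)] by simp
  then have "real (card J) / C \<le> (d i)\<^sup>2" using Suc.prems(2) by (simp add: field_simps)
  then have "sqrt (real (card J) / C) \<le> d i"
    using Suc.prems(4)[OF i(1)] by (intro real_le_lsqrt) auto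
  moreover have "0 < sqrt (real (card J) / C)" using Suc.hyps(2) Suc.prems(2) by simp
  ultimately have last: "d i powr (- q) \<le> sqrt (real (card J) / C) powr (- q)"
    using Suc.prems(3) by (intro powr_mono2') auto
  have "(\<Sum>j\<in>J - {i}. d j powr (- q)) \<le> (\<Sum>m=1..card (J - {i}). sqrt (real m / C) powr (- q))"
  proof (rule Suc.hyps(1))
    fix s :: real assume "s \<ge> 1"
    have "card {j \<in> J - {i}. d j \<le> s} \<le> card {j\<in>J. d j \<le> s}"
      using Suc.prems(1) by (intro card_mono) auto
    then show "real (card {j \<in> J - {i}. d j \<le> s}) \<le> C * s\<^sup>2"
      using Suc.prems(5)[OF \<open>s \<ge> 1\<close>] by linarith
  qed (use Suc.prems k in auto)
  moreover have "(\<Sum>j\<in>J. d j powr (- q)) = d i powr (- q) + (\<Sum>j\<in>J - {i}. d j powr (- q))"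
    using i Suc.prems(1) by (simp add: sum.remove)
  moreover have "(\<Sum>m=1..card J. sqrt (real m / C) powr (- q))
      = (\<Sum>m=1..k. sqrt (real m / C) powr (- q)) + sqrt (real (card J) / C) powr (- q)"
    unfolding Suc.hyps(2)[symmetric] by simp
  ultimately show ?case using last unfolding k by linarith
qed

text \<open>Comparison with the integral of \<open>t powr (- s)\<close>, carried out as a
  telescoping sum via the mean value theorem.\<close>

lemma sum_powr_minus_le:
  fixes s :: real
  assumes "0 \<le> s" "s < 1"
  shows "(\<Sum>m=1..n. real m powr (- s)) \<le> real n powr (1 - s) / (1 - s)"
proof (induction n)
  case (Suc n)
  have step: "(1 - s) * real (Suc n) powr (- s) \<le> real (Suc n) powr (1 - s) - real n powr (1 - s)"
  proof (cases "n = 0")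
    case False
    have der: "((\<lambda>t. t powr (1 - s)) has_real_derivative (1 - s) * t powr (- s)) (at t)" if "t > 0" for t
      using has_real_derivative_powr[OF that, of "1 - s"] by simp
    have "real n < real (Suc n)" by simp
    then obtain t where t: "real n < t" "t < real (Suc n)"
      "real (Suc n) powr (1 - s) - real n powr (1 - s) = (real (Suc n) - real n) * ((1 - s) * t powr (- s))"
      using MVT2[of "real n" "real (Suc n)" "\<lambda>t. t powr (1 - s)" "\<lambda>t. (1 - s) * t powr (- s)"] der False by auto
    have "real (Suc n) powr (- s) \<le> t powr (- s)"
      using t assms by (intro powr_mono2') auto
    then show ?thesis using t(3) assms by (simp add: mult_left_mono)
  qed (use assms in auto)
  have "(\<Sum>m=1..Suc n. real m powr (- s)) \<le> real n powr (1 - s) / (1 - s) + real (Suc n) powr (- s)"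
    using Suc.IH by simp
  also have "\<dots> = (real n powr (1 - s) + (1 - s) * real (Suc n) powr (- s)) / (1 - s)"
    using assms by (simp add: add_divide_distrib)
  also have "\<dots> \<le> real (Suc n) powr (1 - s) / (1 - s)"
    using step assms by (intro divide_right_mono) auto
  finally show ?case .
qed simp

text \<open>The disks of radius 1/2 around the counted points are disjoint and lie in the disk of
  radius \<open>s + 1/2\<close> around \<open>y\<close>; compare areas.\<close>

lemma packing_card_le:
  fixes x :: "'a \<Rightarrow> real^2"
  assumes "finite J" "\<And>i j. \<lbrakk>i \<in> J; j \<in> J; i \<noteq> j\<rbrakk> \<Longrightarrow> dist (x i) (x j) \<ge> 1" "s \<ge> 0"
  shows "real (card {j\<in>J. dist y (x j) \<le> s}) \<le> (2 * s + 1)\<^sup>2"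
proof -
  define N where "N = {j\<in>J. dist y (x j) \<le> s}"
  have N: "finite N" "N \<subseteq> J" using assms by (auto simp: N_def)
  have "real (card N) * (pi / 4) = (\<Sum>j\<in>N. measure lborel (ball (x j) (1/2)))"
    by (simp add: circle_area power2_eq_square)
  also have "\<dots> = measure lborel (\<Union>j\<in>N. ball (x j) (1/2))"
  proof (rule measure_finite_Union[symmetric])
    show "disjoint_family_on (\<lambda>j. ball (x j) (1/2)) N"
      unfolding disjoint_family_on_def
    proof (intro ballI impI)
      fix i j assume "i \<in> N" "j \<in> N" "i \<noteq> j"
      then have d: "dist (x i) (x j) \<ge> 1" using assms(2) N by auto
      show "ball (x i) (1/2) \<inter> ball (x j) (1/2) = {}"
      proof safe
        fix z assume "z \<in> ball (x i) (1/2)" "z \<in> ball (x j) (1/2)"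
        then have "dist (x i) (x j) < 1/2 + 1/2" by (intro dist_triangle_less_add) (auto simp: dist_commute)
        then show "z \<in> {}" using d by simp
      qed
    qed
    show "emeasure lborel (ball (x i) (1/2)) \<noteq> \<infinity>" for i
      using emeasure_lborel_ball_finite[of "x i" "1/2"] by simp
  qed (use N in auto)
  also have "\<dots> \<le> measure lborel (ball y (s + 1/2))"
  proof (rule measure_mono_fmeasurable)
    show "(\<Union>j\<in>N. ball (x j) (1/2)) \<subseteq> ball y (s + 1/2)"
    proof safe
      fix j z assume "j \<in> N" "z \<in> ball (x j) (1/2)"
      then show "z \<in> ball y (s + 1/2)"
        using dist_triangle[of y z "x j"] by (auto simp: N_def)
    qed
    show "ball y (s + 1 / 2) \<in> fmeasurable lborel"
      using emeasure_lborel_ball_finite by (auto simp: fmeasurable_def)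
  qed (auto intro!: borel_open)
  also have "\<dots> = (s + 1/2)\<^sup>2 * pi" using assms(3) by (simp add: circle_area)
  finally have "real (card N) * (pi / 4) \<le> (2 * s + 1)\<^sup>2 * (pi / 4)"
    by (simp add: power2_eq_square algebra_simps)
  then show ?thesis by (simp add: N_def)
qed

text \<open>Packing gives the rank bound with C = 9, since 2 s + 1 \<le> 3 s for s \<ge> 1. The
  resulting exponent (\<alpha> + 1) / 2 is below 1 exactly because \<alpha> < 1, and 18 / (1 -
  \<alpha>) is 9 divided by 1 - (\<alpha> + 1) / 2.\<close>

lemma separated_sum_powr_le:
  fixes x :: "'a \<Rightarrow> real^2"
  assumes J: "finite J" "\<And>i j. \<lbrakk>i \<in> J; j \<in> J; i \<noteq> j\<rbrakk> \<Longrightarrow> dist (x i) (x j) \<ge> 1"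
    and y: "\<And>j. j \<in> J \<Longrightarrow> dist y (x j) \<ge> 1" and \<alpha>: "0 \<le> \<alpha>" "\<alpha> < 1"
  shows "(\<Sum>j\<in>J. dist y (x j) powr (- (\<alpha> + 1))) \<le> 18 / (1 - \<alpha>) * real (card J) powr ((1 - \<alpha>) / 2)"
proof -
  have "(\<Sum>j\<in>J. dist y (x j) powr (- (\<alpha> + 1))) \<le> (\<Sum>m=1..card J. sqrt (real m / 9) powr (- (\<alpha> + 1)))"
  proof (rule sum_powr_le_rank)
    fix s :: real assume s: "s \<ge> 1"
    have "real (card {j\<in>J. dist y (x j) \<le> s}) \<le> (2 * s + 1)\<^sup>2"
      using s by (intro packing_card_le J) auto
    also have "\<dots> \<le> (3 * s)\<^sup>2" using s by (intro power_mono) auto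
    finally show "real (card {j\<in>J. dist y (x j) \<le> s}) \<le> 9 * s\<^sup>2" by (simp add: power_mult_distrib)
  qed (use J y \<alpha> in auto)
  also have "\<dots> \<le> (\<Sum>m=1..card J. 9 * real m powr (- ((\<alpha> + 1) / 2)))"
  proof (rule sum_mono)
    fix m assume m: "m \<in> {1..card J}"
    have "sqrt (real m / 9) powr (- (\<alpha> + 1)) = ((real m / 9) powr (1 / 2)) powr (- (\<alpha> + 1))"
      by (subst powr_half_sqrt) auto
    also have "\<dots> = (real m / 9) powr (1 / 2 * (- (\<alpha> + 1)))" by (rule powr_powr)
    also have "1 / 2 * (- (\<alpha> + 1)) = - ((\<alpha> + 1) / 2)" by (simp add: field_simps)
    also have "(real m / 9) powr (- ((\<alpha> + 1) / 2)) = real m powr (- ((\<alpha> + 1) / 2)) * 9 powr ((\<alpha> + 1) / 2)"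
      by (simp add: powr_divide powr_minus field_simps)
    also have "\<dots> \<le> real m powr (- ((\<alpha> + 1) / 2)) * 9 powr 1"
      using \<alpha> by (intro mult_left_mono powr_mono) auto
    finally show "sqrt (real m / 9) powr (- (\<alpha> + 1)) \<le> 9 * real m powr (- ((\<alpha> + 1) / 2))" by simp
  qed
  also have "\<dots> = 9 * (\<Sum>m=1..card J. real m powr (- ((\<alpha> + 1) / 2)))" by (simp add: sum_distrib_left)
  also have "\<dots> \<le> 9 * (real (card J) powr (1 - (\<alpha> + 1) / 2) / (1 - (\<alpha> + 1) / 2))"
    using \<alpha> by (intro mult_left_mono sum_powr_minus_le) auto
  also have "1 - (\<alpha> + 1) / 2 = (1 - \<alpha>) / 2" by (simp add: field_simps)
  also have "9 * (real (card J) powr ((1 - \<alpha>) / 2) / ((1 - \<alpha>) / 2)) = 18 / (1 - \<alpha>) * real (card J) powr ((1 - \<alpha>) / 2)"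
    by simp
  finally show ?thesis .
qed

text \<open>Along an edge path the norm changes by at most one per step, so every integer below
  \<open>\<lfloor>norm (x l)\<rfloor>\<close> is the integer part of the norm of some particle.\<close>

lemma cluster_norm_less:
  assumes "cluster n x" "l \<in> {1..n}"
  shows "norm (x l) < real n"
proof -
  let ?E = "{(k, l). k \<in> {1..n} \<and> l \<in> {1..n} \<and> dist (x k) (x l) = 1}"
  have n: "n \<ge> 1" and x1: "x 1 = 0" using assms(1) by (auto simp: cluster_def)
  have "(1, l) \<in> ?E\<^sup>*" using assms n unfolding cluster_def by simp
  then have "l \<in> {1..n} \<and> {0..\<lfloor>norm (x l)\<rfloor>} \<subseteq> (\<lambda>m. \<lfloor>norm (x m)\<rfloor>) ` {1..n}"
  proof (induction rule: rtrancl_induct)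
    case base
    have "{0..\<lfloor>norm (x 1)\<rfloor>} = {\<lfloor>norm (x 1)\<rfloor>}" using x1 by simp
    then show ?case using n by auto
  next
    case (step k l)
    then have l: "l \<in> {1..n}" and d: "dist (x k) (x l) = 1" by auto
    have "norm (x l) \<le> norm (x k) + 1"
      using norm_triangle_ineq4[of "x k" "x k - x l"] d by (simp add: dist_norm)
    then have "\<lfloor>norm (x l)\<rfloor> \<le> \<lfloor>norm (x k)\<rfloor> + 1" by linarith
    then have "{0..\<lfloor>norm (x l)\<rfloor>} \<subseteq> insert \<lfloor>norm (x l)\<rfloor> {0..\<lfloor>norm (x k)\<rfloor>}" by auto
    with step.IH l show ?case by blast
  qed
  then have "card {0..\<lfloor>norm (x l)\<rfloor>} \<le> card {1..n}" by (meson finite_atLeastAtMost surj_card_le)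
  then have "\<lfloor>norm (x l)\<rfloor> + 1 \<le> int n" by simp
  then show ?thesis by linarith
qed

section \<open>Flows and area\<close>

lemma vector_differentiable_bound:
  fixes f :: "real \<Rightarrow> 'b::real_normed_vector"
  assumes "convex S" "\<And>t. t \<in> S \<Longrightarrow> (f has_vector_derivative f' t) (at t within S)"
    and "\<And>t. t \<in> S \<Longrightarrow> norm (f' t) \<le> B" "s \<in> S" "t \<in> S"
  shows "norm (f s - f t) \<le> B * norm (s - t)"
proof (rule differentiable_bound[where f' = "\<lambda>t h. h *\<^sub>R f' t", OF assms(1)])
  fix r assume r: "r \<in> S"
  show "(f has_derivative (\<lambda>h. h *\<^sub>R f' r)) (at r within S)"
    using assms(2)[OF r] by (simp add: has_vector_derivative_def)
  show "onorm (\<lambda>h. h *\<^sub>R f' r) \<le> B"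
    using assms(3)[OF r] by (intro onorm_le) (simp add: mult.commute[of B] mult_left_mono)
qed (use assms in auto)

section \<open>The global flow of a bounded Lipschitz field and its Euler approximation\<close>

locale lipschitz_field =
  fixes F :: "'a::euclidean_space \<Rightarrow> 'a" and L B :: real
  assumes lip: "norm (F y - F z) \<le> L * norm (y - z)"
    and bdd: "norm (F y) \<le> B"
begin

text \<open>Determined by the differential equation for \<open>t \<ge> 0\<close> only; at negative
  times the chosen solution is merely continuous.\<close>

definition flow :: "real \<Rightarrow> 'a \<Rightarrow> 'a" where
  "flow t y = (SOME u. u 0 = y \<and> continuous_on UNIV u \<and>
     (\<forall>t\<ge>0. (u has_vector_derivative F (u t)) (at t within {0..}))) t"

lemma L_nonneg: "L \<ge> 0"
  using order_trans[OF norm_ge_zero lip[of "SOME b. b \<in> Basis" 0]] nonempty_Basis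
  by (metis SOME_Basis diff_zero mult_1_right norm_Basis)

lemma B_nonneg: "B \<ge> 0"
  using order_trans[OF norm_ge_zero bdd[of 0]] .

lemma F_continuous_on [continuous_intros]: "continuous_on S f \<Longrightarrow> continuous_on S (\<lambda>x. F (f x))"
proof -
  have "L-lipschitz_on UNIV F" unfolding lipschitz_on_def dist_norm using lip L_nonneg by blast
  then have "continuous_on UNIV F" by (rule lipschitz_on_continuous_on)
  then show "continuous_on S f \<Longrightarrow> continuous_on S (\<lambda>x. F (f x))"
    by (rule continuous_on_compose2) auto
qed

lemma flow_props:
  "flow 0 y = y" "continuous_on UNIV (\<lambda>t. flow t y)"
  "t \<ge> 0 \<Longrightarrow> ((\<lambda>t. flow t y) has_vector_derivative F (flow t y)) (at t within {0..})"
proof -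
  let ?P = "\<lambda>u. u 0 = y \<and> continuous_on UNIV u \<and>
     (\<forall>t\<ge>0. (u has_vector_derivative F (u t)) (at t within {0..}))"
  obtain u where "?P u"
    by (rule picard_global[of "\<lambda>t. F" L B y]) (auto intro: continuous_intros lip bdd)
  then have "?P (SOME u. ?P u)" by (rule someI[of ?P])
  then show "flow 0 y = y" "continuous_on UNIV (\<lambda>t. flow t y)"
    "t \<ge> 0 \<Longrightarrow> ((\<lambda>t. flow t y) has_vector_derivative F (flow t y)) (at t within {0..})"
    by (auto simp: flow_def[abs_def])
qed

lemmas flow_0 [simp] = flow_props(1)

lemma flow_continuous_time: "continuous_on S (\<lambda>t. flow t y)"
  using flow_props(2) continuous_on_subset by blast

lemma flow_deriv_at:
  assumes "t > 0"
  shows "((\<lambda>t. flow t y) has_vector_derivative F (flow t y)) (at t)"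
proof -
  have "at t within {0..} = at t" by (rule at_within_interior) (use assms in auto)
  then show ?thesis using flow_props(3)[of t y] assms by simp
qed

lemma flow_unique:
  assumes "continuous_on {0..T} v" "T \<ge> 0"
    and "\<And>t. \<lbrakk>0 < t; t < T\<rbrakk> \<Longrightarrow> (v has_vector_derivative F (v t)) (at t)"
  shows "v T = flow T (v 0)"
proof -
  have "norm (v T - flow T (v 0)) \<le> exp (L * (T - 0)) * norm (v 0 - flow 0 (v 0))"
    by (rule ode_solutions_dist(1)[of 0 T v "\<lambda>t. flow t (v 0)" "\<lambda>t. F (v t)" "\<lambda>t. F (flow t (v 0))"])
       (use assms in \<open>auto intro: flow_continuous_time flow_deriv_at lip\<close>)
  then show ?thesis by simp
qed

lemma flow_add:
  assumes "s \<ge> 0" "t \<ge> 0"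
  shows "flow (s + t) y = flow t (flow s y)"
proof -
  have "flow (s + t) y = flow t (flow (s + 0) y)"
  proof (rule flow_unique[where v = "\<lambda>t. flow (s + t) y"])
    show "continuous_on {0..t} (\<lambda>t. flow (s + t) y)"
      by (rule continuous_on_compose2[OF flow_continuous_time[of UNIV]]) (auto intro: continuous_intros)
    fix r assume "0 < r" "r < t"
    then have "((\<lambda>t. flow t y) has_vector_derivative F (flow (s + r) y)) (at (s + r))"
      using assms by (intro flow_deriv_at) auto
    moreover have "((+) s has_vector_derivative 1) (at r)"
      by (auto intro!: derivative_eq_intros)
    ultimately have "((\<lambda>t. flow t y) \<circ> (+) s has_vector_derivative (1 *\<^sub>R F (flow (s + r) y))) (at r)"
      by (intro vector_diff_chain_at) auto
    then show "((\<lambda>t. flow (s + t) y) has_vector_derivative F (flow (s + r) y)) (at r)"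
      by (simp add: o_def)
  qed (use assms in auto)
  then show ?thesis by simp
qed

lemma flow_lipschitz:
  assumes "t \<ge> 0"
  shows "norm (flow t y - flow t z) \<le> exp (L * t) * norm (y - z)"
    and "norm (y - z) \<le> exp (L * t) * norm (flow t y - flow t z)"
  using ode_solutions_dist[of 0 t "\<lambda>t. flow t y" "\<lambda>t. flow t z" "\<lambda>t. F (flow t y)" "\<lambda>t. F (flow t z)" L]
    assms by (auto intro: flow_continuous_time flow_deriv_at lip)

lemma flow_inj: "\<lbrakk>t \<ge> 0; flow t y = flow t z\<rbrakk> \<Longrightarrow> y = z"
  using flow_lipschitz(2)[of t y z] by simp

lemma flow_time_lipschitz:
  assumes "0 \<le> s" "s \<le> t"
  shows "norm (flow t y - flow s y) \<le> B * (t - s)"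
proof -
  have "norm (flow t y - flow s y) \<le> B * norm (t - s)"
  proof (rule vector_differentiable_bound[where S = "{s..t}" and f' = "\<lambda>t. F (flow t y)"])
    fix r assume "r \<in> {s..t}"
    then show "((\<lambda>t. flow t y) has_vector_derivative F (flow r y)) (at r within {s..t})"
      using assms by (intro has_vector_derivative_within_subset[OF flow_props(3)]) auto
  qed (use assms bdd in auto)
  then show ?thesis using assms by simp
qed

lemma flow_continuous_on:
  assumes "t \<ge> 0"
  shows "continuous_on S (flow t)"
proof -
  have "(exp (L * t))-lipschitz_on S (flow t)"
    unfolding lipschitz_on_def dist_norm using flow_lipschitz[OF assms] by auto
  then show ?thesis by (rule lipschitz_on_continuous_on)
qed

text \<open>Joint continuity in time and starting point: the Lipschitz constant in the starting
  point stays bounded as long as the times converge.\<close>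

lemma flow_tendsto:
  assumes "(s \<longlongrightarrow> t) G" "(z \<longlongrightarrow> y) G" "t \<ge> 0" "eventually (\<lambda>x. s x \<ge> 0) G"
  shows "((\<lambda>x. flow (s x) (z x)) \<longlongrightarrow> flow t y) G"
proof -
  have "isCont (\<lambda>t. flow t y) t"
    using flow_props(2) by (simp add: continuous_on_eq_continuous_at)
  then have 1: "((\<lambda>x. flow (s x) y) \<longlongrightarrow> flow t y) G" using assms(1) by (rule isCont_tendsto_compose)
  have "((\<lambda>x. exp (L * s x) * norm (z x - y)) \<longlongrightarrow> exp (L * t) * norm (y - y)) G"
    by (intro tendsto_intros assms)
  then have "((\<lambda>x. exp (L * s x) * norm (z x - y)) \<longlongrightarrow> 0) G" by simp
  then have "((\<lambda>x. flow (s x) (z x) - flow (s x) y) \<longlongrightarrow> 0) G"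
    by (rule Lim_null_comparison[rotated]) (use assms(4) in eventually_elim, auto intro: flow_lipschitz)
  from tendsto_add[OF this 1] show ?thesis by simp
qed

definition euler :: "real \<Rightarrow> 'a \<Rightarrow> 'a" where "euler h y = y + h *\<^sub>R F y"

lemma euler_step_error:
  assumes "h \<ge> 0"
  shows "norm (euler h y - flow h y) \<le> L * B * h\<^sup>2"
proof -
  have "norm (flow h y - flow 0 y - (h - 0) *\<^sub>R F (flow 0 y)) \<le> norm (h - 0) * (L * (B * h))"
  proof (rule vector_differentiable_bound_linearization[where S = "{0..h}" and f' = "\<lambda>t. F (flow t y)"])
    fix r assume r: "r \<in> {0..h}"
    then show "((\<lambda>t. flow t y) has_vector_derivative F (flow r y)) (at r within {0..h})"
      by (intro has_vector_derivative_within_subset[OF flow_props(3)]) auto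
    have "norm (F (flow r y) - F (flow 0 y)) \<le> L * norm (flow r y - flow 0 y)" by (rule lip)
    also have "\<dots> \<le> L * (B * (r - 0))"
      using r by (intro mult_left_mono flow_time_lipschitz L_nonneg) auto
    also have "\<dots> \<le> L * (B * h)" using r L_nonneg B_nonneg by (intro mult_left_mono) auto
    finally show "norm (F (flow r y) - F (flow 0 y)) \<le> L * (B * h)" .
  qed (use assms in \<open>auto simp: closed_segment_eq_real_ivl\<close>)
  moreover have "norm (euler h y - flow h y) = norm (flow h y - flow 0 y - (h - 0) *\<^sub>R F (flow 0 y))"
    by (subst norm_minus_commute) (simp add: euler_def algebra_simps)
  ultimately show ?thesis using assms by (simp add: power2_eq_square algebra_simps)
qed

text \<open>A step multiplies the error made so far by at most \<open>1 + L * h\<close> and adds the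
  local error \<open>L * B * h\<^sup>2\<close>. As long as \<open>k * h\<close> is bounded the total
  is of order h.\<close>

lemma euler_error:
  assumes "h \<ge> 0"
  shows "norm ((euler h ^^ k) y - flow (real k * h) y) \<le> real k * (L * B * h\<^sup>2) * exp (L * h * real k)"
proof (induction k)
  case (Suc k)
  let ?e = "L * B * h\<^sup>2" and ?z = "flow (real k * h) y" and ?g = "(euler h ^^ k) y"
  have e0: "?e \<ge> 0" using L_nonneg B_nonneg by simp
  have "euler h ?g - euler h ?z = (?g - ?z) + h *\<^sub>R (F ?g - F ?z)"
    by (simp add: euler_def algebra_simps)
  then have "norm (euler h ?g - euler h ?z) \<le> norm (?g - ?z) + h * norm (F ?g - F ?z)"
    using norm_triangle_ineq[of "?g - ?z" "h *\<^sub>R (F ?g - F ?z)"] assms by simp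
  also have "\<dots> \<le> norm (?g - ?z) + h * (L * norm (?g - ?z))"
    using assms by (intro add_left_mono mult_left_mono lip) auto
  also have "\<dots> = (1 + L * h) * norm (?g - ?z)" by (simp add: algebra_simps)
  also have "\<dots> \<le> exp (L * h) * (real k * ?e * exp (L * h * real k))"
    by (intro mult_mono Suc.IH exp_ge_add_one_self) auto
  finally have 1: "norm (euler h ?g - euler h ?z) \<le> real k * ?e * exp (L * h * real (Suc k))"
    by (simp add: algebra_simps exp_add)
  have "flow (real (Suc k) * h) y = flow h ?z"
    using flow_add[of "real k * h" h y] assms by (simp add: algebra_simps)
  then have 2: "norm (euler h ?z - flow (real (Suc k) * h) y) \<le> ?e"
    using euler_step_error[OF assms, of ?z] by simp
  have "1 \<le> exp (L * h * real (Suc k))" using L_nonneg assms by simp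
  then have 3: "?e \<le> ?e * exp (L * h * real (Suc k))" using e0 by (simp add: mult_le_cancel_left1)
  have "norm ((euler h ^^ Suc k) y - flow (real (Suc k) * h) y)
      \<le> norm (euler h ?g - euler h ?z) + norm (euler h ?z - flow (real (Suc k) * h) y)"
    using norm_triangle_ineq[of "euler h ?g - euler h ?z" "euler h ?z - flow (real (Suc k) * h) y"] by simp
  also have "\<dots> \<le> real k * ?e * exp (L * h * real (Suc k)) + ?e * exp (L * h * real (Suc k))"
    using 1 2 3 by linarith
  also have "\<dots> = real (Suc k) * ?e * exp (L * h * real (Suc k))" by (simp add: algebra_simps)
  finally show ?case .
qed simp

lemma euler_inj:
  assumes "h \<ge> 0" "h * L < 1"
  shows "inj (euler h)"
proof (rule injI)
  fix y z assume "euler h y = euler h z"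
  then have "y - z = h *\<^sub>R (F z - F y)" by (simp add: euler_def algebra_simps)
  then have "norm (y - z) = h * norm (F z - F y)" using assms by (metis abs_of_nonneg norm_scaleR)
  also have "\<dots> \<le> h * (L * norm (z - y))" using assms by (intro mult_left_mono lip) auto
  finally have "norm (y - z) * (1 - h * L) \<le> 0" by (simp add: norm_minus_commute algebra_simps)
  then show "y = z" using assms(2) by (simp add: mult_le_0_iff)
qed

lemma euler_continuous_on: "continuous_on S (euler h)"
  unfolding euler_def[abs_def] by (intro continuous_intros)

end

section \<open>Area under a planar flow of nonnegative divergence\<close>

lemma det_id_plus_ge:
  fixes J :: "real^2 \<Rightarrow> real^2"
  assumes "h \<ge> 0" "\<And>v. norm (J v) \<le> L * norm v" "J (axis 1 1) $ 1 + J (axis 2 1) $ 2 \<ge> 0"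
  shows "1 - 2 * L\<^sup>2 * h\<^sup>2 \<le> det (matrix (\<lambda>v. v + h *\<^sub>R J v))"
proof -
  have e: "\<bar>J (axis j 1) $ i\<bar> \<le> L" for i j
    using order_trans[OF component_le_norm_cart assms(2)[of "axis j 1"]] by simp
  define a b c d where "a = J (axis 1 1) $ 1" "b = J (axis 2 1) $ 1" "c = J (axis 1 1) $ 2" "d = J (axis 2 1) $ 2"
  note abcd = this
  have "L \<ge> 0" using e[of 1 1] by linarith
  have "\<bar>a * d\<bar> \<le> L * L" "\<bar>b * c\<bar> \<le> L * L"
    unfolding abs_mult abcd using e \<open>L \<ge> 0\<close> by (intro mult_mono; simp)+
  then have "- (2 * L\<^sup>2) \<le> a * d - b * c" by (simp add: power2_eq_square)
  then have "h\<^sup>2 * (- (2 * L\<^sup>2)) \<le> h\<^sup>2 * (a * d - b * c)" by (intro mult_left_mono) auto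
  moreover have "0 \<le> h * (a + d)" using assms(1,3) abcd by simp
  \<comment> \<open>The linear term is h times the trace, which is nonnegative, so only the
    quadratic term can lower the determinant; the entry bound \<open>L\<close> limits that loss to
    \<open>2 * L\<^sup>2 * h\<^sup>2\<close>.\<close>
  moreover have "det (matrix (\<lambda>v. v + h *\<^sub>R J v)) = 1 + h * (a + d) + h\<^sup>2 * (a * d - b * c)"
    by (simp add: det_2 matrix_def abcd axis_def power2_eq_square) (simp add: axis_def algebra_simps)
  ultimately show ?thesis by (simp add: algebra_simps)
qed

locale planar_field = lipschitz_field F L B for F :: "real^2 \<Rightarrow> real^2" and L B
begin

text \<open>The last conjunct is the trace of the derivative, that is, the divergence; the norm
  bound on \<open>J\<close> controls the determinant of an Euler step.\<close>

definition nonneg_div_at :: "real^2 \<Rightarrow> bool" where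
  "nonneg_div_at z \<longleftrightarrow> (\<exists>J. (F has_derivative J) (at z) \<and> (\<forall>v. norm (J v) \<le> L * norm v) \<and>
     J (axis 1 1) $ 1 + J (axis 2 1) $ 2 \<ge> 0)"

lemma euler_area_ge:
  assumes "h \<ge> 0" "h * L < 1" "2 * L\<^sup>2 * h\<^sup>2 \<le> 1" "compact S" "\<And>z. z \<in> S \<Longrightarrow> nonneg_div_at z"
  shows "(1 - 2 * L\<^sup>2 * h\<^sup>2) * measure lebesgue S \<le> measure lebesgue (euler h ` S)"
proof -
  obtain J where J: "\<And>z. z \<in> S \<Longrightarrow> (F has_derivative J z) (at z)"
    "\<And>z v. z \<in> S \<Longrightarrow> norm (J z v) \<le> L * norm v"
    "\<And>z. z \<in> S \<Longrightarrow> J z (axis 1 1) $ 1 + J z (axis 2 1) $ 2 \<ge> 0"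
    using assms(5) unfolding nonneg_div_at_def by metis
  define G' where "G' = (\<lambda>z v. v + h *\<^sub>R J z v)"
  have lS: "S \<in> lmeasurable" using assms(4) by (rule lmeasurable_compact)
  have der: "(euler h has_derivative G' z) (at z within S)" if "z \<in> S" for z
    unfolding euler_def[abs_def] G'_def
    by (rule has_derivative_add[OF has_derivative_ident has_derivative_scaleR_right])
       (rule has_derivative_at_withinI[OF J(1)[OF that]])
  have inj: "inj_on (euler h) S" using euler_inj[OF assms(1,2)] by (rule inj_on_subset) auto
  have "compact (euler h ` S)" by (intro compact_continuous_image euler_continuous_on assms)
  then have "euler h ` S \<in> lmeasurable" by (rule lmeasurable_compact)
  then have int: "(\<lambda>z. \<bar>det (matrix (G' z))\<bar>) integrable_on S"
    using measurable_differentiable_image_eq[OF _ der inj] lS by blast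
  have "(1 - 2 * L\<^sup>2 * h\<^sup>2) * measure lebesgue S = integral S (\<lambda>z. 1 - 2 * L\<^sup>2 * h\<^sup>2)"
    using lS by (simp add: lmeasure_integral flip: integral_mult_right)
  also have "\<dots> \<le> integral S (\<lambda>z. \<bar>det (matrix (G' z))\<bar>)"
  proof (intro integral_le int integrable_on_const lS)
    fix z assume "z \<in> S"
    then have "1 - 2 * L\<^sup>2 * h\<^sup>2 \<le> det (matrix (G' z))"
      unfolding G'_def using assms(1) J by (intro det_id_plus_ge) auto
    then show "1 - 2 * L\<^sup>2 * h\<^sup>2 \<le> \<bar>det (matrix (G' z))\<bar>" by linarith
  qed
  also have "\<dots> = measure lebesgue (euler h ` S)"
    by (rule measure_differentiable_image_eq[symmetric, OF _ der inj int]) (use lS in auto)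
  finally show ?thesis .
qed

text \<open>Euler steps shrink a compact set by a factor of at most \<open>1 - O(h\<^sup>2)\<close> each, and after time \<open>t\<close>
  they land in an arbitrarily small neighbourhood of its image under the flow.  This avoids
  differentiating the flow in its initial value.\<close>

lemma flow_area_nondecreasing:
  assumes K: "compact K" and t: "t \<ge> 0" and \<delta>: "\<delta> > 0"
    and div: "\<And>y s z. \<lbrakk>y \<in> K; 0 \<le> s; s \<le> t; norm (z - flow s y) < \<delta>\<rbrakk> \<Longrightarrow> nonneg_div_at z"
  shows "measure lebesgue K \<le> measure lebesgue (flow t ` K)"
proof (rule field_le_epsilon)
  fix e :: real assume e: "e > 0"
  have cK: "compact (flow t ` K)" by (intro compact_continuous_image flow_continuous_on t K)
  then have mK: "flow t ` K \<in> lmeasurable" by (rule lmeasurable_compact)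
  \<comment> \<open>Upper semicontinuity of area at a compact set: an open superset of almost the
    same measure contains a whole \<open>d\<close>-neighbourhood, in which the Euler images end
    up.\<close>
  obtain T where T: "open T" "flow t ` K \<subseteq> T" and T': "T - flow t ` K \<in> lmeasurable"
    "emeasure lebesgue (T - flow t ` K) < ennreal e"
    by (rule sets_lebesgue_outer_open[OF fmeasurableD[OF mK] e])
  have Teq: "T = flow t ` K \<union> (T - flow t ` K)" using T(2) by blast
  have mT: "T \<in> lmeasurable" by (subst Teq, intro fmeasurable.Un mK T')
  have "measure lebesgue (T - flow t ` K) < e"
    using T' e by (simp add: emeasure_eq_measure2 ennreal_less_iff)
  moreover have "measure lebesgue T \<le> measure lebesgue (flow t ` K) + measure lebesgue (T - flow t ` K)"
    by (subst Teq, rule measure_Un_le) (use mK T' in auto)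
  ultimately have lT: "measure lebesgue T < measure lebesgue (flow t ` K) + e" by linarith
  obtain d where d: "d > 0" "(\<Union>x\<in>flow t ` K. ball x d) \<subseteq> T"
    using compact_subset_open_imp_ball_epsilon_subset[OF cK T] by blast
  define C where "C = t * (L * B * t) * exp (L * t)"
  have C: "C \<ge> 0" using t L_nonneg B_nonneg by (simp add: C_def)
  define h where "h = (\<lambda>N. t / real N)"
  have lim0: "(\<lambda>N. c / real N) \<longlonglongrightarrow> 0" for c by (rule lim_const_over_n)
  have "eventually (\<lambda>N. C / real N < min d \<delta>) sequentially"
    by (rule order_tendstoD(2)[OF lim0]) (use d \<delta> in auto)
  \<comment> \<open>Forces \<open>h * L < 1/2\<close>, so that Euler steps are injective and the
    shrinking factor is nonnegative.\<close>
  moreover have "eventually (\<lambda>N. t * (1 + 2 * L) / real N < 1) sequentially"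
    by (rule order_tendstoD(2)[OF lim0]) auto
  ultimately have ev: "eventually (\<lambda>N. (1 - 2 * L\<^sup>2 * t\<^sup>2 / real N) * measure lebesgue K
      \<le> measure lebesgue (flow t ` K) + e) sequentially"
    using eventually_gt_at_top[of 0]
  proof eventually_elim
    case (elim N)
    let ?h = "h N"
    have N: "N > 0" using elim by simp
    have h0: "?h \<ge> 0" using t by (simp add: h_def)
    have hN: "real N * ?h = t" using N by (simp add: h_def)
    have h1: "?h * (1 + 2 * L) < 1" using elim by (simp add: h_def)
    have hL0: "0 \<le> ?h * L" using h0 L_nonneg by simp
    have hL: "?h * L < 1/2" using h1 h0 by (simp add: algebra_simps)
    have "(?h * L)\<^sup>2 \<le> (1/2)\<^sup>2" using hL hL0 by (intro power_mono) auto
    then have h2: "2 * L\<^sup>2 * ?h\<^sup>2 \<le> 1" by (simp add: power_mult_distrib power2_eq_square algebra_simps)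
    have err: "norm ((euler ?h ^^ k) y - flow (real k * ?h) y) \<le> C / real N" if "k \<le> N" for k y
    proof -
      have kh: "real k * ?h \<le> t" using that hN h0 by (metis mult_right_mono of_nat_le_iff)
      have "real k * (L * B * ?h\<^sup>2) * exp (L * ?h * real k)
          = (real k * ?h) * (L * B * ?h) * exp (L * (real k * ?h))"
        by (simp add: power2_eq_square algebra_simps)
      also have "\<dots> \<le> t * (L * B * ?h) * exp (L * t)"
        using kh h0 t L_nonneg B_nonneg by (intro mult_mono mult_nonneg_nonneg iffD2[OF exp_le_cancel_iff] mult_left_mono) auto
      also have "\<dots> = C / real N" by (simp add: C_def h_def)
      finally show ?thesis using euler_error[OF h0, of k y] by linarith
    qed
    have ind: "compact ((euler ?h ^^ k) ` K) \<and>
        (1 - 2 * L\<^sup>2 * ?h\<^sup>2) ^ k * measure lebesgue K \<le> measure lebesgue ((euler ?h ^^ k) ` K)"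
      if "k \<le> N" for k
      using that
    proof (induction k)
      case 0
      then show ?case using K by simp
    next
      case (Suc k)
      let ?S = "(euler ?h ^^ k) ` K"
      have S: "compact ?S" and IH: "(1 - 2 * L\<^sup>2 * ?h\<^sup>2) ^ k * measure lebesgue K \<le> measure lebesgue ?S"
        using Suc by auto
      have eq: "(euler ?h ^^ Suc k) ` K = euler ?h ` ?S" by (simp add: image_comp)
      have "nonneg_div_at z" if "z \<in> ?S" for z
      proof -
        obtain y where y: "y \<in> K" "z = (euler ?h ^^ k) y" using \<open>z \<in> ?S\<close> by auto
        have "real k * ?h \<le> t" using Suc.prems hN h0 by (metis Suc_leD mult_right_mono of_nat_le_iff)
        moreover have "norm (z - flow (real k * ?h) y) < \<delta>"
          using err[of k y] Suc.prems elim(1) y by simp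
        ultimately show ?thesis using div[OF y(1), of "real k * ?h" z] h0 by simp
      qed
      then have "(1 - 2 * L\<^sup>2 * ?h\<^sup>2) * measure lebesgue ?S \<le> measure lebesgue (euler ?h ` ?S)"
        using h0 hL h2 S by (intro euler_area_ge) auto
      moreover have "(1 - 2 * L\<^sup>2 * ?h\<^sup>2) * ((1 - 2 * L\<^sup>2 * ?h\<^sup>2) ^ k * measure lebesgue K)
          \<le> (1 - 2 * L\<^sup>2 * ?h\<^sup>2) * measure lebesgue ?S"
        using h2 by (intro mult_left_mono IH) auto
      ultimately have "(1 - 2 * L\<^sup>2 * ?h\<^sup>2) ^ Suc k * measure lebesgue K \<le> measure lebesgue (euler ?h ` ?S)"
        by (simp add: mult.assoc)
      moreover have "compact (euler ?h ` ?S)" by (intro compact_continuous_image euler_continuous_on S)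
      ultimately show ?case unfolding eq by blast
    qed
    have sub: "(euler ?h ^^ N) ` K \<subseteq> T"
    proof safe
      fix y assume y: "y \<in> K"
      have "norm ((euler ?h ^^ N) y - flow t y) < d" using err[of N y] elim(1) hN by simp
      then have "(euler ?h ^^ N) y \<in> ball (flow t y) d" by (simp add: dist_norm norm_minus_commute)
      then show "(euler ?h ^^ N) y \<in> T" using d(2) y by blast
    qed
    \<comment> \<open>N steps with relative loss of order 1 / N^2 lose only O(1 / N) together;
      Bernoulli's inequality makes this explicit.\<close>
    have "1 - 2 * L\<^sup>2 * t\<^sup>2 / real N = 1 + real N * (- (2 * L\<^sup>2 * ?h\<^sup>2))"
      using N by (simp add: h_def power2_eq_square)
    also have "\<dots> \<le> (1 + (- (2 * L\<^sup>2 * ?h\<^sup>2))) ^ N"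
      by (rule Bernoulli_inequality) (use h2 in simp)
    finally have "(1 - 2 * L\<^sup>2 * t\<^sup>2 / real N) * measure lebesgue K
        \<le> (1 - 2 * L\<^sup>2 * ?h\<^sup>2) ^ N * measure lebesgue K"
      by (intro mult_right_mono) auto
    also have "\<dots> \<le> measure lebesgue ((euler ?h ^^ N) ` K)" using ind[of N] by simp
    also have "\<dots> \<le> measure lebesgue T"
      using sub mT ind[of N] lmeasurable_compact by (intro measure_mono_fmeasurable) auto
    finally show ?case using lT by linarith
  qed
  have "(\<lambda>N. (1 - 2 * L\<^sup>2 * t\<^sup>2 / real N) * measure lebesgue K) \<longlonglongrightarrow> (1 - 0) * measure lebesgue K"
    by (intro tendsto_intros lim0)
  from tendsto_upperbound[OF this ev] show "measure lebesgue K \<le> measure lebesgue (flow t ` K) + e" by simp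
qed

end

section \<open>The field of a cluster\<close>

text \<open>Up to a constant factor, minus the gradient of one energy summand, with \<beta> =
  \<alpha> + 2. Bounding the norm below by 1/2 removes the singularity and leaves the kernel
  unchanged from that distance on.\<close>

definition kern :: "real \<Rightarrow> 'a::real_inner \<Rightarrow> 'a" where
  "kern \<beta> z = max (norm z) (1/2) powr (- \<beta>) *\<^sub>R z"

lemma max_half_powr_le:
  fixes p :: real
  assumes "p \<ge> 1/2" "0 \<le> \<beta>" "\<beta> \<le> k"
  shows "p powr (- \<beta>) \<le> 2 powr k"
proof -
  have "p powr (- \<beta>) \<le> (1/2) powr (- \<beta>)" using assms by (intro powr_mono2') auto
  also have "\<dots> = 2 powr \<beta>" by (simp add: powr_minus powr_divide)
  also have "\<dots> \<le> 2 powr k" using assms by (intro powr_mono) auto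
  finally show ?thesis .
qed

lemma powr_mult_self:
  fixes p :: real
  assumes "p \<ge> 0"
  shows "p powr a * p = p powr (a + 1)" and "p powr a * p\<^sup>2 = p powr (a + 2)"
  using powr_mult_base[OF assms, of a] powr_mult_base[OF assms, of "1 + a"]
  by (simp_all add: power2_eq_square algebra_simps)

lemma two_powr_3: "(2::real) powr 3 = 8" "(2::real) powr 2 = 4"
  by (simp_all add: powr_numeral)

lemma kern_norm_le:
  assumes "2 \<le> \<beta>" "\<beta> \<le> 3"
  shows "norm (kern \<beta> z) \<le> 4"
proof -
  let ?p = "max (norm z) (1/2)"
  have "norm (kern \<beta> z) \<le> ?p powr (- \<beta>) * ?p"
    unfolding kern_def by (simp add: mult_left_mono)
  also have "\<dots> = ?p powr (- (\<beta> - 1))" by (simp add: powr_mult_self)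
  also have "\<dots> \<le> 2 powr 2" using assms by (intro max_half_powr_le) auto
  finally show ?thesis by (simp add: two_powr_3)
qed

text \<open>With the smaller norm at \<open>z\<close>, the difference splits into
  \<open>q powr (- \<beta>)\<close> times z - w and a change of the scalar factor times
  \<open>z\<close>. The norm of \<open>z\<close> is at most \<open>p\<close>, which absorbs the
  extra power in the derivative of the scalar factor. The constant is 8 + 3 * 8, from
  \<open>\<beta> \<le> 3\<close> and \<open>p \<ge> 1/2\<close>.\<close>

lemma kern_lipschitz:
  assumes "2 \<le> \<beta>" "\<beta> \<le> 3"
  shows "norm (kern \<beta> z - kern \<beta> w) \<le> 32 * norm (z - w)"
proof (induction "norm z" "norm w" arbitrary: z w rule: linorder_wlog)
  case (sym z w)
  then show ?case by (metis norm_minus_commute)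
next
  case (le z w)
  define p q where "p = max (norm z) (1/2)" "q = max (norm w) (1/2)"
  note pq_def = this
  have pq: "p \<le> q" "1/2 \<le> p" "norm z \<le> p" using le by (auto simp: pq_def)
  have qp: "q - p \<le> norm (z - w)"
    using le norm_triangle_ineq3[of w z] by (auto simp: pq_def norm_minus_commute)
  have pb: "p powr (- \<beta>) \<le> 8" using max_half_powr_le[of p \<beta> 3] pq assms by (simp add: two_powr_3)
  have qb: "q powr (- \<beta>) \<le> 8" using max_half_powr_le[of q \<beta> 3] pq assms by (simp add: two_powr_3)
  have diff: "\<bar>p powr (- \<beta>) - q powr (- \<beta>)\<bar> \<le> (q - p) * (\<beta> * p powr (- \<beta> - 1))"
  proof (cases "p = q")
    case False
    then have "p < q" using pq by simp
    have der: "((\<lambda>t. t powr (- \<beta>)) has_real_derivative (- \<beta>) * t powr (- \<beta> - 1)) (at t)" if "t > 0" for t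
      using has_real_derivative_powr[OF that, of "- \<beta>"] by simp
    obtain t where t: "p < t" "t < q"
      "q powr (- \<beta>) - p powr (- \<beta>) = (q - p) * ((- \<beta>) * t powr (- \<beta> - 1))"
      using MVT2[OF \<open>p < q\<close>, of "\<lambda>t. t powr (- \<beta>)" "\<lambda>t. (- \<beta>) * t powr (- \<beta> - 1)"] der pq by auto
    have "t powr (- \<beta> - 1) \<le> p powr (- \<beta> - 1)" using t pq assms by (intro powr_mono2') auto
    then have "(q - p) * (\<beta> * t powr (- \<beta> - 1)) \<le> (q - p) * (\<beta> * p powr (- \<beta> - 1))"
      using pq assms by (intro mult_left_mono) auto
    moreover have "0 \<le> (q - p) * (\<beta> * t powr (- \<beta> - 1))" using pq assms by (intro mult_nonneg_nonneg) auto
    ultimately show ?thesis using t(3) by simp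
  qed simp
  have pp: "p powr (- \<beta> - 1) * p = p powr (- \<beta>)" using pq powr_mult_self(1)[of p "- \<beta> - 1"] by simp
  have "kern \<beta> z - kern \<beta> w = q powr (- \<beta>) *\<^sub>R (z - w) + (p powr (- \<beta>) - q powr (- \<beta>)) *\<^sub>R z"
    by (simp add: kern_def pq_def algebra_simps)
  also have "norm \<dots> \<le> q powr (- \<beta>) * norm (z - w) + \<bar>p powr (- \<beta>) - q powr (- \<beta>)\<bar> * norm z"
    by (rule order_trans[OF norm_triangle_ineq]) simp
  also have "\<dots> \<le> 8 * norm (z - w) + (q - p) * (\<beta> * p powr (- \<beta> - 1)) * p"
    using pq diff qb by (intro add_mono mult_mono mult_right_mono) auto
  also have "\<dots> = 8 * norm (z - w) + (q - p) * (\<beta> * p powr (- \<beta>))"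
    using pp by (simp add: mult.assoc)
  also have "\<dots> \<le> 8 * norm (z - w) + norm (z - w) * (3 * 8)"
    using qp pb assms by (intro add_left_mono mult_mono) auto
  finally show ?case by simp
qed

definition kern_deriv :: "real \<Rightarrow> 'a::real_inner \<Rightarrow> 'a \<Rightarrow> 'a" where
  "kern_deriv \<beta> z v = norm z powr (- \<beta>) *\<^sub>R v - (\<beta> * norm z powr (- \<beta> - 2) * (z \<bullet> v)) *\<^sub>R z"

lemma norm_powr_has_derivative:
  fixes z :: "'a::real_inner"
  assumes "z \<noteq> 0"
  shows "((\<lambda>z. norm z powr a) has_derivative (\<lambda>v. a * norm z powr (a - 2) * (z \<bullet> v))) (at z)"
proof -
  have "((\<lambda>s. s powr a) has_real_derivative a * norm z powr (a - 1)) (at (norm z))"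
    using assms has_real_derivative_powr[of "norm z" a] by simp
  from DERIV_compose_FDERIV[OF this has_derivative_norm[OF assms]]
  have "((\<lambda>z. norm z powr a) has_derivative (\<lambda>v. (v \<bullet> sgn z) * (a * norm z powr (a - 1)))) (at z)" .
  moreover have "(v \<bullet> sgn z) * (a * norm z powr (a - 1)) = a * norm z powr (a - 2) * (z \<bullet> v)" for v
  proof -
    have "norm z powr (a - 1) = norm z powr (a - 2) * norm z"
      using powr_mult_self(1)[of "norm z" "a - 2"] by simp
    then show ?thesis using assms by (simp add: sgn_div_norm inner_commute)
  qed
  ultimately show ?thesis by simp
qed

lemma kern_has_derivative:
  fixes z :: "'a::real_inner"
  assumes "norm z > 1/2"
  shows "(kern \<beta> has_derivative kern_deriv \<beta> z) (at z)"
proof -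
  have z: "z \<noteq> 0" using assms by auto
  have "((\<lambda>z. norm z powr (- \<beta>) *\<^sub>R z) has_derivative kern_deriv \<beta> z) (at z)"
    by (rule has_derivative_eq_rhs[OF has_derivative_scaleR[OF norm_powr_has_derivative[OF z] has_derivative_ident]])
       (simp add: kern_deriv_def fun_eq_iff)
  then show ?thesis
  proof (rule has_derivative_transform_within_open)
    show "open {z :: 'a. norm z > 1/2}" by (intro open_Collect_less continuous_intros)
    show "norm w powr (- \<beta>) *\<^sub>R w = kern \<beta> w" if "w \<in> {z :: 'a. norm z > 1/2}" for w
      using that by (simp add: kern_def max_def)
  qed (use assms in auto)
qed

lemma kern_deriv_norm_le:
  assumes "norm z > 1/2" "2 \<le> \<beta>" "\<beta> \<le> 3"
  shows "norm (kern_deriv \<beta> z v) \<le> 32 * norm v"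
proof -
  have p8: "norm z powr (- \<beta>) \<le> 8"
    using max_half_powr_le[of "norm z" \<beta> 3] assms by (simp add: two_powr_3)
  have e: "norm z powr (- \<beta> - 2) * (norm z * norm z) = norm z powr (- \<beta>)"
    using powr_mult_self(2)[of "norm z" "- \<beta> - 2"] by (simp add: power2_eq_square)
  have "norm (kern_deriv \<beta> z v) \<le> norm z powr (- \<beta>) * norm v
      + (\<beta> * norm z powr (- \<beta> - 2)) * \<bar>z \<bullet> v\<bar> * norm z"
    unfolding kern_deriv_def using assms by (intro order_trans[OF norm_triangle_ineq4]) (simp add: abs_mult)
  also have "\<dots> \<le> norm z powr (- \<beta>) * norm v + (\<beta> * norm z powr (- \<beta> - 2)) * (norm z * norm v) * norm z"
    using assms by (intro add_left_mono mult_right_mono mult_left_mono Cauchy_Schwarz_ineq2) auto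
  also have "\<dots> = norm z powr (- \<beta>) * norm v + \<beta> * (norm z powr (- \<beta> - 2) * (norm z * norm z)) * norm v"
    by (simp only: mult_ac)
  also have "\<dots> = (1 + \<beta>) * norm z powr (- \<beta>) * norm v" unfolding e by (simp add: algebra_simps)
  also have "\<dots> \<le> 4 * 8 * norm v" using p8 assms by (intro mult_right_mono mult_mono) auto
  finally show ?thesis by simp
qed

text \<open>For \<beta> = \<alpha> + 2 the trace is - \<alpha> times a positive number, so the
  field, built from minus the kernel, has nonnegative divergence: the energy is subharmonic off the
  particles, and harmonic for \<alpha> = 0.\<close>

lemma kern_deriv_trace:
  fixes z :: "real^2"
  assumes "z \<noteq> 0"
  shows "kern_deriv \<beta> z (axis 1 1) $ 1 + kern_deriv \<beta> z (axis 2 1) $ 2 = (2 - \<beta>) * norm z powr (- \<beta>)"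
proof -
  have "(norm z)\<^sup>2 = z $ 1 * z $ 1 + z $ 2 * z $ 2"
    by (simp add: power2_norm_eq_inner inner_vec_def sum_2)
  moreover have "norm z powr (- \<beta>) = norm z powr (- \<beta> - 2) * (norm z)\<^sup>2"
    using powr_mult_self(2)[of "norm z" "- \<beta> - 2"] by simp
  ultimately show ?thesis
    unfolding kern_deriv_def by (simp add: inner_axis algebra_simps)
qed

text \<open>The factor in front of the kernel in the gradient. The logarithmic energy at \<alpha> =
  0 contributes 1, not the value 0 that the power rule would suggest.\<close>

definition coef :: "real \<Rightarrow> real" where "coef \<alpha> = (if \<alpha> = 0 then 1 else \<alpha>)"

section \<open>The capped gradient field of the cluster\<close>

lemma energy_summand_GDERIV:
  fixes y a :: "'a::real_inner"
  assumes "norm (y - a) \<ge> 1/2"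
  shows "GDERIV (\<lambda>y. if \<alpha> = 0 then ln (1 / norm (y - a)) else norm (y - a) powr (- \<alpha>)) y
    :> - (coef \<alpha> *\<^sub>R kern (\<alpha> + 2) (y - a))"
proof -
  have z: "y - a \<noteq> 0" using assms by auto
  have m: "max (norm (y - a)) (1/2) = norm (y - a)" using assms by simp
  have k: "kern (\<alpha> + 2) (y - a) = norm (y - a) powr (- \<alpha> - 2) *\<^sub>R (y - a)"
    unfolding kern_def m by simp
  have sh: "((\<lambda>y. y - a) has_derivative (\<lambda>v. v)) (at y)"
    by (auto intro!: derivative_eq_intros)
  show ?thesis
  proof (cases "\<alpha> = 0")
    case True
    have "((\<lambda>z. - ln (norm z)) has_derivative (\<lambda>v. - ((v \<bullet> sgn (y - a)) * (1 / norm (y - a))))) (at (y - a))"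
      by (intro has_derivative_minus DERIV_compose_FDERIV[OF _ has_derivative_norm[OF z]] DERIV_ln_divide)
         (use z in auto)
    from has_derivative_compose[OF sh this]
    have "((\<lambda>y. - ln (norm (y - a))) has_derivative (\<lambda>v. - ((v \<bullet> sgn (y - a)) * (1 / norm (y - a))))) (at y)" .
    moreover have "(\<lambda>v. - ((v \<bullet> sgn (y - a)) * (1 / norm (y - a)))) = (\<lambda>v. v \<bullet> (- (coef \<alpha> *\<^sub>R kern (\<alpha> + 2) (y - a))))"
    proof -
      have "(v \<bullet> sgn w) * (1 / norm w) = v \<bullet> (norm w powr (- 2) *\<^sub>R w)" if "w \<noteq> 0" for v w :: 'a
        using that by (simp add: sgn_div_norm powr_minus powr_numeral power2_eq_square divide_inverse)
      from this[OF z] show ?thesis using True k by (simp add: coef_def)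
    qed
    ultimately have "((\<lambda>y. - ln (norm (y - a))) has_derivative (\<lambda>v. v \<bullet> (- (coef \<alpha> *\<^sub>R kern (\<alpha> + 2) (y - a))))) (at y)"
      by simp
    then show ?thesis
      unfolding gderiv_def using True by (simp add: ln_div ln_inverse divide_inverse)
  next
    case False
    from has_derivative_compose[OF sh norm_powr_has_derivative[OF z, of "- \<alpha>"]]
    have "((\<lambda>y. norm (y - a) powr (- \<alpha>)) has_derivative
        (\<lambda>v. - \<alpha> * norm (y - a) powr (- \<alpha> - 2) * ((y - a) \<bullet> v))) (at y)" .
    then show ?thesis
      unfolding gderiv_def using False by (simp add: k coef_def inner_commute mult.assoc)
  qed
qed

lemma GDERIV_unique:
  assumes "GDERIV f y :> g" "GDERIV f y :> g'"
  shows "g = g'"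
proof -
  have "(\<lambda>h. h \<bullet> g) = (\<lambda>h. h \<bullet> g')"
    using has_derivative_unique assms unfolding gderiv_def by blast
  then have "(g - g') \<bullet> (g - g') = 0" by (metis inner_diff_right right_minus_eq)
  then show ?thesis by simp
qed

locale cluster_flow =
  fixes \<alpha> :: real and n :: nat and x :: "nat \<Rightarrow> real^2"
  assumes \<alpha>: "0 \<le> \<alpha>" "\<alpha> \<le> 1" and cluster: "cluster n x"
begin

text \<open>The gradient of the energy wherever every particle is at distance at least 1/2, extended
  by the cap to a bounded Lipschitz field on the plane.\<close>

definition F :: "real^2 \<Rightarrow> real^2" where
  "F y = - (coef \<alpha> *\<^sub>R (\<Sum>j=1..n. kern (\<alpha> + 2) (y - x j)))"

lemma coef_pos: "coef \<alpha> > 0" using \<alpha> by (simp add: coef_def)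

lemma separated: "\<lbrakk>i \<in> {1..n}; j \<in> {1..n}; i \<noteq> j\<rbrakk> \<Longrightarrow> dist (x i) (x j) \<ge> 1"
  using cluster by (auto simp: cluster_def)

lemma n_pos: "n \<ge> 1" using cluster by (simp add: cluster_def)

lemma x_norm: "j \<in> {1..n} \<Longrightarrow> norm (x j) < real n" using cluster by (rule cluster_norm_less)

sublocale planar_field F "coef \<alpha> * (real n * 32)" "coef \<alpha> * (real n * 4)"
proof
  fix y z
  have "norm (F y - F z) = coef \<alpha> * norm (\<Sum>j=1..n. kern (\<alpha> + 2) (y - x j) - kern (\<alpha> + 2) (z - x j))"
    using coef_pos by (simp add: F_def norm_minus_commute sum_subtractf flip: scaleR_diff_right)
  also have "\<dots> \<le> coef \<alpha> * (\<Sum>j=1..n. 32 * norm (y - z))"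
  proof (intro mult_left_mono sum_norm_le)
    fix j
    show "norm (kern (\<alpha> + 2) (y - x j) - kern (\<alpha> + 2) (z - x j)) \<le> 32 * norm (y - z)"
      using kern_lipschitz[of "\<alpha> + 2" "y - x j" "z - x j"] \<alpha> by simp
  qed (use coef_pos in auto)
  finally show "norm (F y - F z) \<le> coef \<alpha> * (real n * 32) * norm (y - z)" by (simp add: algebra_simps)
  have "norm (F y) \<le> coef \<alpha> * (\<Sum>j=1..n. 4)"
    unfolding F_def using coef_pos \<alpha> by (simp del: sum_constant) (intro mult_left_mono sum_norm_le kern_norm_le; simp)
  then show "norm (F y) \<le> coef \<alpha> * (real n * 4)" by simp
qed

lemma F_nonneg_div:
  assumes "\<And>j. j \<in> {1..n} \<Longrightarrow> norm (z - x j) > 1/2"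
  shows "nonneg_div_at z"
  unfolding nonneg_div_at_def
proof (intro exI conjI allI)
  let ?J = "\<lambda>v. - (coef \<alpha> *\<^sub>R (\<Sum>j=1..n. kern_deriv (\<alpha> + 2) (z - x j) v))"
  have "((\<lambda>z. kern (\<alpha> + 2) (z - x j)) has_derivative (\<lambda>v. kern_deriv (\<alpha> + 2) (z - x j) v)) (at z)"
    if "j \<in> {1..n}" for j
  proof -
    have "((\<lambda>z. z - x j) has_derivative (\<lambda>v. v)) (at z)" by (auto intro!: derivative_eq_intros)
    from has_derivative_compose[OF this kern_has_derivative[OF assms[OF that]]] show ?thesis .
  qed
  then show "(F has_derivative ?J) (at z)"
    unfolding F_def[abs_def]
    by (intro has_derivative_minus has_derivative_scaleR_right has_derivative_sum)
  fix v
  have "norm (\<Sum>j=1..n. kern_deriv (\<alpha> + 2) (z - x j) v) \<le> (\<Sum>j=1..n. 32 * norm v)"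
    using assms \<alpha> by (intro sum_norm_le kern_deriv_norm_le) auto
  then have "coef \<alpha> * norm (\<Sum>j=1..n. kern_deriv (\<alpha> + 2) (z - x j) v) \<le> coef \<alpha> * (real n * (32 * norm v))"
    using coef_pos by (intro mult_left_mono) auto
  then show "norm (?J v) \<le> coef \<alpha> * (real n * 32) * norm v"
    using coef_pos by (simp add: mult.assoc)
next
  have "0 \<le> - (kern_deriv (\<alpha> + 2) (z - x j) (axis 1 1) $ 1 + kern_deriv (\<alpha> + 2) (z - x j) (axis 2 1) $ 2)"
    if "j \<in> {1..n}" for j
  proof -
    have "z - x j \<noteq> 0" using assms[OF that] by auto
    from kern_deriv_trace[OF this, of "\<alpha> + 2"] show ?thesis using \<alpha> by simp
  qed
  then have "0 \<le> (\<Sum>j=1..n. - (kern_deriv (\<alpha> + 2) (z - x j) (axis 1 1) $ 1 + kern_deriv (\<alpha> + 2) (z - x j) (axis 2 1) $ 2))"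
    by (intro sum_nonneg) auto
  then have "0 \<le> coef \<alpha> * (\<Sum>j=1..n. - (kern_deriv (\<alpha> + 2) (z - x j) (axis 1 1) $ 1 + kern_deriv (\<alpha> + 2) (z - x j) (axis 2 1) $ 2))"
    using coef_pos by simp
  then show "0 \<le> (- (coef \<alpha> *\<^sub>R (\<Sum>j=1..n. kern_deriv (\<alpha> + 2) (z - x j) (axis 1 1)))) $ 1
      + (- (coef \<alpha> *\<^sub>R (\<Sum>j=1..n. kern_deriv (\<alpha> + 2) (z - x j) (axis 2 1)))) $ 2"
    by (simp add: sum_negf sum.distrib sum_subtractf algebra_simps)
qed

lemma energy_GDERIV:
  assumes "\<And>j. j \<in> {1..n} \<Longrightarrow> norm (y - x j) \<ge> 1/2"
  shows "GDERIV (energy \<alpha> n x) y :> F y"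
proof -
  have "((\<lambda>y. \<Sum>j=1..n. if \<alpha> = 0 then ln (1 / norm (y - x j)) else norm (y - x j) powr (- \<alpha>))
      has_derivative (\<lambda>v. \<Sum>j=1..n. v \<bullet> (- (coef \<alpha> *\<^sub>R kern (\<alpha> + 2) (y - x j))))) (at y)"
    using energy_summand_GDERIV assms unfolding gderiv_def by (intro has_derivative_sum) blast
  moreover have "(\<lambda>v. \<Sum>j=1..n. v \<bullet> (- (coef \<alpha> *\<^sub>R kern (\<alpha> + 2) (y - x j)))) = (\<lambda>v. v \<bullet> F y)"
    by (simp add: F_def inner_sum_right scaleR_sum_right sum_negf fun_eq_iff)
  ultimately show ?thesis unfolding gderiv_def energy_def[abs_def] by simp
qed

section \<open>Hitting sets and their measurability\<close>

definition hits :: "nat \<Rightarrow> (real^2) set" where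
  "hits i = {y. \<exists>T\<ge>0. dist (flow T y) (x i) = 1 \<and> (\<forall>t\<in>{0..<T}. \<forall>j\<in>{1..n}. dist (flow t y) (x j) > 1)}"

definition outside :: "(real^2) set" where
  "outside = {y. \<forall>j\<in>{1..n}. dist y (x j) > 1}"

lemma dist_gt_1_before:
  fixes u :: "real \<Rightarrow> 'c::metric_space"
  assumes "continuous_on {0..T} u" "dist (u 0) p > 1" "\<And>t. t \<in> {0..<T} \<Longrightarrow> dist (u t) p \<noteq> 1"
  shows "t \<in> {0..<T} \<Longrightarrow> dist (u t) p > 1" and "t \<in> {0..T} \<Longrightarrow> dist (u t) p \<ge> 1"
proof -
  have *: "dist (u t) p \<ge> 1" if t: "t \<in> {0..T}" for t
  proof (rule ccontr)
    assume "\<not> dist (u t) p \<ge> 1"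
    moreover have "continuous_on {0..t} (\<lambda>t. dist (u t) p)"
      using t by (intro continuous_intros continuous_on_subset[OF assms(1)]) auto
    ultimately obtain s where s: "0 \<le> s" "s \<le> t" "dist (u s) p = 1"
      using IVT2'[of "\<lambda>t. dist (u t) p" t 1 0] assms(2) t by auto
    then have "s \<noteq> t" using \<open>\<not> dist (u t) p \<ge> 1\<close> by auto
    then show False using s t assms(3)[of s] by auto
  qed
  show "dist (u t) p \<ge> 1" if "t \<in> {0..T}" using * that .
  show "dist (u t) p > 1" if "t \<in> {0..<T}" using *[of t] assms(3)[of t] that by force
qed

text \<open>From outside, a continuous path that has not been at distance 1 from a particle is still
  at distance greater than 1. Up to the hit the capped field is therefore the gradient, and
  uniqueness identifies the ascent flow with \<open>flow\<close>.\<close>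

lemma attaches_iff:
  assumes y: "y \<in> outside" and i: "i \<in> {1..n}"
  shows "attaches \<alpha> n x i y \<longleftrightarrow> y \<in> hits i"
proof
  assume "attaches \<alpha> n x i y"
  then obtain T \<phi> where T: "T \<ge> 0" "\<phi> 0 = y" "ascent_flow \<alpha> n x \<phi> T" "dist (\<phi> T) (x i) = 1"
    "\<And>t j. \<lbrakk>t \<in> {0..<T}; j \<in> {1..n}\<rbrakk> \<Longrightarrow> dist (\<phi> t) (x j) \<noteq> 1"
    unfolding attaches_def by blast
  have c: "continuous_on {0..T} \<phi>"
    using T(3) unfolding ascent_flow_def
    by (auto simp: continuous_on_eq_continuous_within intro: has_vector_derivative_continuous)
  have d: "dist (\<phi> t) (x j) \<ge> 1" "t < T \<Longrightarrow> dist (\<phi> t) (x j) > 1" if "t \<in> {0..T}" "j \<in> {1..n}" for t j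
    using dist_gt_1_before[OF c, of "x j" t] T(2,5) y that by (auto simp: outside_def)
  have der: "(\<phi> has_vector_derivative F (\<phi> t)) (at t)" if t: "0 < t" "t < T" for t
  proof -
    obtain g where g: "GDERIV (energy \<alpha> n x) (\<phi> t) :> g" "(\<phi> has_vector_derivative g) (at t within {0..T})"
      using T(3) t unfolding ascent_flow_def by fastforce
    have "1 \<le> norm (\<phi> t - x j)" if "j \<in> {1..n}" for j using d(1)[of t j] t that by (simp add: dist_norm)
    then have "1/2 \<le> norm (\<phi> t - x j)" if "j \<in> {1..n}" for j using that by fastforce
    then have "g = F (\<phi> t)" using GDERIV_unique[OF g(1) energy_GDERIV] by blast
    moreover have "at t within {0..T} = at t" by (rule at_within_interior) (use t in auto)
    ultimately show ?thesis using g(2) by simp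
  qed
  have eq: "\<phi> t = flow t y" if "t \<in> {0..T}" for t
    using flow_unique[of t \<phi>] der that T(2) continuous_on_subset[OF c, of "{0..t}"] by auto
  show "y \<in> hits i"
    unfolding hits_def using T(1,4) eq d(2) by (intro CollectI exI[of _ T]) auto
next
  assume "y \<in> hits i"
  then obtain T where T: "T \<ge> 0" "dist (flow T y) (x i) = 1"
    "\<And>t j. \<lbrakk>t \<in> {0..<T}; j \<in> {1..n}\<rbrakk> \<Longrightarrow> dist (flow t y) (x j) > 1"
    unfolding hits_def by blast
  have d: "dist (flow t y) (x j) \<ge> 1" if "t \<in> {0..T}" "j \<in> {1..n}" for t j
    using dist_gt_1_before(2)[of T "\<lambda>t. flow t y" "x j" t] T(3)[of _ j] y that flow_continuous_time
    by (force simp: outside_def)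
  have "ascent_flow \<alpha> n x (\<lambda>t. flow t y) T"
    unfolding ascent_flow_def
  proof (intro ballI conjI exI)
    fix t assume t: "t \<in> {0..T}"
    have d': "norm (flow t y - x j) \<ge> 1/2" if "j \<in> {1..n}" for j
      using d[OF t that] unfolding dist_norm by linarith
    show "flow t y \<notin> x ` {1..n}" using d[OF t] by force
    show "GDERIV (energy \<alpha> n x) (flow t y) :> F (flow t y)" by (rule energy_GDERIV[OF d'])
    show "((\<lambda>t. flow t y) has_vector_derivative F (flow t y)) (at t within {0..T})"
      using t by (intro has_vector_derivative_within_subset[OF flow_props(3)]) auto
  qed
  then show "attaches \<alpha> n x i y"
    unfolding attaches_def using T by (intro exI[of _ T] conjI exI[of _ "\<lambda>t. flow t y"]) force+
qed

text \<open>Reaching the closed unit disk by a given time is a closed condition on the starting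
  point, which hitting it before all others is not evidently; \<open>hits\<close> is assembled from
  these sets.\<close>

definition enters :: "nat \<Rightarrow> real \<Rightarrow> (real^2) set" where
  "enters j s = {y. \<exists>t\<in>{0..s}. dist (flow t y) (x j) \<le> 1}"

text \<open>Entry times lie in the compact interval \<open>{0..s}\<close>; a convergent subsequence
  of them and joint continuity of the flow give an entry time of the limit.\<close>

lemma closed_enters: "closed (enters j s)"
  unfolding closed_sequential_limits
proof (intro allI impI, elim conjE)
  fix Y y assume Y: "\<forall>k. Y k \<in> enters j s" "Y \<longlonglongrightarrow> y"
  then have "\<forall>k. \<exists>t. t \<in> {0..s} \<and> dist (flow t (Y k)) (x j) \<le> 1" unfolding enters_def by blast
  then obtain t where t: "\<And>k. t k \<in> {0..s}" "\<And>k. dist (flow (t k) (Y k)) (x j) \<le> 1" by metis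
  obtain r l where l: "l \<in> {0..s}" "strict_mono r" "(t \<circ> r) \<longlonglongrightarrow> l"
    using compact_Icc[of 0 s] t(1) unfolding compact_def by metis
  have "((\<lambda>k. flow ((t \<circ> r) k) ((Y \<circ> r) k)) \<longlongrightarrow> flow l y) sequentially"
    by (rule flow_tendsto[OF l(3) LIMSEQ_subseq_LIMSEQ[OF Y(2) l(2)]]) (use l(1) t(1) in auto)
  then have "(\<lambda>k. dist (flow ((t \<circ> r) k) ((Y \<circ> r) k)) (x j)) \<longlonglongrightarrow> dist (flow l y) (x j)"
    by (intro tendsto_intros)
  then have "dist (flow l y) (x j) \<le> 1"
    by (rule LIMSEQ_le_const2) (use t(2) in auto)
  then show "y \<in> enters j s" using l(1) by (auto simp: enters_def)
qed

text \<open>Being first is expressed without naming the hitting time: whenever some disk has been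
  entered by time q, so has the disk of x_i. Rational q suffice, since one lies strictly between an
  earlier entry and the first entry into the disk of x_i. Simultaneous contacts are allowed on both
  sides.\<close>

lemma hits_Int_outside:
  assumes i: "i \<in> {1..n}"
  shows "hits i \<inter> outside = outside \<inter> (\<Union>N::nat. enters i (real N)) \<inter>
    (\<Inter>j\<in>{1..n}. \<Inter>q\<in>\<rat> \<inter> {0..}. (- enters j q) \<union> enters i q)"
proof (intro set_eqI iffI)
  fix y assume "y \<in> hits i \<inter> outside"
  then obtain T where y: "y \<in> outside" and T: "T \<ge> 0" "dist (flow T y) (x i) = 1"
    "\<And>t j. \<lbrakk>t \<in> {0..<T}; j \<in> {1..n}\<rbrakk> \<Longrightarrow> dist (flow t y) (x j) > 1"
    unfolding hits_def by blast
  have le: "T \<le> s \<Longrightarrow> y \<in> enters i s" for s using T(1,2) by (force simp: enters_def)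
  obtain N :: nat where "T \<le> real N" using real_arch_simple by blast
  moreover have "y \<in> enters i q" if jq: "j \<in> {1..n}" "y \<in> enters j q" for j q
  proof -
    obtain t where "t \<in> {0..q}" "dist (flow t y) (x j) \<le> 1" using jq(2) unfolding enters_def by blast
    then have "T \<le> t" using T(3)[of t j] jq(1) by force
    then show ?thesis using le \<open>t \<in> {0..q}\<close> by auto
  qed
  ultimately show "y \<in> outside \<inter> (\<Union>N::nat. enters i (real N)) \<inter>
    (\<Inter>j\<in>{1..n}. \<Inter>q\<in>\<rat> \<inter> {0..}. (- enters j q) \<union> enters i q)" using y le by blast
next
  fix y assume a: "y \<in> outside \<inter> (\<Union>N::nat. enters i (real N)) \<inter>
    (\<Inter>j\<in>{1..n}. \<Inter>q\<in>\<rat> \<inter> {0..}. (- enters j q) \<union> enters i q)"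
  define S where "S = {t. t \<ge> 0 \<and> dist (flow t y) (x i) \<le> 1}"
  have "closed S"
    unfolding S_def by (intro closed_Collect_conj closed_Collect_le continuous_intros flow_continuous_time)
  moreover have "S \<noteq> {}" using a by (auto simp: S_def enters_def)
  moreover have bS: "bdd_below S" by (rule bdd_belowI[of _ 0]) (simp add: S_def)
  ultimately have "Inf S \<in> S" using closed_contains_Inf by blast
  define T where "T = Inf S"
  have T: "T \<ge> 0" "dist (flow T y) (x i) \<le> 1" using \<open>Inf S \<in> S\<close> by (auto simp: S_def T_def)
  have min: "T \<le> t" if "t \<ge> 0" "dist (flow t y) (x i) \<le> 1" for t
    using that cInf_lower[OF _ bS] by (simp add: T_def S_def)
  have before: "dist (flow t y) (x j) > 1" if t: "t \<in> {0..<T}" and j: "j \<in> {1..n}" for t j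
  proof (rule ccontr)
    assume "\<not> dist (flow t y) (x j) > 1"
    obtain q where q: "q \<in> \<rat>" "t < q" "q < T" using t Rats_dense_in_real[of t T] by auto
    then have "y \<in> enters j q" using t \<open>\<not> dist (flow t y) (x j) > 1\<close> by (force simp: enters_def)
    then have "y \<in> enters i q" using a q j t by auto
    then obtain s where "s \<in> {0..q}" "dist (flow s y) (x i) \<le> 1" by (auto simp: enters_def)
    then show False using min[of s] q by auto
  qed
  have "dist (flow T y) (x i) \<ge> 1"
  proof (rule dist_gt_1_before(2)[of T "\<lambda>t. flow t y"])
    show "1 < dist (flow 0 y) (x i)" using a i by (simp add: outside_def)
    show "dist (flow t y) (x i) \<noteq> 1" if "t \<in> {0..<T}" for t using before[OF that i] by simp
  qed (use T(1) flow_continuous_time in auto)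
  then have "dist (flow T y) (x i) = 1" using T by simp
  then show "y \<in> hits i \<inter> outside" unfolding hits_def using a T(1) before by blast
qed

lemma outside_open: "open outside"
proof -
  have "outside = (\<Inter>j\<in>{1..n}. {y. 1 < dist y (x j)})" by (auto simp: outside_def)
  then show ?thesis by (auto intro!: open_Collect_less continuous_intros)
qed

lemma hits_borel: "i \<in> {1..n} \<Longrightarrow> hits i \<inter> outside \<in> sets borel"
  unfolding hits_Int_outside
  using borel_closed[OF closed_enters] borel_open[OF outside_open] n_pos
  by (intro sets.Int sets.countable_UN sets.finite_INT sets.countable_INT' sets.Un)
     (auto simp: countable_rat intro!: exI[of _ 0])

lemma hits_flow:
  assumes "s \<ge> 0" "\<And>t. t \<in> {0..s} \<Longrightarrow> flow t y \<in> outside" "i \<in> {1..n}"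
  shows "flow s y \<in> hits i \<longleftrightarrow> y \<in> hits i"
proof
  assume "flow s y \<in> hits i"
  then obtain T where T: "T \<ge> 0" "dist (flow T (flow s y)) (x i) = 1"
    "\<And>t j. \<lbrakk>t \<in> {0..<T}; j \<in> {1..n}\<rbrakk> \<Longrightarrow> dist (flow t (flow s y)) (x j) > 1"
    unfolding hits_def by blast
  have "dist (flow t y) (x j) > 1" if "t \<in> {0..<s + T}" "j \<in> {1..n}" for t j
  proof (cases "t \<le> s")
    case True
    then show ?thesis using assms(2)[of t] that by (auto simp: outside_def)
  next
    case False
    then show ?thesis using T(3)[of "t - s" j] flow_add[of s "t - s" y] assms(1) that by auto
  qed
  moreover have "dist (flow (s + T) y) (x i) = 1" using T flow_add assms(1) by simp
  ultimately show "y \<in> hits i" unfolding hits_def using T(1) assms(1) by (intro CollectI exI[of _ "s + T"]) auto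
next
  assume "y \<in> hits i"
  then obtain T where T: "T \<ge> 0" "dist (flow T y) (x i) = 1"
    "\<And>t j. \<lbrakk>t \<in> {0..<T}; j \<in> {1..n}\<rbrakk> \<Longrightarrow> dist (flow t y) (x j) > 1"
    unfolding hits_def by blast
  have sT: "s < T" using assms(2)[of T] T(1,2) assms(3) by (force simp: outside_def)
  have "dist (flow t (flow s y)) (x j) > 1" if "t \<in> {0..<T - s}" "j \<in> {1..n}" for t j
    using T(3)[of "s + t" j] flow_add[of s t y] assms(1) that by auto
  moreover have "dist (flow (T - s) (flow s y)) (x i) = 1"
    using T flow_add[of s "T - s" y] assms(1) sT by simp
  ultimately show "flow s y \<in> hits i"
    unfolding hits_def using sT by (intro CollectI exI[of _ "T - s"]) auto
qed

end

section \<open>Flow lines far from the cluster\<close>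

context cluster_flow
begin

text \<open>\<open>rad\<close> and \<open>tang\<close> are the coordinates of a particle in the
  radial and tangential directions at angle \<theta>; \<open>sqd\<close> is then its squared
  distance from the circle point, by the law of cosines, and \<open>wt\<close> that distance to the
  power - (\<alpha> + 2).\<close>

definition rad :: "real \<Rightarrow> nat \<Rightarrow> real" where
  "rad \<theta> j = x j $ 1 * cos \<theta> + x j $ 2 * sin \<theta>"

definition tang :: "real \<Rightarrow> nat \<Rightarrow> real" where
  "tang \<theta> j = x j $ 2 * cos \<theta> - x j $ 1 * sin \<theta>"

definition sqd :: "real \<Rightarrow> real \<Rightarrow> nat \<Rightarrow> real" where
  "sqd \<rho> \<theta> j = \<rho>\<^sup>2 - 2 * \<rho> * rad \<theta> j + (norm (x j))\<^sup>2"

definition wt :: "real \<Rightarrow> real \<Rightarrow> nat \<Rightarrow> real" where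
  "wt \<rho> \<theta> j = sqd \<rho> \<theta> j powr (- (\<alpha> + 2) / 2)"

definition tsum :: "real \<Rightarrow> real \<Rightarrow> real" where
  "tsum \<rho> \<theta> = (\<Sum>j=1..n. wt \<rho> \<theta> j * tang \<theta> j)"

definition rsum :: "real \<Rightarrow> real \<Rightarrow> real" where
  "rsum \<rho> \<theta> = (\<Sum>j=1..n. wt \<rho> \<theta> j * (\<rho> - rad \<theta> j))"

definition wsum :: "real \<Rightarrow> real \<Rightarrow> real" where
  "wsum \<rho> \<theta> = (\<Sum>j=1..n. wt \<rho> \<theta> j)"

text \<open>The derivative of the angle with respect to the radius along a flow line: the field has
  components proportional to \<open>tsum\<close> (tangential) and - \<open>rsum\<close> (radial),
  and the common factor \<open>coef \<alpha>\<close> cancels.\<close>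

definition slope :: "real \<Rightarrow> real \<Rightarrow> real" where
  "slope \<rho> \<theta> = - tsum \<rho> \<theta> / (\<rho> * rsum \<rho> \<theta>)"

lemma rad_tang_sq: "(rad \<theta> j)\<^sup>2 + (tang \<theta> j)\<^sup>2 = (norm (x j))\<^sup>2"
proof -
  have "(rad \<theta> j)\<^sup>2 + (tang \<theta> j)\<^sup>2 = ((x j $ 1)\<^sup>2 + (x j $ 2)\<^sup>2) * ((cos \<theta>)\<^sup>2 + (sin \<theta>)\<^sup>2)"
    by (simp only: rad_def tang_def power2_eq_square) (simp only: algebra_simps)
  moreover have "(norm (x j))\<^sup>2 = (x j $ 1)\<^sup>2 + (x j $ 2)\<^sup>2"
    by (simp only: power2_norm_eq_inner inner_real2) (simp only: power2_eq_square)
  ultimately show ?thesis by simp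
qed

lemma rad_abs_le: "\<bar>rad \<theta> j\<bar> \<le> norm (x j)" and tang_abs_le: "\<bar>tang \<theta> j\<bar> \<le> norm (x j)"
proof -
  have "(rad \<theta> j)\<^sup>2 \<le> (norm (x j))\<^sup>2" "(tang \<theta> j)\<^sup>2 \<le> (norm (x j))\<^sup>2"
    using rad_tang_sq[of \<theta> j] zero_le_power2[of "rad \<theta> j"] zero_le_power2[of "tang \<theta> j"] by linarith+
  then show "\<bar>rad \<theta> j\<bar> \<le> norm (x j)" "\<bar>tang \<theta> j\<bar> \<le> norm (x j)"
    unfolding abs_le_square_iff[symmetric] by simp_all
qed

lemma wsum_mult: "(\<Sum>j=1..n. wt \<rho> \<theta> j * k) = wsum \<rho> \<theta> * k"
  unfolding wsum_def by (rule sum_distrib_right[symmetric])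

text \<open>Everything rests on particle norms below n \<le> \<rho> / 4: the distance to the circle
  point is at least 3/4 \<rho>, whose square gives 9/16.\<close>

lemma
  assumes "\<rho> \<ge> 4 * real n" "j \<in> {1..n}"
  shows far_rad: "\<bar>rad \<theta> j\<bar> \<le> real n" and far_tang: "\<bar>tang \<theta> j\<bar> \<le> real n"
    and far_sqd: "9/16 * \<rho>\<^sup>2 \<le> sqd \<rho> \<theta> j" and far_wt: "wt \<rho> \<theta> j > 0"
    and far_pos: "\<rho> > 0" "4 * real n \<le> \<rho>"
proof -
  have n: "real n \<ge> 1" using n_pos by simp
  show \<rho>: "\<rho> > 0" "4 * real n \<le> \<rho>" using assms n by auto
  have xn: "norm (x j) \<le> real n" using x_norm[OF assms(2)] by simp
  show "\<bar>rad \<theta> j\<bar> \<le> real n" "\<bar>tang \<theta> j\<bar> \<le> real n"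
    using rad_abs_le[of \<theta> j] tang_abs_le[of \<theta> j] xn by auto
  have "\<rho> * rad \<theta> j \<le> \<rho> * norm (x j)"
    using rad_abs_le[of \<theta> j] \<rho> by (intro mult_left_mono) auto
  then have 1: "(\<rho> - norm (x j))\<^sup>2 \<le> sqd \<rho> \<theta> j"
    by (simp add: sqd_def power2_eq_square algebra_simps)
  have "(3/4 * \<rho>)\<^sup>2 \<le> (\<rho> - norm (x j))\<^sup>2" using xn \<rho> by (intro power_mono) auto
  also note 1
  finally show s: "9/16 * \<rho>\<^sup>2 \<le> sqd \<rho> \<theta> j" by (simp add: power2_eq_square)
  have "sqd \<rho> \<theta> j > 0" using s \<rho> by (intro less_le_trans[OF _ s]) simp
  then show "wt \<rho> \<theta> j > 0" by (simp add: wt_def)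
qed

lemma wt_sum_abs_le:
  assumes "\<rho> \<ge> 4 * real n" "\<And>j. j \<in> {1..n} \<Longrightarrow> \<bar>g j\<bar> \<le> k"
  shows "\<bar>\<Sum>j=1..n. wt \<rho> \<theta> j * g j\<bar> \<le> k * wsum \<rho> \<theta>"
proof -
  have "\<bar>\<Sum>j=1..n. wt \<rho> \<theta> j * g j\<bar> \<le> (\<Sum>j=1..n. wt \<rho> \<theta> j * k)"
  proof (rule order_trans[OF sum_abs sum_mono])
    fix j assume j: "j \<in> {1..n}"
    have "wt \<rho> \<theta> j * \<bar>g j\<bar> \<le> wt \<rho> \<theta> j * k"
      using far_wt[OF assms(1) j, of \<theta>] assms(2)[OF j] by (intro mult_left_mono) auto
    then show "\<bar>wt \<rho> \<theta> j * g j\<bar> \<le> wt \<rho> \<theta> j * k"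
      using far_wt[OF assms(1) j, of \<theta>] by (simp add: abs_mult)
  qed
  then show ?thesis unfolding wsum_mult by (simp only: mult.commute)
qed

lemma circle_point_minus:
  "circle_point \<rho> \<theta> - x j = (\<rho> - rad \<theta> j) *\<^sub>R circle_point 1 \<theta> - tang \<theta> j *\<^sub>R vector [- sin \<theta>, cos \<theta>]"
proof -
  note 1 = sin_cos_squared_add3[of \<theta>]
  have "\<rho> * cos \<theta> - x j $ 1 = (\<rho> - rad \<theta> j) * cos \<theta> - tang \<theta> j * (- sin \<theta>)"
    unfolding rad_def tang_def using 1 by algebra
  moreover have "\<rho> * sin \<theta> - x j $ 2 = (\<rho> - rad \<theta> j) * sin \<theta> - tang \<theta> j * cos \<theta>"
    unfolding rad_def tang_def using 1 by algebra
  ultimately show ?thesis by (simp add: vec_eq_iff forall_2)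
qed

lemma norm_circle_point_minus: "(norm (circle_point \<rho> \<theta> - x j))\<^sup>2 = sqd \<rho> \<theta> j"
proof -
  have "circle_point \<rho> \<theta> \<bullet> x j = \<rho> * rad \<theta> j"
    by (simp add: inner_real2 rad_def algebra_simps)
  moreover have "circle_point \<rho> \<theta> \<bullet> circle_point \<rho> \<theta> = \<rho>\<^sup>2"
    using norm_circle_point[of \<rho> \<theta>] by (simp add: dot_square_norm)
  moreover have "(norm (a - b))\<^sup>2 = a \<bullet> a - 2 * (a \<bullet> b) + (norm b)\<^sup>2" for a b :: "real^2"
    by (simp add: power2_norm_eq_inner inner_diff_left inner_diff_right inner_commute)
  ultimately show ?thesis by (simp add: sqd_def)
qed

lemma F_circle_point:
  assumes "\<rho> \<ge> 4 * real n"
  shows "F (circle_point \<rho> \<theta>) = coef \<alpha> *\<^sub>R (tsum \<rho> \<theta> *\<^sub>R vector [- sin \<theta>, cos \<theta>] - rsum \<rho> \<theta> *\<^sub>R circle_point 1 \<theta>)"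
proof -
  have "kern (\<alpha> + 2) (circle_point \<rho> \<theta> - x j) = (wt \<rho> \<theta> j * (\<rho> - rad \<theta> j)) *\<^sub>R circle_point 1 \<theta>
      - (wt \<rho> \<theta> j * tang \<theta> j) *\<^sub>R vector [- sin \<theta>, cos \<theta>]" if j: "j \<in> {1..n}" for j
  proof -
    let ?z = "circle_point \<rho> \<theta> - x j"
    have "(3/4 * \<rho>)\<^sup>2 \<le> (norm ?z)\<^sup>2"
      using far_sqd[OF assms j, of \<theta>] norm_circle_point_minus[of \<rho> \<theta> j] by (simp add: power2_eq_square)
    then have "3/4 * \<rho> \<le> norm ?z" by (rule power2_le_imp_le) simp
    then have z: "norm ?z \<ge> 1/2" using assms n_pos by simp
    have "sqd \<rho> \<theta> j = norm ?z powr 2" using z by (simp add: powr_numeral norm_circle_point_minus)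
    then have "wt \<rho> \<theta> j = norm ?z powr (2 * (- (\<alpha> + 2) / 2))" by (simp only: wt_def powr_powr)
    also have "2 * (- (\<alpha> + 2) / 2) = - (\<alpha> + 2)" by simp
    finally have w: "wt \<rho> \<theta> j = norm ?z powr (- (\<alpha> + 2))" .
    have m: "max (norm ?z) (1/2) = norm ?z" using z by simp
    have "kern (\<alpha> + 2) ?z = wt \<rho> \<theta> j *\<^sub>R ?z" unfolding kern_def m w by simp
    also have "\<dots> = (wt \<rho> \<theta> j * (\<rho> - rad \<theta> j)) *\<^sub>R circle_point 1 \<theta>
      - (wt \<rho> \<theta> j * tang \<theta> j) *\<^sub>R vector [- sin \<theta>, cos \<theta>]"
      unfolding circle_point_minus by (simp add: scaleR_diff_right)
    finally show ?thesis .
  qed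
  then have "(\<Sum>j=1..n. kern (\<alpha> + 2) (circle_point \<rho> \<theta> - x j))
      = rsum \<rho> \<theta> *\<^sub>R circle_point 1 \<theta> - tsum \<rho> \<theta> *\<^sub>R vector [- sin \<theta>, cos \<theta>]"
    by (simp add: sum_subtractf rsum_def tsum_def scaleR_sum_left)
  then show ?thesis unfolding F_def by (simp flip: scaleR_minus_right)
qed

lemma
  assumes "\<rho> \<ge> 4 * real n"
  shows wsum_pos: "wsum \<rho> \<theta> > 0" and rsum_ge: "3/4 * \<rho> * wsum \<rho> \<theta> \<le> rsum \<rho> \<theta>"
    and rsum_pos: "rsum \<rho> \<theta> > 0" and tsum_le: "\<bar>tsum \<rho> \<theta>\<bar> \<le> real n * wsum \<rho> \<theta>"
proof -
  show w: "wsum \<rho> \<theta> > 0"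
    unfolding wsum_def using n_pos far_wt[OF assms] by (intro sum_pos) auto
  have "(\<Sum>j=1..n. wt \<rho> \<theta> j * (3/4 * \<rho>)) \<le> rsum \<rho> \<theta>"
    unfolding rsum_def
  proof (rule sum_mono)
    fix j assume j: "j \<in> {1..n}"
    then show "wt \<rho> \<theta> j * (3/4 * \<rho>) \<le> wt \<rho> \<theta> j * (\<rho> - rad \<theta> j)"
      using far_rad[OF assms j, of \<theta>] far_pos(2)[OF assms j] far_wt[OF assms j, of \<theta>]
      by (intro mult_left_mono) auto
  qed
  then show r: "3/4 * \<rho> * wsum \<rho> \<theta> \<le> rsum \<rho> \<theta>"
    unfolding wsum_mult by (simp only: mult.commute)
  have "\<rho> > 0" using assms n_pos by simp
  then have "0 < 3/4 * \<rho> * wsum \<rho> \<theta>" using w by simp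
  then show "rsum \<rho> \<theta> > 0" using r by linarith
  show "\<bar>tsum \<rho> \<theta>\<bar> \<le> real n * wsum \<rho> \<theta>"
    unfolding tsum_def using far_tang[OF assms] by (intro wt_sum_abs_le assms) auto
qed

lemma rad_deriv: "((\<lambda>\<theta>. rad \<theta> j) has_real_derivative tang \<theta> j) (at \<theta>)"
  unfolding rad_def tang_def by (auto intro!: derivative_eq_intros)

lemma tang_deriv: "((\<lambda>\<theta>. tang \<theta> j) has_real_derivative - rad \<theta> j) (at \<theta>)"
  unfolding rad_def tang_def by (auto intro!: derivative_eq_intros)

lemma wt_deriv:
  assumes "\<rho> \<ge> 4 * real n" "j \<in> {1..n}"
  shows "((\<lambda>\<theta>. wt \<rho> \<theta> j) has_real_derivative
    wt \<rho> \<theta> j * ((\<alpha> + 2) * \<rho> * tang \<theta> j / sqd \<rho> \<theta> j)) (at \<theta>)"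
proof -
  have pos: "sqd \<rho> \<theta> j > 0"
    using far_sqd[OF assms, of \<theta>] far_pos(1)[OF assms] by (intro less_le_trans[OF _ far_sqd[OF assms]]) simp
  have sq: "((\<lambda>\<theta>. sqd \<rho> \<theta> j) has_real_derivative - (2 * \<rho> * tang \<theta> j)) (at \<theta>)"
    unfolding sqd_def by (auto intro!: derivative_eq_intros rad_deriv)
  have "((\<lambda>s. s powr (- (\<alpha> + 2) / 2)) has_real_derivative
      (- (\<alpha> + 2) / 2) * sqd \<rho> \<theta> j powr (- (\<alpha> + 2) / 2 - 1)) (at (sqd \<rho> \<theta> j))"
    using has_real_derivative_powr[OF pos] .
  from DERIV_chain2[OF this sq]
  have "((\<lambda>\<theta>. wt \<rho> \<theta> j) has_real_derivative
      (- (\<alpha> + 2) / 2) * sqd \<rho> \<theta> j powr (- (\<alpha> + 2) / 2 - 1) * - (2 * \<rho> * tang \<theta> j)) (at \<theta>)"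
    by (simp add: wt_def)
  moreover have "sqd \<rho> \<theta> j powr (- (\<alpha> + 2) / 2 - 1) = wt \<rho> \<theta> j / sqd \<rho> \<theta> j"
    using pos by (simp add: wt_def powr_diff)
  ultimately show ?thesis
    using pos by (elim DERIV_cong) (simp add: field_simps)
qed

definition tsum' :: "real \<Rightarrow> real \<Rightarrow> real" where
  "tsum' \<rho> \<theta> = (\<Sum>j=1..n. wt \<rho> \<theta> j * ((\<alpha> + 2) * \<rho> * (tang \<theta> j)\<^sup>2 / sqd \<rho> \<theta> j - rad \<theta> j))"

definition rsum' :: "real \<Rightarrow> real \<Rightarrow> real" where
  "rsum' \<rho> \<theta> = (\<Sum>j=1..n. wt \<rho> \<theta> j * (tang \<theta> j * ((\<alpha> + 2) * \<rho> * (\<rho> - rad \<theta> j) / sqd \<rho> \<theta> j - 1)))"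

lemma tsum_deriv:
  assumes "\<rho> \<ge> 4 * real n"
  shows "(tsum \<rho> has_real_derivative tsum' \<rho> \<theta>) (at \<theta>)"
  unfolding tsum_def[abs_def] tsum'_def
  by (rule DERIV_sum, rule DERIV_cong[OF DERIV_mult[OF wt_deriv[OF assms] tang_deriv]])
     (auto simp: power2_eq_square algebra_simps)

lemma rsum_deriv:
  assumes "\<rho> \<ge> 4 * real n"
  shows "(rsum \<rho> has_real_derivative rsum' \<rho> \<theta>) (at \<theta>)"
  unfolding rsum_def[abs_def] rsum'_def
  by (rule DERIV_sum, rule DERIV_cong[OF DERIV_mult[OF wt_deriv[OF assms] DERIV_diff[OF DERIV_const rad_deriv]]])
     (auto simp: algebra_simps)

text \<open>From \<alpha> + 2 \<le> 3, \<open>tang\<^sup>2 \<le> n * \<rho> / 4\<close> and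
  \<open>sqd \<ge> 9/16 * \<rho>\<^sup>2\<close> the quotients are at most 4/3 n and 20/3; adding
  the remaining n and 1 gives 7/3 and 23/3.\<close>

lemma
  assumes "\<rho> \<ge> 4 * real n"
  shows tsum'_le: "\<bar>tsum' \<rho> \<theta>\<bar> \<le> 7/3 * real n * wsum \<rho> \<theta>"
    and rsum'_le: "\<bar>rsum' \<rho> \<theta>\<bar> \<le> 23/3 * real n * wsum \<rho> \<theta>"
proof -
  have t: "\<bar>(\<alpha> + 2) * \<rho> * (tang \<theta> j)\<^sup>2 / sqd \<rho> \<theta> j - rad \<theta> j\<bar> \<le> 7/3 * real n"
    and r: "\<bar>tang \<theta> j * ((\<alpha> + 2) * \<rho> * (\<rho> - rad \<theta> j) / sqd \<rho> \<theta> j - 1)\<bar> \<le> 23/3 * real n"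
    if j: "j \<in> {1..n}" for j
  proof -
    note f = far_rad[OF assms j, of \<theta>] far_tang[OF assms j, of \<theta>] far_sqd[OF assms j, of \<theta>] far_pos[OF assms j]
    have s: "sqd \<rho> \<theta> j > 0" using f by (intro less_le_trans[OF _ f(3)]) simp
    have "(tang \<theta> j)\<^sup>2 = \<bar>tang \<theta> j\<bar> * \<bar>tang \<theta> j\<bar>" by (simp add: power2_eq_square)
    also have "\<dots> \<le> real n * (\<rho> / 4)" using f by (intro mult_mono) auto
    finally have "(\<alpha> + 2) * \<rho> * (tang \<theta> j)\<^sup>2 \<le> 3 * \<rho> * (real n * (\<rho> / 4))"
      using \<alpha> f by (intro mult_mono mult_nonneg_nonneg) auto
    also have "\<dots> = 4/3 * real n * (9/16 * \<rho>\<^sup>2)" by (simp add: power2_eq_square)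
    also have "\<dots> \<le> 4/3 * real n * sqd \<rho> \<theta> j" using f by (intro mult_left_mono) auto
    finally have 1: "(\<alpha> + 2) * \<rho> * (tang \<theta> j)\<^sup>2 / sqd \<rho> \<theta> j \<le> 4/3 * real n"
      using s by (simp add: divide_le_eq)
    have "0 \<le> (\<alpha> + 2) * \<rho> * (tang \<theta> j)\<^sup>2 / sqd \<rho> \<theta> j" using \<alpha> f s by simp
    then show "\<bar>(\<alpha> + 2) * \<rho> * (tang \<theta> j)\<^sup>2 / sqd \<rho> \<theta> j - rad \<theta> j\<bar> \<le> 7/3 * real n"
      using 1 f(1) by linarith
    have "(\<alpha> + 2) * \<rho> * (\<rho> - rad \<theta> j) \<le> 3 * \<rho> * (5/4 * \<rho>)"
      using \<alpha> f by (intro mult_mono mult_nonneg_nonneg) auto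
    also have "\<dots> = 20/3 * (9/16 * \<rho>\<^sup>2)" by (simp add: power2_eq_square)
    also have "\<dots> \<le> 20/3 * sqd \<rho> \<theta> j" using f by (intro mult_left_mono) auto
    finally have 2: "(\<alpha> + 2) * \<rho> * (\<rho> - rad \<theta> j) / sqd \<rho> \<theta> j \<le> 20/3"
      using s by (simp add: divide_le_eq)
    have "0 \<le> (\<alpha> + 2) * \<rho> * (\<rho> - rad \<theta> j) / sqd \<rho> \<theta> j"
      using \<alpha> f s by (intro divide_nonneg_pos mult_nonneg_nonneg) auto
    then have "\<bar>(\<alpha> + 2) * \<rho> * (\<rho> - rad \<theta> j) / sqd \<rho> \<theta> j - 1\<bar> \<le> 23/3" using 2 by linarith
    then have "\<bar>tang \<theta> j\<bar> * \<bar>(\<alpha> + 2) * \<rho> * (\<rho> - rad \<theta> j) / sqd \<rho> \<theta> j - 1\<bar> \<le> real n * (23/3)"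
      using f(2) by (intro mult_mono) auto
    then show "\<bar>tang \<theta> j * ((\<alpha> + 2) * \<rho> * (\<rho> - rad \<theta> j) / sqd \<rho> \<theta> j - 1)\<bar> \<le> 23/3 * real n"
      by (simp add: abs_mult)
  qed
  show "\<bar>tsum' \<rho> \<theta>\<bar> \<le> 7/3 * real n * wsum \<rho> \<theta>"
    unfolding tsum'_def by (rule wt_sum_abs_le[OF assms t])
  show "\<bar>rsum' \<rho> \<theta>\<bar> \<le> 23/3 * real n * wsum \<rho> \<theta>"
    unfolding rsum'_def by (rule wt_sum_abs_le[OF assms r])
qed

lemma slope_abs_le:
  assumes "\<rho> \<ge> 4 * real n"
  shows "\<bar>slope \<rho> \<theta>\<bar> \<le> 1"
proof -
  have \<rho>: "\<rho> > 0" "\<rho> \<ge> 4" using assms n_pos by auto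
  note w = wsum_pos[OF assms, of \<theta>] and r = rsum_ge[OF assms, of \<theta>] rsum_pos[OF assms, of \<theta>]
  have "\<bar>tsum \<rho> \<theta>\<bar> \<le> real n * wsum \<rho> \<theta>" by (rule tsum_le[OF assms])
  also have "\<dots> \<le> 3/4 * \<rho> * wsum \<rho> \<theta>" using assms w by (intro mult_right_mono) auto
  also have "\<dots> \<le> rsum \<rho> \<theta>" by (rule r)
  also have "\<dots> \<le> \<rho> * rsum \<rho> \<theta>" using r \<rho> by (simp add: mult_le_cancel_right1)
  finally show ?thesis using \<rho> r by (simp add: slope_def abs_mult divide_le_eq)
qed

text \<open>Quotient rule, with each weight sum traded for 4/3 \<open>rsum\<close> / \<rho>. The
  product term carries n twice, and one of these factors is spent as n \<le> \<rho> / 4. The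
  computation yields 176/27, rounded up to 10.\<close>

lemma slope_lipschitz:
  assumes "\<rho> \<ge> 4 * real n"
  shows "\<bar>slope \<rho> \<theta> - slope \<rho> \<theta>'\<bar> \<le> 10 * real n / \<rho>\<^sup>2 * \<bar>\<theta> - \<theta>'\<bar>"
proof -
  have \<rho>: "\<rho> > 0" "real n \<le> \<rho> / 4" using assms n_pos by auto
  define s' where "s' = (\<lambda>\<theta>. - (tsum' \<rho> \<theta> * rsum \<rho> \<theta> - tsum \<rho> \<theta> * rsum' \<rho> \<theta>) / (\<rho> * (rsum \<rho> \<theta>)\<^sup>2))"
  have der: "(slope \<rho> has_field_derivative s' \<theta>) (at \<theta> within UNIV)" for \<theta>
  proof -
    have "rsum \<rho> \<theta> \<noteq> 0" using rsum_pos[OF assms, of \<theta>] by simp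
    then show ?thesis
      unfolding slope_def[abs_def] s'_def using \<rho>
      by (auto intro!: derivative_eq_intros tsum_deriv[OF assms] rsum_deriv[OF assms]
          simp: power2_eq_square field_simps)
  qed
  have bound: "norm (s' \<theta>) \<le> 10 * real n / \<rho>\<^sup>2" for \<theta>
  proof -
    define W N Q where "W = wsum \<rho> \<theta>" "N = real n" "Q = rsum \<rho> \<theta>"
    note d = this
    have W: "W > 0" "3/4 * \<rho> * W \<le> Q" "Q > 0"
      using wsum_pos[OF assms, of \<theta>] rsum_ge[OF assms, of \<theta>] rsum_pos[OF assms, of \<theta>] by (auto simp: d)
    have W': "W \<le> 4/3 * Q / \<rho>" using W \<rho> by (simp add: field_simps)
    have N: "0 \<le> N" "N \<le> \<rho> / 4" using \<rho> by (auto simp: d)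
    have "\<bar>tsum' \<rho> \<theta> * Q\<bar> \<le> 7/3 * N * (4/3 * Q / \<rho>) * Q"
      unfolding abs_mult using tsum'_le[OF assms, of \<theta>] W W' N
      by (intro mult_mono order_trans[OF tsum'_le[OF assms]] mult_left_mono) (auto simp: d)
    moreover have "\<bar>tsum \<rho> \<theta> * rsum' \<rho> \<theta>\<bar> \<le> (N * (4/3 * Q / \<rho>)) * (23/3 * N * (4/3 * Q / \<rho>))"
      unfolding abs_mult using W W' N
      by (intro mult_mono order_trans[OF tsum_le[OF assms]] order_trans[OF rsum'_le[OF assms]] mult_left_mono) (auto simp: d)
    moreover have "(N * (4/3 * Q / \<rho>)) * (23/3 * N * (4/3 * Q / \<rho>)) \<le> (N * (4/3 * Q / \<rho>)) * (23/3 * (\<rho> / 4) * (4/3 * Q / \<rho>))"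
      using W N \<rho> by (intro mult_left_mono mult_right_mono) auto
    ultimately have "\<bar>tsum' \<rho> \<theta> * Q - tsum \<rho> \<theta> * rsum' \<rho> \<theta>\<bar> \<le> 7/3 * N * (4/3 * Q / \<rho>) * Q + (N * (4/3 * Q / \<rho>)) * (23/3 * (\<rho> / 4) * (4/3 * Q / \<rho>))"
      by linarith
    also have "\<dots> = 176/27 * N * Q\<^sup>2 / \<rho>" using \<rho> by (simp add: power2_eq_square field_simps)
    also have "\<dots> \<le> 10 * N * Q\<^sup>2 / \<rho>" using N \<rho> by (intro divide_right_mono mult_right_mono) auto
    finally have "\<bar>tsum' \<rho> \<theta> * Q - tsum \<rho> \<theta> * rsum' \<rho> \<theta>\<bar> / (\<rho> * Q\<^sup>2) \<le> (10 * N * Q\<^sup>2 / \<rho>) / (\<rho> * Q\<^sup>2)"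
      using \<rho> by (intro divide_right_mono) auto
    also have "\<dots> = 10 * N / \<rho>\<^sup>2" using W \<rho> by (simp add: power2_eq_square field_simps)
    finally show ?thesis using \<rho> W by (simp add: s'_def d abs_mult abs_minus_commute)
  qed
  show ?thesis
    using field_differentiable_bound[OF convex_UNIV der bound, of \<theta> \<theta>'] by simp
qed

lemma slope_periodic: "slope \<rho> (\<theta> + 2 * pi) = slope \<rho> \<theta>"
  by (simp add: slope_def tsum_def rsum_def wt_def sqd_def rad_def tang_def)

lemma rsum_slope_continuous:
  assumes "continuous_on S f" "continuous_on S g" "\<And>s. s \<in> S \<Longrightarrow> f s \<ge> 4 * real n"
  shows "continuous_on S (\<lambda>s. rsum (f s) (g s))" and "continuous_on S (\<lambda>s. slope (f s) (g s))"
proof -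
  have cs: "continuous_on S (\<lambda>s. cos (g s))" "continuous_on S (\<lambda>s. sin (g s))"
    by (rule continuous_on_compose2[OF _ assms(2), of UNIV]; auto intro: continuous_intros)+
  have c: "continuous_on S (\<lambda>s. rad (g s) j)" "continuous_on S (\<lambda>s. tang (g s) j)"
    "continuous_on S (\<lambda>s. sqd (f s) (g s) j)" for j
    unfolding rad_def tang_def sqd_def by (intro continuous_intros assms cs)+
  have "continuous_on S (\<lambda>s. wt (f s) (g s) j)" if "j \<in> {1..n}" for j
  proof -
    have "sqd (f s) (g s) j \<noteq> 0" if "s \<in> S" for s
      using far_sqd[OF assms(3)[OF that] \<open>j \<in> {1..n}\<close>, of "g s"] far_pos[OF assms(3)[OF that] \<open>j \<in> {1..n}\<close>]
      by (metis less_le_trans mult_pos_pos less_irrefl zero_less_power zero_less_divide_iff zero_less_numeral)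
    then show ?thesis unfolding wt_def by (intro continuous_on_powr c continuous_intros) auto
  qed
  then have "continuous_on S (\<lambda>s. rsum (f s) (g s))" "continuous_on S (\<lambda>s. tsum (f s) (g s))"
    unfolding rsum_def tsum_def by (intro continuous_intros c assms; simp)+
  moreover have "f s * rsum (f s) (g s) \<noteq> 0" if "s \<in> S" for s
  proof -
    have "f s > 0" using assms(3)[OF that] n_pos by simp
    then show ?thesis using rsum_pos[OF assms(3)[OF that], of "g s"] by simp
  qed
  ultimately show "continuous_on S (\<lambda>s. rsum (f s) (g s))" "continuous_on S (\<lambda>s. slope (f s) (g s))"
    unfolding slope_def by (auto intro!: continuous_intros assms)
qed

text \<open>The flow line through polar angle \<open>\<theta>\<^sub>1\<close> at radius \<open>r\<^sub>1\<close> has angle \<open>\<theta>\<^sub>2\<close> at radius \<open>r\<^sub>2\<close>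
  (angles are lifted to the real line).\<close>

definition joins :: "real \<Rightarrow> real \<Rightarrow> real \<Rightarrow> real \<Rightarrow> bool" where
  "joins r1 r2 \<theta>1 \<theta>2 \<longleftrightarrow> (\<exists>u. continuous_on {r1..r2} u \<and> u r1 = \<theta>1 \<and> u r2 = \<theta>2 \<and>
     (\<forall>\<rho>\<in>{r1<..<r2}. (u has_vector_derivative slope \<rho> (u \<rho>)) (at \<rho>)))"

text \<open>Clamping the radius at 4 n turns the angular equation into one with globally bounded and
  Lipschitz right-hand side, as \<open>picard_global\<close> demands; the sign \<sigma> selects
  integration outward or inward.\<close>

lemma slope_clamp_bounds:
  "norm (\<sigma> * slope (max \<rho> (4 * real n)) \<theta> - \<sigma> * slope (max \<rho> (4 * real n)) \<theta>') \<le> \<bar>\<sigma>\<bar> * norm (\<theta> - \<theta>')"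
  "norm (\<sigma> * slope (max \<rho> (4 * real n)) \<theta>) \<le> \<bar>\<sigma>\<bar>"
proof -
  let ?m = "max \<rho> (4 * real n)"
  have m: "?m \<ge> 4 * real n" by simp
  have n: "real n \<ge> 1" using n_pos by simp
  have "10 * real n \<le> (4 * real n) * (4 * real n)" using n by (simp add: mult_le_cancel_left1)
  also have "\<dots> \<le> ?m\<^sup>2" unfolding power2_eq_square using n by (intro mult_mono m) auto
  finally have "10 * real n / ?m\<^sup>2 \<le> 1" using n by (simp add: divide_le_eq_1)
  then have "10 * real n / ?m\<^sup>2 * \<bar>\<theta> - \<theta>'\<bar> \<le> 1 * \<bar>\<theta> - \<theta>'\<bar>" by (intro mult_right_mono) auto
  then have "\<bar>slope ?m \<theta> - slope ?m \<theta>'\<bar> \<le> \<bar>\<theta> - \<theta>'\<bar>" using slope_lipschitz[OF m, of \<theta> \<theta>'] by linarith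
  then show "norm (\<sigma> * slope ?m \<theta> - \<sigma> * slope ?m \<theta>') \<le> \<bar>\<sigma>\<bar> * norm (\<theta> - \<theta>')"
    by (simp add: mult_left_mono abs_mult flip: right_diff_distrib)
  show "norm (\<sigma> * slope ?m \<theta>) \<le> \<bar>\<sigma>\<bar>"
    using slope_abs_le[OF m, of \<theta>] by (simp add: abs_mult mult_left_le)
qed

lemma slope_ode:
  obtains u where "u 0 = \<theta>" "continuous_on UNIV u"
    "\<And>t. t > 0 \<Longrightarrow> (u has_vector_derivative \<sigma> * slope (max (r + \<sigma> * t) (4 * real n)) (u t)) (at t)"
proof -
  obtain u where u: "u 0 = \<theta>" "continuous_on UNIV u"
    "\<And>t. t \<ge> 0 \<Longrightarrow> (u has_vector_derivative \<sigma> * slope (max (r + \<sigma> * t) (4 * real n)) (u t)) (at t within {0..})"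
  proof (rule picard_global[of "\<lambda>t \<theta>. \<sigma> * slope (max (r + \<sigma> * t) (4 * real n)) \<theta>" "\<bar>\<sigma>\<bar>" "\<bar>\<sigma>\<bar>" \<theta>])
    show "continuous_on UNIV (\<lambda>t. \<sigma> * slope (max (r + \<sigma> * t) (4 * real n)) (u t))"
      if "continuous_on UNIV u" for u
      by (intro continuous_intros rsum_slope_continuous(2) that) auto
  qed (use slope_clamp_bounds in auto)
  have "(u has_vector_derivative \<sigma> * slope (max (r + \<sigma> * t) (4 * real n)) (u t)) (at t)" if "t > 0" for t
  proof -
    have "at t within {0..} = at t" by (rule at_within_interior) (use that in auto)
    then show ?thesis using u(3)[of t] that by simp
  qed
  then show thesis using that u(1,2) by blast
qed

lemma joins_forward:
  assumes "4 * real n \<le> r1" "r1 \<le> r2"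
  obtains \<theta>2 where "joins r1 r2 \<theta>1 \<theta>2"
proof -
  obtain u where u: "u 0 = \<theta>1" "continuous_on UNIV u"
    "\<And>t. t > 0 \<Longrightarrow> (u has_vector_derivative 1 * slope (max (r1 + 1 * t) (4 * real n)) (u t)) (at t)"
    using slope_ode by blast
  have "joins r1 r2 \<theta>1 (u (r2 - r1))"
    unfolding joins_def
  proof (intro exI[of _ "\<lambda>\<rho>. u (\<rho> - r1)"] conjI ballI)
    show "continuous_on {r1..r2} (\<lambda>\<rho>. u (\<rho> - r1))"
      by (rule continuous_on_compose2[OF u(2)]) (auto intro: continuous_intros)
    fix \<rho> assume \<rho>: "\<rho> \<in> {r1<..<r2}"
    have "((\<lambda>\<rho>. \<rho> - r1) has_vector_derivative 1) (at \<rho>)" by (auto intro!: derivative_eq_intros)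
    from vector_diff_chain_at[OF this u(3)[of "\<rho> - r1"]] \<rho> assms
    show "((\<lambda>\<rho>. u (\<rho> - r1)) has_vector_derivative slope \<rho> (u (\<rho> - r1))) (at \<rho>)"
      by (simp add: o_def max_def split: if_splits)
  qed (use u(1) in auto)
  then show thesis by (rule that)
qed

lemma joins_backward:
  assumes "4 * real n \<le> r1" "r1 \<le> r2"
  obtains \<theta>1 where "joins r1 r2 \<theta>1 \<theta>2"
proof -
  obtain u where u: "u 0 = \<theta>2" "continuous_on UNIV u"
    "\<And>t. t > 0 \<Longrightarrow> (u has_vector_derivative (- 1) * slope (max (r2 + (- 1) * t) (4 * real n)) (u t)) (at t)"
    using slope_ode by blast
  have "joins r1 r2 (u (r2 - r1)) \<theta>2"
    unfolding joins_def
  proof (intro exI[of _ "\<lambda>\<rho>. u (r2 - \<rho>)"] conjI ballI)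
    show "continuous_on {r1..r2} (\<lambda>\<rho>. u (r2 - \<rho>))"
      by (rule continuous_on_compose2[OF u(2)]) (auto intro: continuous_intros)
    fix \<rho> assume \<rho>: "\<rho> \<in> {r1<..<r2}"
    have "((\<lambda>\<rho>. r2 - \<rho>) has_vector_derivative - 1) (at \<rho>)" by (auto intro!: derivative_eq_intros)
    from vector_diff_chain_at[OF this u(3)[of "r2 - \<rho>"]] \<rho> assms
    show "((\<lambda>\<rho>. u (r2 - \<rho>)) has_vector_derivative slope \<rho> (u (r2 - \<rho>))) (at \<rho>)"
      by (simp add: o_def max_def split: if_splits)
  qed (use u(1) in auto)
  then show thesis by (rule that)
qed

text \<open>\<open>gronwall_two_sided\<close> with - 10 n / \<rho>, a primitive of the Lipschitz
  constant 10 n / \<rho>^2. The exponent stays bounded as \<open>r2\<close> grows.\<close>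

lemma slope_solutions_dist:
  fixes u v :: "real \<Rightarrow> real"
  assumes "4 * real n \<le> r1" "r1 \<le> r2" "continuous_on {r1..r2} u" "continuous_on {r1..r2} v"
    and "\<And>\<rho>. \<rho> \<in> {r1<..<r2} \<Longrightarrow> (u has_vector_derivative slope \<rho> (u \<rho>)) (at \<rho>)"
    and "\<And>\<rho>. \<rho> \<in> {r1<..<r2} \<Longrightarrow> (v has_vector_derivative slope \<rho> (v \<rho>)) (at \<rho>)"
  shows "\<bar>u r2 - v r2\<bar> \<le> exp (10 * real n / r1 - 10 * real n / r2) * \<bar>u r1 - v r1\<bar>"
    and "\<bar>u r1 - v r1\<bar> \<le> exp (10 * real n / r1 - 10 * real n / r2) * \<bar>u r2 - v r2\<bar>"
proof -
  have r1: "r1 > 0" using assms n_pos by simp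
  have *: "continuous_on {r1..r2} (\<lambda>\<rho>. u \<rho> - v \<rho>)" "continuous_on {r1..r2} (\<lambda>\<rho>. - (10 * real n / \<rho>))"
    "\<And>t. \<lbrakk>r1 < t; t < r2\<rbrakk> \<Longrightarrow> ((\<lambda>\<rho>. u \<rho> - v \<rho>) has_vector_derivative slope t (u t) - slope t (v t)) (at t)"
    "\<And>t. \<lbrakk>r1 < t; t < r2\<rbrakk> \<Longrightarrow> ((\<lambda>\<rho>. - (10 * real n / \<rho>)) has_real_derivative 10 * real n / t\<^sup>2) (at t)"
    using assms r1
    by (auto intro!: continuous_intros derivative_eq_intros has_vector_derivative_diff
        simp: power2_eq_square)
  have **: "norm (slope t (u t) - slope t (v t)) \<le> 10 * real n / t\<^sup>2 * norm (u t - v t)"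
    if "r1 < t" "t < r2" for t
    using slope_lipschitz[of t "u t" "v t"] assms(1) that by simp
  show "\<bar>u r2 - v r2\<bar> \<le> exp (10 * real n / r1 - 10 * real n / r2) * \<bar>u r1 - v r1\<bar>"
    "\<bar>u r1 - v r1\<bar> \<le> exp (10 * real n / r1 - 10 * real n / r2) * \<bar>u r2 - v r2\<bar>"
    using gronwall_two_sided[OF assms(2) * **] by simp_all
qed

lemma joins_dist:
  assumes "4 * real n \<le> r1" "r1 \<le> r2" "joins r1 r2 \<theta>1 \<theta>2" "joins r1 r2 \<theta>1' \<theta>2'"
  shows "\<bar>\<theta>2 - \<theta>2'\<bar> \<le> exp (10 * real n / r1 - 10 * real n / r2) * \<bar>\<theta>1 - \<theta>1'\<bar>"
    and "\<bar>\<theta>1 - \<theta>1'\<bar> \<le> exp (10 * real n / r1 - 10 * real n / r2) * \<bar>\<theta>2 - \<theta>2'\<bar>"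
proof -
  obtain u where u: "continuous_on {r1..r2} u" "u r1 = \<theta>1" "u r2 = \<theta>2"
    "\<And>\<rho>. \<rho> \<in> {r1<..<r2} \<Longrightarrow> (u has_vector_derivative slope \<rho> (u \<rho>)) (at \<rho>)"
    using assms(3) unfolding joins_def by blast
  obtain v where v: "continuous_on {r1..r2} v" "v r1 = \<theta>1'" "v r2 = \<theta>2'"
    "\<And>\<rho>. \<rho> \<in> {r1<..<r2} \<Longrightarrow> (v has_vector_derivative slope \<rho> (v \<rho>)) (at \<rho>)"
    using assms(4) unfolding joins_def by blast
  show "\<bar>\<theta>2 - \<theta>2'\<bar> \<le> exp (10 * real n / r1 - 10 * real n / r2) * \<bar>\<theta>1 - \<theta>1'\<bar>"
    "\<bar>\<theta>1 - \<theta>1'\<bar> \<le> exp (10 * real n / r1 - 10 * real n / r2) * \<bar>\<theta>2 - \<theta>2'\<bar>"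
    using slope_solutions_dist[OF assms(1,2) u(1) v(1) u(4) v(4)] u(2,3) v(2,3) by auto
qed

text \<open>Two solutions that exchange their order meet at some radius, and backward uniqueness
  from there makes them start at the same angle.\<close>

lemma joins_less_iff:
  assumes "4 * real n \<le> r1" "r1 \<le> r2" "joins r1 r2 \<theta>1 \<theta>2" "joins r1 r2 \<theta>1' \<theta>2'"
  shows "\<theta>1 < \<theta>1' \<longleftrightarrow> \<theta>2 < \<theta>2'"
proof -
  have less: "\<theta>2 < \<theta>2'" if j: "joins r1 r2 \<theta>1 \<theta>2" "joins r1 r2 \<theta>1' \<theta>2'" "\<theta>1 < \<theta>1'" for \<theta>1 \<theta>2 \<theta>1' \<theta>2'
  proof (rule ccontr)
    assume "\<not> \<theta>2 < \<theta>2'"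
    obtain u where u: "continuous_on {r1..r2} u" "u r1 = \<theta>1" "u r2 = \<theta>2"
      "\<And>\<rho>. \<rho> \<in> {r1<..<r2} \<Longrightarrow> (u has_vector_derivative slope \<rho> (u \<rho>)) (at \<rho>)"
      using j(1) unfolding joins_def by blast
    obtain v where v: "continuous_on {r1..r2} v" "v r1 = \<theta>1'" "v r2 = \<theta>2'"
      "\<And>\<rho>. \<rho> \<in> {r1<..<r2} \<Longrightarrow> (v has_vector_derivative slope \<rho> (v \<rho>)) (at \<rho>)"
      using j(2) unfolding joins_def by blast
    have "continuous_on {r1..r2} (\<lambda>\<rho>. u \<rho> - v \<rho>)" by (intro continuous_intros u v)
    then obtain \<rho> where \<rho>: "r1 \<le> \<rho>" "\<rho> \<le> r2" "u \<rho> - v \<rho> = 0"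
      using IVT'[of "\<lambda>\<rho>. u \<rho> - v \<rho>" r1 0 r2] assms(2) u v j(3) \<open>\<not> \<theta>2 < \<theta>2'\<close> by auto
    have "continuous_on {r1..\<rho>} u" "continuous_on {r1..\<rho>} v"
      using \<rho> by (auto intro: continuous_on_subset[OF u(1)] continuous_on_subset[OF v(1)])
    from slope_solutions_dist(2)[OF assms(1) \<rho>(1) this] u v \<rho> have "u r1 = v r1" by simp
    then show False using u v j(3) by simp
  qed
  have "\<theta>1 = \<theta>1' \<Longrightarrow> \<theta>2 = \<theta>2'" using joins_dist(1)[OF assms] by simp
  then show ?thesis using less[OF assms(3,4)] less[OF assms(4,3)] by force
qed

lemma joins_shift: "joins r1 r2 \<theta>1 \<theta>2 \<Longrightarrow> joins r1 r2 (\<theta>1 + 2 * pi) (\<theta>2 + 2 * pi)"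
proof -
  assume "joins r1 r2 \<theta>1 \<theta>2"
  then obtain u where u: "continuous_on {r1..r2} u" "u r1 = \<theta>1" "u r2 = \<theta>2"
    "\<And>\<rho>. \<rho> \<in> {r1<..<r2} \<Longrightarrow> (u has_vector_derivative slope \<rho> (u \<rho>)) (at \<rho>)"
    unfolding joins_def by blast
  have "((\<lambda>\<rho>. u \<rho> + 2 * pi) has_vector_derivative slope \<rho> (u \<rho> + 2 * pi)) (at \<rho>)" if "\<rho> \<in> {r1<..<r2}" for \<rho>
    using has_vector_derivative_add[OF u(4)[OF that] has_vector_derivative_const[of "2 * pi"]]
    by (simp add: slope_periodic)
  then show "joins r1 r2 (\<theta>1 + 2 * pi) (\<theta>2 + 2 * pi)"
    unfolding joins_def using u by (intro exI[of _ "\<lambda>\<rho>. u \<rho> + 2 * pi"]) (auto intro!: continuous_intros)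
qed

lemma far_outside:
  assumes "norm y \<ge> 4 * real n"
  shows "y \<in> outside"
  unfolding outside_def
proof safe
  fix j assume j: "j \<in> {1..n}"
  have "norm y \<le> dist y (x j) + norm (x j)"
    using norm_triangle_ineq[of "y - x j" "x j"] by (simp add: dist_norm)
  then show "1 < dist y (x j)" using x_norm[OF j] assms n_pos by linarith
qed

text \<open>A solution of the angular equation traces a true trajectory: reparametrised by radius,
  the flow from the outer point and the polar curve satisfy the same equation and agree at
  \<open>r2\<close>.\<close>

lemma joins_hits:
  assumes "4 * real n \<le> r1" "r1 \<le> r2" "joins r1 r2 \<theta>1 \<theta>2" "i \<in> {1..n}"
  shows "circle_point r1 \<theta>1 \<in> hits i \<longleftrightarrow> circle_point r2 \<theta>2 \<in> hits i"
proof -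
  obtain u where u: "continuous_on {r1..r2} u" "u r1 = \<theta>1" "u r2 = \<theta>2"
    "\<And>\<rho>. \<rho> \<in> {r1<..<r2} \<Longrightarrow> (u has_vector_derivative slope \<rho> (u \<rho>)) (at \<rho>)"
    using assms(3) unfolding joins_def by blast
  \<comment> \<open>The reciprocal of the inward speed, that is, the time spent per unit of radius;
    \<open>T \<rho>\<close> below is the travel time from radius \<open>r2\<close> to
    \<rho>.\<close>
  define q where "q = (\<lambda>\<rho>. 1 / (coef \<alpha> * rsum \<rho> (u \<rho>)))"
  have rp: "rsum \<rho> (u \<rho>) > 0" if "\<rho> \<in> {r1..r2}" for \<rho> using rsum_pos that assms(1) by auto
  have qp: "q \<rho> > 0" if "\<rho> \<in> {r1..r2}" for \<rho> using rp[OF that] coef_pos by (simp add: q_def)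
  have qc: "continuous_on {r1..r2} q"
  proof -
    have "continuous_on {r1..r2} (\<lambda>\<rho>. rsum \<rho> (u \<rho>))"
      by (rule rsum_slope_continuous(1)) (use u(1) assms(1) in \<open>auto intro: continuous_intros\<close>)
    moreover have "coef \<alpha> * rsum \<rho> (u \<rho>) \<noteq> 0" if "\<rho> \<in> {r1..r2}" for \<rho>
      using rp[OF that] coef_pos by simp
    ultimately show ?thesis unfolding q_def by (intro continuous_intros) auto
  qed
  define I where "I = (\<lambda>\<rho>. integral {r1..\<rho>} q)"
  have I: "(I has_vector_derivative q \<rho>) (at \<rho> within {r1..r2})" if "\<rho> \<in> {r1..r2}" for \<rho>
    unfolding I_def by (rule integral_has_vector_derivative[OF qc that])
  define T where "T = (\<lambda>\<rho>. I r2 - I \<rho>)"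
  have Tder: "(T has_vector_derivative - q \<rho>) (at \<rho> within {r1..r2})" if "\<rho> \<in> {r1..r2}" for \<rho>
    unfolding T_def using has_vector_derivative_diff[OF has_vector_derivative_const I[OF that]] by simp
  have Tc: "continuous_on {r1..r2} T"
    unfolding continuous_on_eq_continuous_within using has_vector_derivative_continuous[OF Tder] by blast
  have qi: "q integrable_on {a..b}" if "r1 \<le> a" "b \<le> r2" for a b
    using that by (intro integrable_continuous_real continuous_on_subset[OF qc]) auto
  have T0: "T \<rho> \<ge> 0" if \<rho>: "\<rho> \<in> {r1..r2}" for \<rho>
  proof -
    have "I \<rho> + integral {\<rho>..r2} q = I r2"
      unfolding I_def using \<rho> by (intro Henstock_Kurzweil_Integration.integral_combine qi) auto
    moreover have "integral {\<rho>..r2} q \<ge> 0"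
      using \<rho> qp by (intro integral_nonneg qi) (auto intro: less_imp_le)
    ultimately show ?thesis by (simp add: T_def)
  qed
  have at: "at \<rho> within {r1<..<r2} = at \<rho>" "at \<rho> within {r1..r2} = at \<rho>" if "\<rho> \<in> {r1<..<r2}" for \<rho>
    using that by (auto intro!: at_within_open at_within_interior)
  define y2 where "y2 = circle_point r2 \<theta>2"
  define X where "X = (\<lambda>\<rho>. flow (T \<rho>) y2)"
  define Y where "Y = (\<lambda>\<rho>. circle_point \<rho> (u \<rho>))"
  have Xder: "(X has_vector_derivative - q \<rho> *\<^sub>R F (X \<rho>)) (at \<rho>)" if \<rho>: "\<rho> \<in> {r1<..<r2}" for \<rho>
  proof -
    have T1: "(T has_vector_derivative - q \<rho>) (at \<rho> within {r1<..<r2})"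
      by (rule has_vector_derivative_within_subset[OF Tder]) (use \<rho> in auto)
    have "((\<lambda>t. flow t y2) has_vector_derivative F (flow (T \<rho>) y2)) (at (T \<rho>) within T ` {r1<..<r2})"
      by (rule has_vector_derivative_within_subset[OF flow_props(3)]) (use T0 \<rho> in auto)
    from vector_diff_chain_within[OF T1 this] show ?thesis
      using at(1)[OF \<rho>] by (simp add: X_def o_def)
  qed
  have Yder: "(Y has_vector_derivative - q \<rho> *\<^sub>R F (Y \<rho>)) (at \<rho>)" if \<rho>: "\<rho> \<in> {r1<..<r2}" for \<rho>
  proof -
    have R: "\<rho> \<ge> 4 * real n" "\<rho> \<noteq> 0" using \<rho> assms n_pos by auto
    have ud: "(u has_real_derivative slope \<rho> (u \<rho>)) (at \<rho>)"
      using u(4)[OF \<rho>] by (simp add: has_real_derivative_iff_has_vector_derivative)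
    have "((\<lambda>\<rho>. \<rho> * cos (u \<rho>)) has_real_derivative (cos (u \<rho>) - \<rho> * slope \<rho> (u \<rho>) * sin (u \<rho>))) (at \<rho>)"
      "((\<lambda>\<rho>. \<rho> * sin (u \<rho>)) has_real_derivative (sin (u \<rho>) + \<rho> * slope \<rho> (u \<rho>) * cos (u \<rho>))) (at \<rho>)"
      by (auto intro!: derivative_eq_intros ud)
    then have "(Y has_vector_derivative (cos (u \<rho>) - \<rho> * slope \<rho> (u \<rho>) * sin (u \<rho>)) *\<^sub>R axis 1 1
        + (sin (u \<rho>) + \<rho> * slope \<rho> (u \<rho>) * cos (u \<rho>)) *\<^sub>R axis 2 1) (at \<rho>)"
      unfolding Y_def circle_point_def vector2_eq_axis
      by (intro has_vector_derivative_add)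
        (auto intro!: has_vector_derivative_scaleR[THEN has_vector_derivative_eq_rhs] has_vector_derivative_const)
    moreover have "- q \<rho> *\<^sub>R F (Y \<rho>) = (cos (u \<rho>) - \<rho> * slope \<rho> (u \<rho>) * sin (u \<rho>)) *\<^sub>R axis 1 1
        + (sin (u \<rho>) + \<rho> * slope \<rho> (u \<rho>) * cos (u \<rho>)) *\<^sub>R axis 2 1"
    proof -
      define Q N where "Q = rsum \<rho> (u \<rho>)" "N = tsum \<rho> (u \<rho>)"
      note QN = this
      have Q: "Q > 0" using rp \<rho> by (simp add: QN)
      have s: "\<rho> * slope \<rho> (u \<rho>) = - N / Q" using R by (simp add: slope_def QN)
      have "- q \<rho> *\<^sub>R F (Y \<rho>) = (- 1 / Q) *\<^sub>R (N *\<^sub>R vector [- sin (u \<rho>), cos (u \<rho>)] - Q *\<^sub>R circle_point 1 (u \<rho>))"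
        unfolding Y_def F_circle_point[OF R(1)] q_def using coef_pos by (simp add: QN)
      then show ?thesis
        unfolding s using Q by (simp add: vec_eq_iff forall_2 axis_def field_simps)
    qed
    ultimately show ?thesis by simp
  qed
  have Xc: "continuous_on {r1..r2} X"
    unfolding X_def by (rule continuous_on_compose2[OF flow_props(2) Tc]) auto
  have Yc: "continuous_on {r1..r2} Y"
    unfolding Y_def by (intro continuous_intros u(1))
  \<comment> \<open>A bound on \<open>q\<close> makes the equation in the radius Lipschitz with
    constant M times that of \<open>F\<close>.\<close>
  obtain M where M: "\<And>\<rho>. \<rho> \<in> {r1..r2} \<Longrightarrow> q \<rho> \<le> M"
    using continuous_attains_sup[of "{r1..r2}" q] qc assms(2) by fastforce
  let ?L = "coef \<alpha> * (real n * 32)"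
  have XY: "X \<rho> = Y \<rho>" if \<rho>: "\<rho> \<in> {r1..r2}" for \<rho>
  proof -
    have "norm (X \<rho> - Y \<rho>) \<le> exp (M * ?L * (r2 - \<rho>)) * norm (X r2 - Y r2)"
    proof (rule ode_solutions_dist(2))
      fix t assume t: "\<rho> < t" "t < r2"
      then have t': "t \<in> {r1<..<r2}" using \<rho> by auto
      show "(X has_vector_derivative - q t *\<^sub>R F (X t)) (at t)" by (rule Xder[OF t'])
      show "(Y has_vector_derivative - q t *\<^sub>R F (Y t)) (at t)" by (rule Yder[OF t'])
      have qt: "0 < q t" "q t \<le> M" using qp[of t] M[of t] t' by auto
      have "norm (- q t *\<^sub>R F (X t) - - q t *\<^sub>R F (Y t)) = q t * norm (F (X t) - F (Y t))"
        using qt by (simp add: norm_minus_commute flip: scaleR_diff_right)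
      also have "\<dots> \<le> M * (?L * norm (X t - Y t))" using qt by (intro mult_mono lip) auto
      finally show "norm (- q t *\<^sub>R F (X t) - - q t *\<^sub>R F (Y t)) \<le> M * ?L * norm (X t - Y t)"
        by (simp add: mult.assoc)
    qed (use \<rho> in \<open>auto intro: continuous_on_subset[OF Xc] continuous_on_subset[OF Yc]\<close>)
    moreover have "X r2 = Y r2" by (simp add: X_def Y_def T_def y2_def u(3))
    ultimately show ?thesis by simp
  qed
  \<comment> \<open>By the intermediate value theorem every time up to \<open>T r1\<close> is the
    travel time to some radius at least \<open>r1\<close>, so the trajectory has not come near the
    cluster.\<close>
  have "flow t y2 \<in> outside" if t: "t \<in> {0..T r1}" for t
  proof -
    have "T r2 = 0" by (simp add: T_def)
    then obtain \<rho> where \<rho>: "r1 \<le> \<rho>" "\<rho> \<le> r2" "T \<rho> = t"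
      using IVT2'[of T r2 t r1] t assms(2) Tc by auto
    then have "flow t y2 = circle_point \<rho> (u \<rho>)" using XY[of \<rho>] by (simp add: X_def Y_def)
    then show ?thesis using \<rho> assms(1) by (intro far_outside) (simp add: norm_circle_point)
  qed
  then have "flow (T r1) y2 \<in> hits i \<longleftrightarrow> y2 \<in> hits i"
    using assms(2,4) T0 by (intro hits_flow) auto
  moreover have "flow (T r1) y2 = circle_point r1 \<theta>1"
    using XY[of r1] assms(2) u(2) by (simp add: X_def Y_def)
  ultimately show ?thesis by (simp add: y2_def)
qed

end

section \<open>Hitting probabilities as arc lengths\<close>

text \<open>A window of length 2 pi contains a multiple \<open>b\<close> of 2 pi; cut there and
  shift both pieces by multiples of 2 pi into the standard period.\<close>

lemma periodic_measure:
  fixes A :: "real set"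
  assumes A: "A \<in> sets borel" and per: "\<And>\<theta>. \<theta> + 2 * pi \<in> A \<longleftrightarrow> \<theta> \<in> A"
  shows "measure lborel (A \<inter> {a..<a + 2*pi}) = measure lborel (A \<inter> {0..<2*pi})"
proof -
  have perk: "\<theta> + of_int k * (2 * pi) \<in> A \<longleftrightarrow> \<theta> \<in> A" for k :: int and \<theta>
  proof (induction k arbitrary: \<theta> rule: int_induct[of _ 0])
    case (step1 i)
    then show ?case using per[of "\<theta> + of_int i * (2 * pi)"] by (simp add: algebra_simps)
  next
    case (step2 i)
    then show ?case using per[of "\<theta> + of_int (i - 1) * (2 * pi)"] by (simp add: algebra_simps)
  qed simp
  define m where "m = \<lceil>a / (2 * pi)\<rceil>"
  define b where "b = of_int m * (2 * pi)"
  have "a / (2 * pi) \<le> of_int m" "of_int m < a / (2 * pi) + 1" unfolding m_def by linarith+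
  then have b: "a \<le> b" "b < a + 2 * pi" by (auto simp: b_def field_simps)
  have shift: "measure lborel (A \<inter> {p..<q}) = measure lborel (A \<inter> {p + of_int k * (2 * pi)..<q + of_int k * (2 * pi)})"
    for p q and k :: int
  proof -
    have "(+) (of_int k * (2 * pi)) ` (A \<inter> {p..<q}) = A \<inter> {p + of_int k * (2 * pi)..<q + of_int k * (2 * pi)}"
    proof safe
      fix \<theta> assume "\<theta> \<in> A" "\<theta> \<in> {p + of_int k * (2 * pi)..<q + of_int k * (2 * pi)}"
      then show "\<theta> \<in> (+) (of_int k * (2 * pi)) ` (A \<inter> {p..<q})"
        using perk[of "\<theta> - of_int k * (2 * pi)" k] by (intro image_eqI[of _ _ "\<theta> - of_int k * (2 * pi)"]) auto
    qed (use perk in \<open>auto simp: add.commute\<close>)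
    then have "measure lebesgue (A \<inter> {p + of_int k * (2 * pi)..<q + of_int k * (2 * pi)}) = measure lebesgue (A \<inter> {p..<q})"
      using measure_translation by metis
    then show ?thesis using A by simp
  qed
  have split: "measure lborel (A \<inter> {p..<q}) = measure lborel (A \<inter> {p..<r}) + measure lborel (A \<inter> {r..<q})"
    if "p \<le> r" "r \<le> q" for p q r
  proof -
    have fin: "emeasure lborel (A \<inter> {c..<d}) \<noteq> \<infinity>" for c d
      using emeasure_bounded_finite[of "A \<inter> {c..<d}"] bounded_subset[of "{c..<d}" "A \<inter> {c..<d}"] by auto
    have "A \<inter> {p..<q} = (A \<inter> {p..<r}) \<union> (A \<inter> {r..<q})" using that by auto
    then show ?thesis using A fin by (auto intro!: measure_Union)
  qed
  have "measure lborel (A \<inter> {a..<b}) = measure lborel (A \<inter> {a + of_int (1 - m) * (2 * pi)..<b + of_int (1 - m) * (2 * pi)})"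
    by (rule shift)
  also have "a + of_int (1 - m) * (2 * pi) = a + 2 * pi - b" by (simp add: b_def algebra_simps)
  also have "b + of_int (1 - m) * (2 * pi) = 2 * pi" by (simp add: b_def algebra_simps)
  finally have 1: "measure lborel (A \<inter> {a..<b}) = measure lborel (A \<inter> {a + 2 * pi - b..<2 * pi})" .
  have "measure lborel (A \<inter> {b..<a + 2 * pi}) = measure lborel (A \<inter> {b + of_int (- m) * (2 * pi)..<a + 2 * pi + of_int (- m) * (2 * pi)})"
    by (rule shift)
  then have 2: "measure lborel (A \<inter> {b..<a + 2 * pi}) = measure lborel (A \<inter> {0..<a + 2 * pi - b})"
    by (simp add: b_def)
  show ?thesis
    using split[of a b "a + 2 * pi"] split[of 0 "a + 2 * pi - b" "2 * pi"] b 1 2 by simp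
qed

text \<open>Here \<open>h\<close> is a lift of a circle homeomorphism. The period that it maps onto
  \<open>{0..<2*pi}\<close> starts at the preimage of 0, so \<open>A\<close> is first measured on
  that shifted period.\<close>

lemma circle_lipschitz_measure_le:
  fixes h :: "real \<Rightarrow> real"
  assumes lip: "\<And>x y. \<bar>h x - h y\<bar> \<le> K * \<bar>x - y\<bar>" and mono: "\<And>x y. x < y \<Longrightarrow> h x < h y"
    and surj: "\<And>y. \<exists>x. h x = y" and h2pi: "\<And>\<theta>. h (\<theta> + 2 * pi) = h \<theta> + 2 * pi"
    and A: "A \<in> sets borel" "\<And>\<theta>. \<theta> + 2 * pi \<in> A \<longleftrightarrow> \<theta> \<in> A"
    and B: "B \<in> sets borel" "\<And>\<theta>. h \<theta> \<in> B \<Longrightarrow> \<theta> \<in> A"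
  shows "measure lborel (B \<inter> {0..<2*pi}) \<le> K * measure lborel (A \<inter> {0..<2*pi})"
proof -
  obtain a where a: "h a = 0" using surj by blast
  have "measure lebesgue (B \<inter> {0..<2*pi}) \<le> K * measure lebesgue (A \<inter> {a..<a + 2*pi})"
  proof (rule lipschitz_image_measure_le[OF lip])
    show "A \<inter> {a..<a + 2*pi} \<in> lmeasurable"
      using A(1) by (intro bounded_set_imp_lmeasurable bounded_subset[OF bounded_cbox[of a "a + 2*pi"]]) auto
    show "A \<inter> {a..<a + 2*pi} \<subseteq> {a..a + 2*pi}" by auto
    show "B \<inter> {0..<2*pi} \<in> sets lebesgue" using B(1) by auto
    show "B \<inter> {0..<2*pi} \<subseteq> h ` (A \<inter> {a..<a + 2*pi})"
    proof safe
      fix y assume y: "y \<in> B" "y \<in> {0..<2*pi}"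
      obtain \<theta> where \<theta>: "h \<theta> = y" using surj by blast
      have "\<not> \<theta> < a" using mono[of \<theta> a] a y \<theta> by auto
      moreover have "\<not> a + 2*pi < \<theta>" "\<theta> \<noteq> a + 2*pi" using mono[of "a + 2*pi" \<theta>] h2pi[of a] a y \<theta> by auto
      ultimately show "y \<in> h ` (A \<inter> {a..<a + 2*pi})" using B(2)[of \<theta>] y \<theta> by (intro image_eqI[of _ _ \<theta>]) auto
    qed
  qed
  then show ?thesis using A B(1) periodic_measure[OF A] by simp
qed

context cluster_flow
begin

text \<open>Kept as a periodic subset of the whole line, on which the lifted angle maps act.\<close>

definition angles :: "nat \<Rightarrow> real \<Rightarrow> real set" where
  "angles i r = {\<theta>. circle_point r \<theta> \<in> hits i}"

definition arc :: "nat \<Rightarrow> real \<Rightarrow> real" where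
  "arc i r = measure lborel (angles i r \<inter> {0..<2*pi})"

lemma angles_borel:
  assumes "4 * real n \<le> r" "i \<in> {1..n}"
  shows "angles i r \<in> sets borel"
proof -
  have "continuous_on UNIV (circle_point r)" by (intro continuous_intros)
  then have "circle_point r \<in> borel_measurable borel" by (rule borel_measurable_continuous_onI)
  from measurable_sets[OF this hits_borel[OF assms(2)]]
  have "circle_point r -` (hits i \<inter> outside) \<in> sets borel" by simp
  moreover have "circle_point r -` (hits i \<inter> outside) = angles i r"
    using far_outside assms(1) by (auto simp: angles_def norm_circle_point)
  ultimately show ?thesis by simp
qed

lemma angles_periodic: "\<theta> + 2 * pi \<in> angles i r \<longleftrightarrow> \<theta> \<in> angles i r"
  by (simp add: angles_def circle_point_def)

lemma arc_nonneg: "arc i r \<ge> 0" by (simp add: arc_def)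

lemma arc_le: "arc i r \<le> 2 * pi"
proof -
  have "arc i r \<le> measure lborel {0..<2*pi}"
  proof (cases "angles i r \<inter> {0..<2*pi} \<in> sets lborel")
    case True
    then show ?thesis unfolding arc_def by (intro measure_mono_fmeasurable) (auto simp: fmeasurable_def)
  next
    case False
    then show ?thesis by (simp add: arc_def measure_notin_sets)
  qed
  then show ?thesis by simp
qed

text \<open>Transport along flow lines inward (\<open>h\<close>) and outward (\<open>k\<close>) are
  mutually inverse lifts with the same Lipschitz constant; both preserve the particle hit, so each
  yields one inequality.\<close>

lemma arc_ratio:
  assumes r: "4 * real n \<le> r1" "r1 \<le> r2" and i: "i \<in> {1..n}"
  shows "arc i r1 \<le> exp (10 * real n / r1 - 10 * real n / r2) * arc i r2"
    and "arc i r2 \<le> exp (10 * real n / r1 - 10 * real n / r2) * arc i r1"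
proof -
  define h where "h = (\<lambda>\<theta>2. SOME \<theta>1. joins r1 r2 \<theta>1 \<theta>2)"
  define k where "k = (\<lambda>\<theta>1. SOME \<theta>2. joins r1 r2 \<theta>1 \<theta>2)"
  have h: "joins r1 r2 (h \<theta>) \<theta>" for \<theta>
    unfolding h_def by (rule someI_ex) (use joins_backward[OF r] in blast)
  have k: "joins r1 r2 \<theta> (k \<theta>)" for \<theta>
    unfolding k_def by (rule someI_ex) (use joins_forward[OF r] in blast)
  have uniq: "\<theta>1 = \<theta>1' \<longleftrightarrow> \<theta>2 = \<theta>2'" if "joins r1 r2 \<theta>1 \<theta>2" "joins r1 r2 \<theta>1' \<theta>2'" for \<theta>1 \<theta>2 \<theta>1' \<theta>2'
    using joins_dist[OF r that] by auto
  have rb: "4 * real n \<le> r2" using r by simp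
  show "arc i r1 \<le> exp (10 * real n / r1 - 10 * real n / r2) * arc i r2"
    unfolding arc_def
  proof (rule circle_lipschitz_measure_le[where h = h])
    show "\<bar>h x - h y\<bar> \<le> exp (10 * real n / r1 - 10 * real n / r2) * \<bar>x - y\<bar>" for x y
      by (rule joins_dist(2)[OF r h h])
    show "h x < h y" if "x < y" for x y using joins_less_iff[OF r h h] that by blast
    show "\<exists>x. h x = y" for y using uniq[OF h k] by blast
    show "h (\<theta> + 2 * pi) = h \<theta> + 2 * pi" for \<theta> using uniq[OF h joins_shift[OF h]] by blast
    show "\<theta> \<in> angles i r2" if "h \<theta> \<in> angles i r1" for \<theta>
      using joins_hits[OF r h i] that by (simp add: angles_def)
  qed (use angles_borel angles_periodic r rb i in auto)
  show "arc i r2 \<le> exp (10 * real n / r1 - 10 * real n / r2) * arc i r1"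
    unfolding arc_def
  proof (rule circle_lipschitz_measure_le[where h = k])
    show "\<bar>k x - k y\<bar> \<le> exp (10 * real n / r1 - 10 * real n / r2) * \<bar>x - y\<bar>" for x y
      by (rule joins_dist(1)[OF r k k])
    show "k x < k y" if "x < y" for x y using joins_less_iff[OF r k k] that by blast
    show "\<exists>x. k x = y" for y using uniq[OF k h] by blast
    show "k (\<theta> + 2 * pi) = k \<theta> + 2 * pi" for \<theta> using uniq[OF k joins_shift[OF k]] by blast
    show "\<theta> \<in> angles i r1" if "k \<theta> \<in> angles i r2" for \<theta>
      using joins_hits[OF r k i] that by (simp add: angles_def)
  qed (use angles_borel angles_periodic r rb i in auto)
qed

lemma hit_prob_from_eq:
  assumes "4 * real n \<le> r" "i \<in> {1..n}"
  shows "hit_prob_from \<alpha> n x i r = arc i r / (2 * pi)"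
proof -
  have r: "r \<ge> 0" using assms by simp
  have "{\<theta> \<in> {0..2*pi}. attaches \<alpha> n x i (circle_point r \<theta>)} = {0..2*pi} \<inter> angles i r"
    using attaches_iff[OF far_outside assms(2)] assms r by (auto simp: angles_def norm_circle_point)
  moreover have "measure lborel ({0..2*pi} \<inter> ({0..2*pi} \<inter> angles i r)) = arc i r"
  proof -
    \<comment> \<open>The closed interval in the definition of the probability exceeds a period by
      the null set \<open>{2*pi}\<close>.\<close>
    have "{0..2*pi} \<inter> ({0..2*pi} \<inter> angles i r) = (angles i r \<inter> {0..<2*pi}) \<union> (angles i r \<inter> {2*pi})" by auto
    then have "measure lborel ({0..2*pi} \<inter> ({0..2*pi} \<inter> angles i r))
        = measure lborel ((angles i r \<inter> {0..<2*pi}) \<union> (angles i r \<inter> {2*pi}))" by (rule arg_cong)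
    also have "\<dots> = arc i r"
      unfolding arc_def
    proof (rule measure_Un_null_set)
      show "angles i r \<inter> {2*pi} \<in> null_sets lborel"
      by (rule null_sets_subset[OF finite_imp_null_set_lborel[of "{2*pi}"]]) (use angles_borel[OF assms] in auto)
    qed (use angles_borel[OF assms] in auto)
    finally show ?thesis .
  qed
  ultimately show ?thesis
    unfolding hit_prob_from_def using angles_borel[OF assms]
    by (subst measure_uniform_measure) auto
qed

lemma arc_limit:
  assumes i: "i \<in> {1..n}"
  obtains l where "(arc i \<longlongrightarrow> l) at_top"
proof -
  \<comment> \<open>The comparison of two radii says exactly that this corrected arc length is
    nondecreasing. It is bounded, and the correction factor tends to 1, so \<open>arc i\<close>
    converges as well.\<close>
  define g where "g = (\<lambda>r. arc i r * exp (- (10 * real n / r)))"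
  have mono: "g r1 \<le> g r2" if "4 * real n \<le> r1" "r1 \<le> r2" for r1 r2
  proof -
    have "arc i r1 \<le> (exp (10 * real n / r1) * exp (- (10 * real n / r2))) * arc i r2"
      using arc_ratio(1)[OF that i] by (simp add: exp_diff exp_minus divide_inverse)
    then have "arc i r1 * exp (- (10 * real n / r1)) \<le> (exp (10 * real n / r1) * exp (- (10 * real n / r2))) * arc i r2 * exp (- (10 * real n / r1))"
      by (rule mult_right_mono) simp
    also have "\<dots> = g r2" by (simp add: g_def exp_minus field_simps)
    finally show ?thesis by (simp add: g_def)
  qed
  have bd: "g r \<le> 2 * pi" if "4 * real n \<le> r" for r
  proof -
    have "exp (- (10 * real n / r)) \<le> 1" using that by simp
    then have "g r \<le> arc i r * 1" unfolding g_def by (intro mult_left_mono arc_nonneg)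
    then show ?thesis using arc_le[of i r] by simp
  qed
  define S where "S = g ` {4 * real n..}"
  have bS: "bdd_above S" unfolding S_def bdd_above_def using bd by (intro exI[of _ "2 * pi"]) auto
  have "(g \<longlongrightarrow> Sup S) at_top"
  proof (rule increasing_tendsto)
    show "\<forall>\<^sub>F r in at_top. g r \<le> Sup S"
      using eventually_ge_at_top[of "4 * real n"]
      by eventually_elim (rule cSup_upper[OF _ bS], simp add: S_def)
    fix y assume "y < Sup S"
    then obtain r where r: "r \<ge> 4 * real n" "y < g r"
      using less_cSupE[of y S] by (auto simp: S_def)
    show "\<forall>\<^sub>F r in at_top. y < g r"
      using eventually_ge_at_top[of r]
    proof eventually_elim
      case (elim s)
      then show ?case using mono[OF r(1) elim] r(2) by linarith
    qed
  qed
  moreover have "((\<lambda>r. exp (10 * real n / r)) \<longlongrightarrow> exp 0) at_top"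
    by (intro tendsto_intros real_tendsto_divide_at_top[OF tendsto_const filterlim_ident])
  ultimately have "((\<lambda>r. g r * exp (10 * real n / r)) \<longlongrightarrow> Sup S * exp 0) at_top"
    by (intro tendsto_mult)
  moreover have "(\<lambda>r. g r * exp (10 * real n / r)) = arc i"
    by (simp add: g_def fun_eq_iff exp_minus)
  ultimately show thesis using that by metis
qed

text \<open>The second bound lets the outer radius tend to infinity in \<open>arc_ratio\<close>; the
  exponent 5/2 is 10 n / r at the smallest admissible radius r = 4 n.\<close>

lemma hit_prob_bounds:
  assumes i: "i \<in> {1..n}"
  shows "hit_prob \<alpha> n x i \<le> 1"
    and "4 * real n \<le> r \<Longrightarrow> 2 * pi * hit_prob \<alpha> n x i \<le> exp (5/2) * arc i r"
proof -
  obtain l where l: "(arc i \<longlongrightarrow> l) at_top" using arc_limit[OF i] .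
  have "((\<lambda>r. arc i r / (2 * pi)) \<longlongrightarrow> l / (2 * pi)) at_top" by (intro tendsto_intros l) simp
  moreover have "\<forall>\<^sub>F r in at_top. arc i r / (2 * pi) = hit_prob_from \<alpha> n x i r"
    using eventually_ge_at_top[of "4 * real n"] by eventually_elim (simp add: hit_prob_from_eq[OF _ i])
  ultimately have "(hit_prob_from \<alpha> n x i \<longlongrightarrow> l / (2 * pi)) at_top" by (rule Lim_transform_eventually)
  then have eq: "hit_prob \<alpha> n x i = l / (2 * pi)" unfolding hit_prob_def by (intro tendsto_Lim) auto
  have "l \<le> 2 * pi" by (rule tendsto_upperbound[OF l]) (auto simp: arc_le)
  then show "hit_prob \<alpha> n x i \<le> 1" by (simp add: eq)
  assume r: "4 * real n \<le> r"
  have n: "real n \<ge> 1" using n_pos by simp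
  have "l \<le> exp (5/2) * arc i r"
  proof (rule tendsto_upperbound[OF l])
    show "\<forall>\<^sub>F s in at_top. arc i s \<le> exp (5/2) * arc i r"
      using eventually_ge_at_top[of r]
    proof eventually_elim
      case (elim s)
      have "10 * real n / r \<le> 5/2" using r n by (simp add: divide_le_eq)
      moreover have "10 * real n / s \<ge> 0" using elim r n by simp
      ultimately have "exp (10 * real n / r - 10 * real n / s) \<le> exp (5/2)" by simp
      then have "exp (10 * real n / r - 10 * real n / s) * arc i r \<le> exp (5/2) * arc i r"
        by (intro mult_right_mono arc_nonneg)
      then show ?case using arc_ratio(2)[OF r elim i] by linarith
    qed
  qed simp
  then show "2 * pi * hit_prob \<alpha> n x i \<le> exp (5/2) * arc i r" by (simp add: eq)
qed

end

section \<open>The flux bound\<close>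

context cluster_flow
begin

text \<open>For norm y \<le> 8 n all distances are at most 10 n, and (10 n) powr (\<alpha> + 2)
  \<le> 1000 n powr \<alpha> * n^2. Together with y \<bullet> (y - x_j) \<ge> 3/4 (norm y)^2 \<ge> 3
  n * norm y, summing over n particles gives 3/1000.\<close>

lemma inward_le:
  assumes "4 * real n \<le> norm y"
  shows "y \<bullet> F y \<le> 0"
    and "norm y \<le> 8 * real n \<Longrightarrow> y \<bullet> F y \<le> - (3/1000 * coef \<alpha> * real n powr (- \<alpha>)) * norm y"
proof -
  have n: "real n \<ge> 1" using n_pos by simp
  have z: "real n \<le> norm (y - x j)" "norm (y - x j) \<le> 5/4 * norm y" "3/4 * (norm y)\<^sup>2 \<le> y \<bullet> (y - x j)"
    if j: "j \<in> {1..n}" for j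
  proof -
    have xj: "norm (x j) \<le> norm y / 4" using x_norm[OF j] assms by simp
    show "real n \<le> norm (y - x j)" "norm (y - x j) \<le> 5/4 * norm y"
      using norm_triangle_ineq2[of y "x j"] norm_triangle_ineq4[of y "x j"] x_norm[OF j] assms n by linarith+
    have "y \<bullet> x j \<le> norm y * norm (x j)" by (rule norm_cauchy_schwarz)
    also have "\<dots> \<le> norm y * (norm y / 4)" using xj by (intro mult_left_mono) auto
    finally show "3/4 * (norm y)\<^sup>2 \<le> y \<bullet> (y - x j)"
      by (simp add: inner_diff_right dot_square_norm power2_eq_square)
  qed
  have eq: "y \<bullet> F y = - (coef \<alpha> * (\<Sum>j=1..n. y \<bullet> kern (\<alpha> + 2) (y - x j)))"
    by (simp add: F_def inner_sum_right)
  have k: "y \<bullet> kern (\<alpha> + 2) (y - x j) = norm (y - x j) powr (- (\<alpha> + 2)) * (y \<bullet> (y - x j))"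
    if j: "j \<in> {1..n}" for j
  proof -
    have "max (norm (y - x j)) (1/2) = norm (y - x j)" using z(1)[OF j] n by simp
    then show ?thesis by (simp add: kern_def)
  qed
  have "0 \<le> y \<bullet> kern (\<alpha> + 2) (y - x j)" if "j \<in> {1..n}" for j
    unfolding k[OF that] by (intro mult_nonneg_nonneg order_trans[OF _ z(3)[OF that]]) auto
  then have "0 \<le> (\<Sum>j=1..n. y \<bullet> kern (\<alpha> + 2) (y - x j))" by (intro sum_nonneg) auto
  then show "y \<bullet> F y \<le> 0" unfolding eq using coef_pos by simp
  assume y8: "norm y \<le> 8 * real n"
  have lower: "3/1000 * real n powr (- \<alpha>) / real n * norm y \<le> y \<bullet> kern (\<alpha> + 2) (y - x j)" if j: "j \<in> {1..n}" for j
  proof -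
    have "(10 * real n) powr (- (\<alpha> + 2)) \<le> norm (y - x j) powr (- (\<alpha> + 2))"
      using z[OF j] y8 n \<alpha> by (intro powr_mono2') auto
    moreover have "real n powr (- \<alpha>) / (1000 * (real n)\<^sup>2) \<le> (10 * real n) powr (- (\<alpha> + 2))"
    proof -
      have "(10::real) powr (\<alpha> + 2) \<le> 10 powr 3" using \<alpha> by (intro powr_mono) auto
      then have a: "(10::real) powr (\<alpha> + 2) \<le> 1000" by (simp add: powr_numeral)
      have b: "real n powr (\<alpha> + 2) = real n powr \<alpha> * (real n)\<^sup>2"
        using powr_mult_self(2)[of "real n" \<alpha>] by simp
      have "(10 * real n) powr (\<alpha> + 2) = 10 powr (\<alpha> + 2) * (real n powr \<alpha> * (real n)\<^sup>2)"
        unfolding b[symmetric] by (rule powr_mult)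
      also have "\<dots> \<le> 1000 * (real n powr \<alpha> * (real n)\<^sup>2)" using a by (intro mult_right_mono) auto
      finally have "1 / (1000 * (real n powr \<alpha> * (real n)\<^sup>2)) \<le> 1 / (10 * real n) powr (\<alpha> + 2)"
        using n by (intro divide_left_mono) auto
      then show ?thesis unfolding powr_minus_divide by (simp only: divide_divide_eq_left mult_ac)
    qed
    ultimately have p: "real n powr (- \<alpha>) / (1000 * (real n)\<^sup>2) \<le> norm (y - x j) powr (- (\<alpha> + 2))" by linarith
    have "3 * real n * norm y \<le> 3/4 * (norm y)\<^sup>2"
      using mult_right_mono[OF assms, of "norm y"] by (simp add: power2_eq_square)
    then have q: "3 * real n * norm y \<le> y \<bullet> (y - x j)" using z(3)[OF j] by linarith
    have "real n powr (- \<alpha>) / (1000 * (real n)\<^sup>2) * (3 * real n * norm y) \<le> y \<bullet> kern (\<alpha> + 2) (y - x j)"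
      unfolding k[OF j] using p q n by (intro mult_mono) auto
    moreover have "real n powr (- \<alpha>) / (1000 * (real n)\<^sup>2) * (3 * real n * norm y) = 3/1000 * real n powr (- \<alpha>) / real n * norm y"
      using n by (simp add: power2_eq_square field_simps)
    ultimately show ?thesis by simp
  qed
  have "(\<Sum>j=1..n. 3/1000 * real n powr (- \<alpha>) / real n * norm y) \<le> (\<Sum>j=1..n. y \<bullet> kern (\<alpha> + 2) (y - x j))"
    by (intro sum_mono lower)
  moreover have "(\<Sum>j=1..n. 3/1000 * real n powr (- \<alpha>) / real n * norm y) = 3/1000 * real n powr (- \<alpha>) * norm y"
    using n by simp
  ultimately have "coef \<alpha> * (3/1000 * real n powr (- \<alpha>) * norm y) \<le> coef \<alpha> * (\<Sum>j=1..n. y \<bullet> kern (\<alpha> + 2) (y - x j))"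
    using coef_pos by (intro mult_left_mono) auto
  then show "y \<bullet> F y \<le> - (3/1000 * coef \<alpha> * real n powr (- \<alpha>)) * norm y"
    unfolding eq by (simp add: mult_ac)
qed

lemma norm_flow_deriv:
  assumes "t > 0" "flow t y \<noteq> 0"
  shows "((\<lambda>t. norm (flow t y)) has_real_derivative (flow t y \<bullet> F (flow t y)) / norm (flow t y)) (at t)"
proof -
  have "((\<lambda>t. flow t y) has_derivative (\<lambda>h. h *\<^sub>R F (flow t y))) (at t)"
    using flow_deriv_at[OF assms(1), of y] by (simp add: has_vector_derivative_def)
  from has_derivative_compose[OF this has_derivative_norm[OF assms(2)]]
  have "((\<lambda>t. norm (flow t y)) has_derivative (\<lambda>h. (h *\<^sub>R F (flow t y)) \<bullet> sgn (flow t y))) (at t)" .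
  then show ?thesis
    unfolding has_field_derivative_def
    by (rule has_derivative_eq_rhs) (auto simp: fun_eq_iff sgn_div_norm inner_commute divide_inverse)
qed

lemma norm_flow_continuous: "continuous_on S (\<lambda>t. norm (flow t y))"
  by (intro continuous_intros flow_continuous_time)

text \<open>After the last time \<open>m\<close> at norm at most 4 n the radius could only decrease,
  since the field points inward out there; so the norm could not end above 4 n.\<close>

lemma norm_flow_stays_above:
  assumes "norm (flow s y) > 4 * real n" "t \<in> {0..s}"
  shows "norm (flow t y) > 4 * real n"
proof (rule ccontr)
  assume neg: "\<not> norm (flow t y) > 4 * real n"
  let ?S = "{r \<in> {t..s}. norm (flow r y) \<le> 4 * real n}"
  have cS: "compact ?S"
  proof -
    have "closed {r. norm (flow r y) \<le> 4 * real n}"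
      by (intro closed_Collect_le norm_flow_continuous continuous_on_const)
    then have "compact ({t..s} \<inter> {r. norm (flow r y) \<le> 4 * real n})" by (intro compact_Int_closed) auto
    then show ?thesis by (simp add: Int_def)
  qed
  have "t \<in> ?S" using neg assms(2) by auto
  then have "?S \<noteq> {}" by blast
  from compact_attains_sup[OF cS this] obtain m where m: "m \<in> ?S" "\<forall>r\<in>?S. r \<le> m" by blast
  have "norm (flow s y) \<le> norm (flow m y)"
  proof (rule DERIV_nonpos_imp_decreasing_open[OF _ _ norm_flow_continuous])
    show "m \<le> s" using m by auto
    fix r assume r: "m < r" "r < s"
    have big: "norm (flow r y) > 4 * real n"
    proof (rule ccontr)
      assume "\<not> norm (flow r y) > 4 * real n"
      then have "r \<in> ?S" using r m(1) by auto
      then show False using m(2) r by fastforce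
    qed
    then have nz: "flow r y \<noteq> 0" by auto
    have "r > 0" using r m(1) assms(2) by auto
    then have "((\<lambda>t. norm (flow t y)) has_real_derivative (flow r y \<bullet> F (flow r y)) / norm (flow r y)) (at r)"
      using nz by (rule norm_flow_deriv)
    moreover have "(flow r y \<bullet> F (flow r y)) / norm (flow r y) \<le> 0"
      using inward_le(1)[of "flow r y"] big by (simp add: divide_nonpos_nonneg)
    ultimately show "\<exists>d. ((\<lambda>t. norm (flow t y)) has_real_derivative d) (at r) \<and> d \<le> 0" by blast
  qed
  then show False using m(1) assms(1) by auto
qed

text \<open>The radius shrinks at least at speed \<open>v\<close> while it exceeds 4 n. That speed
  bound holds up to 8 n, whence the condition \<open>v * \<delta> \<le> 4 * real n\<close> on the
  width.\<close>

lemma leaves_annulus: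
  assumes v: "v = 3/1000 * coef \<alpha> * real n powr (- \<alpha>)"
    and "\<delta> \<ge> 0" "v * \<delta> \<le> 4 * real n" "norm y \<le> 4 * real n + v * \<delta>" "s \<ge> \<delta>"
  shows "norm (flow s y) \<le> 4 * real n"
proof (rule ccontr)
  assume "\<not> norm (flow s y) \<le> 4 * real n"
  then have above: "norm (flow t y) > 4 * real n" if "t \<in> {0..s}" for t
    using norm_flow_stays_above[of s y t] that by simp
  have d: "((\<lambda>t. norm (flow t y)) has_real_derivative (flow t y \<bullet> F (flow t y)) / norm (flow t y)) (at t)"
    if "0 < t" "t < s" for t
    using above[of t] that by (intro norm_flow_deriv) auto
  have mono: "norm (flow t y) \<le> norm (flow 0 y)" if "t \<in> {0..s}" for t
  proof (rule DERIV_nonpos_imp_decreasing_open[OF _ _ norm_flow_continuous])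
    fix r assume r: "0 < r" "r < t"
    have "(flow r y \<bullet> F (flow r y)) / norm (flow r y) \<le> 0"
      using inward_le(1)[of "flow r y"] above[of r] r that by (simp add: divide_nonpos_nonneg)
    then show "\<exists>d. ((\<lambda>t. norm (flow t y)) has_real_derivative d) (at r) \<and> d \<le> 0"
      using d[of r] r that by auto
  qed (use that in auto)
  have "norm (flow s y) + v * s \<le> norm (flow 0 y) + v * 0"
  proof (rule DERIV_nonpos_imp_decreasing_open[where f = "\<lambda>t. norm (flow t y) + v * t"])
    show "continuous_on {0..s} (\<lambda>t. norm (flow t y) + v * t)"
      by (intro continuous_intros norm_flow_continuous flow_continuous_time)
    fix t assume t: "0 < t" "t < s"
    have "norm (flow t y) \<le> 8 * real n" using mono[of t] t assms(3,4) by simp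
    then have "flow t y \<bullet> F (flow t y) \<le> - v * norm (flow t y)"
      using inward_le(2)[of "flow t y"] above[of t] t by (simp add: v)
    moreover have "norm (flow t y) > 0" by (rule le_less_trans[OF _ above]) (use t in auto)
    ultimately have "(flow t y \<bullet> F (flow t y)) / norm (flow t y) + v \<le> 0" by (simp add: field_simps)
    moreover have "((\<lambda>t. norm (flow t y) + v * t) has_real_derivative
        (flow t y \<bullet> F (flow t y)) / norm (flow t y) + v) (at t)"
      by (auto intro!: derivative_eq_intros d t)
    ultimately show "\<exists>d. ((\<lambda>t. norm (flow t y) + v * t) has_real_derivative d) (at t) \<and> d \<le> 0" by blast
  qed (use assms in auto)
  moreover have "v \<ge> 0" unfolding v using coef_pos by simp
  then have "v * \<delta> \<le> v * s" using assms(5) by (intro mult_left_mono)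
  ultimately show False using \<open>\<not> norm (flow s y) \<le> 4 * real n\<close> assms(4) by simp
qed

section \<open>Speed near the particles and comparison of the two areas\<close>

lemma F_norm_le_off_disks:
  assumes "\<alpha> < 1" "\<And>j. j \<in> {1..n} \<Longrightarrow> dist y (x j) \<ge> 1"
  shows "norm (F y) \<le> coef \<alpha> * (18 / (1 - \<alpha>) * real n powr ((1 - \<alpha>) / 2))"
proof -
  have k: "norm (kern (\<alpha> + 2) (y - x j)) \<le> dist y (x j) powr (- (\<alpha> + 1))" if j: "j \<in> {1..n}" for j
  proof -
    have "max (norm (y - x j)) (1/2) = norm (y - x j)" using assms(2)[OF j] by (simp add: dist_norm)
    then have "norm (kern (\<alpha> + 2) (y - x j)) = norm (y - x j) powr (- (\<alpha> + 2)) * norm (y - x j)"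
      by (simp add: kern_def)
    also have "\<dots> = norm (y - x j) powr (- (\<alpha> + 2) + 1)" by (rule powr_mult_self(1)) simp
    also have "- (\<alpha> + 2) + 1 = - (\<alpha> + 1)" by simp
    finally show ?thesis by (simp only: dist_norm)
  qed
  have "norm (\<Sum>j=1..n. kern (\<alpha> + 2) (y - x j)) \<le> (\<Sum>j=1..n. dist y (x j) powr (- (\<alpha> + 1)))"
    by (intro sum_norm_le k)
  also have "\<dots> \<le> 18 / (1 - \<alpha>) * real (card {1..n}) powr ((1 - \<alpha>) / 2)"
    using separated assms \<alpha> by (intro separated_sum_powr_le) auto
  finally have "coef \<alpha> * norm (\<Sum>j=1..n. kern (\<alpha> + 2) (y - x j)) \<le> coef \<alpha> * (18 / (1 - \<alpha>) * real n powr ((1 - \<alpha>) / 2))"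
    using coef_pos by (intro mult_left_mono) auto
  then show ?thesis unfolding F_def using coef_pos by simp
qed

lemma inner_compact_approx:
  fixes A :: "(real^2) set"
  assumes "A \<in> sets lebesgue" "bounded A" "e > 0"
  obtains K where "compact K" "K \<subseteq> A" "measure lebesgue A \<le> measure lebesgue K + e"
proof -
  obtain K where K: "closed K" "K \<subseteq> A" "A - K \<in> lmeasurable" "emeasure lebesgue (A - K) < ennreal e"
    by (rule sets_lebesgue_inner_closed[OF assms(1,3)])
  have cK: "compact K" using K(1,2) assms(2) bounded_subset compact_eq_bounded_closed by blast
  then have mK: "K \<in> lmeasurable" by (rule lmeasurable_compact)
  have "measure lebesgue A \<le> measure lebesgue K + measure lebesgue (A - K)"
  proof -
    have "A = K \<union> (A - K)" using K(2) by blast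
    then show ?thesis using measure_Un_le[of K lebesgue "A - K"] mK K(3) by auto
  qed
  moreover have "measure lebesgue (A - K) < e"
    using K(3,4) assms(3) by (simp add: emeasure_eq_measure2 ennreal_less_iff)
  ultimately show thesis using that[OF cK K(2)] by simp
qed

text \<open>The points of the annulus that hit \<open>x i\<close> are sorted by the number of complete time steps \<open>\<delta>\<close>
  before the hit.  Moving the \<open>k\<close>-th class by time \<open>k \<delta>\<close> does not decrease its area, puts it in the thin
  ring around the disk of \<open>x i\<close>, and keeps the classes disjoint because a point leaves the annulus
  within one step.\<close>

lemma annulus_hits_area_le:
  assumes i: "i \<in> {1..n}" and v: "v = 3/1000 * coef \<alpha> * real n powr (- \<alpha>)"
    and \<delta>: "\<delta> > 0" "v * \<delta> \<le> 4 * real n"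
    and M: "M \<ge> 0" "\<And>y. (\<And>j. j \<in> {1..n} \<Longrightarrow> dist y (x j) \<ge> 1) \<Longrightarrow> norm (F y) \<le> M"
    and A: "A = hits i \<inter> outside \<inter> {y. 4 * real n < norm y \<and> norm y \<le> 4 * real n + v * \<delta>}"
  shows "measure lebesgue A \<le> pi * ((1 + M * \<delta>)\<^sup>2 - 1)"
proof -
  have Ab: "A \<in> sets borel"
  proof -
    have "{y :: real^2. 4 * real n < norm y \<and> norm y \<le> 4 * real n + v * \<delta>} \<in> sets borel" by measurable
    then show ?thesis unfolding A by (rule sets.Int[OF hits_borel[OF i]])
  qed
  have bA: "bounded A" unfolding A by (rule boundedI[of _ "4 * real n + v * \<delta>"]) auto
  define P where "P = (\<lambda>k::nat. A \<inter> enters i (real (Suc k) * \<delta>) - enters i (real k * \<delta>))"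
  have Pb: "P k \<in> sets borel" for k
    unfolding P_def using Ab borel_closed[OF closed_enters] by auto
  have PA: "P k \<subseteq> A" for k by (auto simp: P_def)
  have bP: "bounded (P k)" for k using bounded_subset[OF bA PA] .
  have Pl: "P k \<in> lmeasurable" for k using Pb bP by (intro bounded_set_imp_lmeasurable) auto
  have hit: "\<exists>T. 0 \<le> T \<and> dist (flow T y) (x i) = 1 \<and>
      (\<forall>t\<in>{0..<T}. \<forall>j\<in>{1..n}. dist (flow t y) (x j) > 1) \<and> (\<forall>s\<ge>0. y \<in> enters i s \<longleftrightarrow> T \<le> s)"
    if yA: "y \<in> A" for y
  proof -
    obtain T where T: "T \<ge> 0" "dist (flow T y) (x i) = 1"
      "\<forall>t\<in>{0..<T}. \<forall>j\<in>{1..n}. dist (flow t y) (x j) > 1"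
      using yA unfolding A hits_def by blast
    have "y \<in> enters i s \<longleftrightarrow> T \<le> s" if "s \<ge> 0" for s
    proof
      assume "y \<in> enters i s"
      then obtain t where "t \<in> {0..s}" "dist (flow t y) (x i) \<le> 1" unfolding enters_def by blast
      then show "T \<le> s" using T(3) i by (metis atLeastAtMost_iff atLeastLessThan_iff leD leI order_trans)
    next
      assume "T \<le> s"
      then show "y \<in> enters i s" unfolding enters_def using T(1,2) by force
    qed
    then show ?thesis using T by blast
  qed
  have Phit: "\<exists>T. real k * \<delta> < T \<and> T \<le> real (Suc k) * \<delta> \<and> dist (flow T y) (x i) = 1 \<and>
      (\<forall>t\<in>{0..<T}. \<forall>j\<in>{1..n}. dist (flow t y) (x j) > 1)" if "y \<in> P k" for y k
  proof -
    have y: "y \<in> A" "y \<in> enters i (real (Suc k) * \<delta>)" "y \<notin> enters i (real k * \<delta>)"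
      using that by (auto simp: P_def)
    obtain T where T: "0 \<le> T" "dist (flow T y) (x i) = 1"
      "\<forall>t\<in>{0..<T}. \<forall>j\<in>{1..n}. dist (flow t y) (x j) > 1" "\<forall>s\<ge>0. y \<in> enters i s \<longleftrightarrow> T \<le> s"
      using hit[OF y(1)] by blast
    have "T \<le> real (Suc k) * \<delta>" "\<not> T \<le> real k * \<delta>"
      using T(4) y(2,3) \<delta>(1) by (simp_all del: of_nat_Suc)
    then show ?thesis using T(2,3) by (intro exI[of _ T]) auto
  qed
  have Aeq: "A = (\<Union>k. P k)"
  proof
    show "A \<subseteq> (\<Union>k. P k)"
    proof
      fix y assume y: "y \<in> A"
      then obtain T where T: "0 \<le> T" "dist (flow T y) (x i) = 1" "\<forall>s\<ge>0. y \<in> enters i s \<longleftrightarrow> T \<le> s"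
        using hit by blast
      have "T \<noteq> 0"
      proof
        assume "T = 0"
        then have "dist y (x i) = 1" using T(2) by simp
        moreover have "1 < dist y (x i)" using y i unfolding A outside_def by blast
        ultimately show False by simp
      qed
      then have "T > 0" using T(1) by simp
      define k where "k = nat (\<lceil>T / \<delta>\<rceil> - 1)"
      have "T / \<delta> > 0" using \<open>T > 0\<close> \<delta> by simp
      then have "\<lceil>T / \<delta>\<rceil> \<ge> 1" by linarith
      then have "real k = of_int \<lceil>T / \<delta>\<rceil> - 1" by (simp add: k_def)
      then have "real k < T / \<delta>" "T / \<delta> \<le> real (Suc k)" by linarith+
      then have "real k * \<delta> < T" "T \<le> real (Suc k) * \<delta>" using \<delta> by (simp_all add: field_simps)
      then have "y \<in> P k" using T(3) y \<delta> by (auto simp: P_def simp del: of_nat_Suc)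
      then show "y \<in> (\<Union>k. P k)" by blast
    qed
  qed (use PA in auto)
  \<comment> \<open>Less than one step before the hit, at speed at most \<open>M\<close>, a point is
    within \<open>M * \<delta>\<close> of the unit circle around x_i but still outside it.\<close>
  define N where "N = cball (x i) (1 + M * \<delta>) - cball (x i) 1"
  have Md: "M * \<delta> \<ge> 0" using M \<delta> by simp
  have Nm: "N \<in> lmeasurable" unfolding N_def by (intro fmeasurable_Diff) auto
  have mN: "measure lebesgue N = pi * ((1 + M * \<delta>)\<^sup>2 - 1)"
  proof -
    have "measure lebesgue N = measure lebesgue (cball (x i) (1 + M * \<delta>)) - measure lebesgue (cball (x i) 1)"
      unfolding N_def by (rule measurable_measure_Diff) (use Md in auto)
    then show ?thesis using Md
      by (simp add: content_cball unit_ball_vol_2 power2_eq_square algebra_simps)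
  qed
  have ring: "flow (real k * \<delta>) y \<in> N" if y: "y \<in> P k" for k y
  proof -
    obtain T where T: "real k * \<delta> < T" "T \<le> real (Suc k) * \<delta>" "dist (flow T y) (x i) = 1"
      "\<forall>t\<in>{0..<T}. \<forall>j\<in>{1..n}. dist (flow t y) (x j) > 1" using Phit[OF y] by blast
    have k0: "0 \<le> real k * \<delta>" using \<delta> by simp
    have y': "y \<in> outside" using y by (auto simp: P_def A)
    have ge: "dist (flow t y) (x j) \<ge> 1" if "t \<in> {0..T}" "j \<in> {1..n}" for t j
    proof (rule dist_gt_1_before(2)[of T "\<lambda>t. flow t y"])
      show "1 < dist (flow 0 y) (x j)" using y' that by (simp add: outside_def)
      show "dist (flow t y) (x j) \<noteq> 1" if "t \<in> {0..<T}" for t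
        using T(4) that \<open>j \<in> {1..n}\<close> by fastforce
    qed (use that flow_continuous_time in auto)
    have "norm (flow T y - flow (real k * \<delta>) y) \<le> M * norm (T - real k * \<delta>)"
    proof (rule vector_differentiable_bound[where S = "{real k * \<delta>..T}" and f' = "\<lambda>t. F (flow t y)"])
      fix t assume t: "t \<in> {real k * \<delta>..T}"
      show "((\<lambda>t. flow t y) has_vector_derivative F (flow t y)) (at t within {real k * \<delta>..T})"
        using t k0 by (intro has_vector_derivative_within_subset[OF flow_props(3)]) auto
      show "norm (F (flow t y)) \<le> M" using t k0 ge by (intro M(2)) auto
    qed (use T in auto)
    also have "\<dots> \<le> M * \<delta>" using T M(1) by (intro mult_left_mono) (auto simp: algebra_simps)
    finally have "dist (flow (real k * \<delta>) y) (flow T y) \<le> M * \<delta>" by (simp add: dist_norm norm_minus_commute)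
    then have "dist (x i) (flow (real k * \<delta>) y) \<le> 1 + M * \<delta>"
      using dist_triangle[of "flow (real k * \<delta>) y" "x i" "flow T y"] T(3) by (simp add: dist_commute)
    moreover have "dist (flow (real k * \<delta>) y) (x i) > 1" using T(1,4) k0 i by auto
    ultimately show ?thesis by (simp add: N_def dist_commute)
  qed
  \<comment> \<open>Up to time k \<delta> the trajectories keep distance more than 1 from all
    particles, so their 1/4-neighbourhood avoids the capped region, where the divergence has no sign
    guarantee.\<close>
  have area: "measure lebesgue K \<le> measure lebesgue (flow (real k * \<delta>) ` K)" if K: "compact K" "K \<subseteq> P k" for K k
  proof (rule flow_area_nondecreasing[OF K(1), of _ "1/4"])
    show "0 \<le> real k * \<delta>" using \<delta> by simp
    fix y s z assume h: "y \<in> K" "0 \<le> s" "s \<le> real k * \<delta>" "norm (z - flow s y) < 1/4"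
    obtain T where T: "real k * \<delta> < T" "\<forall>t\<in>{0..<T}. \<forall>j\<in>{1..n}. dist (flow t y) (x j) > 1"
      using Phit[of y k] h(1) K(2) by blast
    show "nonneg_div_at z"
    proof (rule F_nonneg_div)
      fix j assume "j \<in> {1..n}"
      then have "1 < norm (flow s y - x j)" using T h by (simp add: dist_norm)
      then show "1/2 < norm (z - x j)"
        using h(4) norm_triangle_ineq[of "flow s y - z" "z - x j"] by (simp add: norm_minus_commute)
    qed
  qed simp
  \<comment> \<open>A common image point can be flowed back k steps by injectivity: \<open>y\<close>
    would be a later position of \<open>z\<close>, at least one step on, although \<open>z\<close>
    has left the annulus by then.\<close>
  have disj: "flow (real k * \<delta>) ` P k \<inter> flow (real l * \<delta>) ` P l = {}" if "k < l" for k l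
  proof (rule ccontr)
    assume "flow (real k * \<delta>) ` P k \<inter> flow (real l * \<delta>) ` P l \<noteq> {}"
    then obtain y z where yz: "y \<in> P k" "z \<in> P l" "flow (real k * \<delta>) y = flow (real l * \<delta>) z" by auto
    define s where "s = real (l - k) * \<delta>"
    have s: "s \<ge> \<delta>" using that \<delta> by (simp add: s_def mult_le_cancel_right1)
    have "real l * \<delta> = s + real k * \<delta>" using that by (simp add: s_def of_nat_diff algebra_simps)
    then have "flow (real k * \<delta>) y = flow (real k * \<delta>) (flow s z)"
      using yz(3) flow_add[of s "real k * \<delta>" z] s \<delta> by simp
    then have "y = flow s z" by (rule flow_inj[rotated]) (use \<delta> in simp)
    moreover have "norm (flow s z) \<le> 4 * real n"
      using yz(2) \<delta> s by (intro leaves_annulus[OF v]) (auto simp: P_def A)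
    ultimately show False using yz(1) by (auto simp: P_def A)
  qed
  have fin: "measure lebesgue (\<Union>k\<le>m. P k) \<le> measure lebesgue N" for m
  proof (rule field_le_epsilon)
    fix e :: real assume e: "e > 0"
    \<comment> \<open>The error \<open>e\<close> is shared among the m + 1 slices, each replaced by
      a compact subset to which the area inequality applies.\<close>
    define e' where "e' = e / real (Suc m)"
    have e': "e' > 0" using e by (simp add: e'_def)
    have "\<exists>K. compact K \<and> K \<subseteq> P k \<and> measure lebesgue (P k) \<le> measure lebesgue K + e'" for k
    proof -
      have "P k \<in> sets lebesgue" using Pb by auto
      from inner_compact_approx[OF this bP e'] show ?thesis by metis
    qed
    then obtain K where K: "\<And>k. compact (K k)" "\<And>k. K k \<subseteq> P k"
      "\<And>k. measure lebesgue (P k) \<le> measure lebesgue (K k) + e'" by metis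
    let ?G = "\<lambda>k. flow (real k * \<delta>) ` K k"
    have Gm: "?G k \<in> lmeasurable" for k
      using \<delta> by (intro lmeasurable_compact compact_continuous_image flow_continuous_on K) auto
    have "measure lebesgue (\<Union>k\<le>m. P k) \<le> (\<Sum>k\<le>m. measure lebesgue (P k))"
      using Pl by (intro measure_UNION_le) (auto intro: fmeasurableD)
    also have "\<dots> \<le> (\<Sum>k\<le>m. measure lebesgue (?G k) + e')"
      using K(3) area[OF K(1,2)] by (intro sum_mono) (meson add_right_mono order_trans)
    also have "\<dots> = (\<Sum>k\<le>m. measure lebesgue (?G k)) + e"
      using e by (simp add: sum.distrib e'_def)
    also have "(\<Sum>k\<le>m. measure lebesgue (?G k)) = measure lebesgue (\<Union>k\<le>m. ?G k)"
    proof (rule measure_UNION'[symmetric])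
      show "pairwise (\<lambda>k l. disjnt (?G k) (?G l)) {..m}"
      proof (rule pairwiseI)
        fix k l :: nat assume "k \<noteq> l"
        then have "flow (real k * \<delta>) ` P k \<inter> flow (real l * \<delta>) ` P l = {}"
          using disj[of k l] disj[of l k] by (cases "k < l") auto
        then show "disjnt (?G k) (?G l)" unfolding disjnt_def using K(2)[of k] K(2)[of l] by blast
      qed
    qed (use Gm in auto)
    also have "\<dots> \<le> measure lebesgue N"
    proof (rule measure_mono_fmeasurable[OF _ _ Nm])
      show "(\<Union>k\<le>m. ?G k) \<subseteq> N" using ring K(2) by blast
      show "(\<Union>k\<le>m. ?G k) \<in> sets lebesgue" using Gm by (auto intro: fmeasurableD)
    qed
    finally show "measure lebesgue (\<Union>k\<le>m. P k) \<le> measure lebesgue N + e" by simp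
  qed
  show ?thesis
    unfolding Aeq mN[symmetric] by (rule measure_countable_Union_le[OF Pl fin])
qed

lemma hit_prob_le:
  assumes i: "i \<in> {1..n}" and "\<alpha> < 1"
  shows "hit_prob \<alpha> n x i \<le> 2250 * exp (5/2) / (1 - \<alpha>) * real n powr ((\<alpha> - 1) / 2)"
proof -
  have n: "real n \<ge> 1" using n_pos by simp
  define p where "p = hit_prob \<alpha> n x i"
  define v where "v = 3/1000 * coef \<alpha> * real n powr (- \<alpha>)"
  define M where "M = coef \<alpha> * (18 / (1 - \<alpha>) * real n powr ((1 - \<alpha>) / 2))"
  have v: "v > 0" using coef_pos n by (simp add: v_def)
  have M: "M > 0" using coef_pos n assms(2) by (simp add: M_def)
  \<comment> \<open>Small enough that the ring has area at most 3 pi M \<delta> and that the annulus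
    stays inside radius 8 n; \<delta> cancels in the end.\<close>
  define \<delta> where "\<delta> = min (1 / M) (4 * real n / v)"
  have \<delta>: "\<delta> > 0" "M * \<delta> \<le> 1" "v * \<delta> \<le> 4 * real n"
    using v M n by (auto simp: \<delta>_def min_def field_simps)
  define A where "A = hits i \<inter> outside \<inter> {y. 4 * real n < norm y \<and> norm y \<le> 4 * real n + v * \<delta>}"
  have Ab: "A \<in> sets borel"
  proof -
    have "{y :: real^2. 4 * real n < norm y \<and> norm y \<le> 4 * real n + v * \<delta>} \<in> sets borel" by measurable
    then show ?thesis unfolding A_def by (rule sets.Int[OF hits_borel[OF i]])
  qed
  have bA: "bounded A" unfolding A_def by (rule boundedI[of _ "4 * real n + v * \<delta>"]) auto
  have "measure lebesgue A \<le> pi * ((1 + M * \<delta>)\<^sup>2 - 1)"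
    using F_norm_le_off_disks[OF assms(2)] M
    by (intro annulus_hits_area_le[OF i v_def \<delta>(1,3) _ _ A_def]) (auto simp: M_def)
  also have "\<dots> \<le> pi * (3 * (M * \<delta>))"
  proof (rule mult_left_mono)
    have "(M * \<delta>) * (M * \<delta>) \<le> 1 * (M * \<delta>)" using \<delta> M by (intro mult_right_mono) auto
    then show "(1 + M * \<delta>)\<^sup>2 - 1 \<le> 3 * (M * \<delta>)" by (simp add: power2_eq_square algebra_simps)
  qed simp
  finally have upper: "measure lborel A \<le> 3 * pi * M * \<delta>" using Ab by simp
  show ?thesis
  proof (cases "p \<le> 0")
    case True
    then have "p \<le> 0" .
    also have "0 \<le> 2250 * exp (5/2) / (1 - \<alpha>) * real n powr ((\<alpha> - 1) / 2)" using assms(2) by simp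
    finally show ?thesis by (simp add: p_def)
  next
    case False
    \<comment> \<open>The lower bound for the arc of hitting angles on every circle in the annulus;
      the case split on the sign of \<open>p\<close> ensures \<open>c \<ge> 0\<close>.\<close>
    define c where "c = 2 * pi * p / exp (5/2)"
    have c: "c \<ge> 0" using False by (simp add: c_def)
    have "4 * real n * c * ((4 * real n + v * \<delta>) - 4 * real n) \<le> measure lborel A"
    proof (rule polar_area_ge[OF Ab bA])
      fix \<rho> assume \<rho>: "4 * real n < \<rho>" "\<rho> < 4 * real n + v * \<delta>"
      have "{\<theta>\<in>{0..<2*pi}. circle_point \<rho> \<theta> \<in> A} = angles i \<rho> \<inter> {0..<2*pi}"
        using \<rho> n far_outside by (auto simp: A_def angles_def norm_circle_point)
      then have "measure lborel {\<theta>\<in>{0..<2*pi}. circle_point \<rho> \<theta> \<in> A} = arc i \<rho>" by (simp add: arc_def)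
      moreover have "2 * pi * p \<le> exp (5/2) * arc i \<rho>"
        using hit_prob_bounds(2)[OF i, of \<rho>] \<rho> by (simp add: p_def)
      then have "c \<le> arc i \<rho>" by (simp add: c_def divide_le_eq mult.commute)
      ultimately show "c \<le> measure lborel {\<theta>\<in>{0..<2*pi}. circle_point \<rho> \<theta> \<in> A}" by simp
    qed (use n v \<delta> c in auto)
    then have "(4 * real n * c * v) * \<delta> \<le> (3 * pi * M) * \<delta>" using upper by (simp add: algebra_simps)
    then have "4 * real n * c * v \<le> 3 * pi * M" using \<delta>(1) by (simp add: mult_le_cancel_right)
    then have "pi * (8 * real n * v * p) \<le> pi * (3 * M * exp (5/2))"
      by (simp add: c_def field_simps)
    then have "8 * real n * v * p \<le> 3 * M * exp (5/2)" by simp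
    then have "p \<le> 3 * M * exp (5/2) / (8 * real n * v)" using n v by (simp add: field_simps)
    \<comment> \<open>3 * 18 from the upper speed, divided by 8 * 3/1000 from the annulus;
      \<open>coef \<alpha>\<close> occurs in both speeds and cancels.\<close>
    also have "\<dots> = 2250 * exp (5/2) / (1 - \<alpha>) * (real n powr ((1 - \<alpha>) / 2) / (real n * real n powr (- \<alpha>)))"
      using coef_pos n assms(2) by (simp add: M_def v_def field_simps)
    also have "real n powr ((1 - \<alpha>) / 2) / (real n * real n powr (- \<alpha>)) = real n powr ((\<alpha> - 1) / 2)"
    proof -
      have "real n * real n powr (- \<alpha>) = real n powr (1 - \<alpha>)" using powr_mult_base[of "real n" "- \<alpha>"] by simp
      then have "real n powr ((1 - \<alpha>) / 2) / (real n * real n powr (- \<alpha>)) = real n powr ((1 - \<alpha>) / 2 - (1 - \<alpha>))"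
        by (simp add: powr_diff)
      also have "(1 - \<alpha>) / 2 - (1 - \<alpha>) = (\<alpha> - 1) / 2" by (simp add: field_simps)
      finally show ?thesis .
    qed
    finally show ?thesis by (simp add: p_def)
  qed
qed

end

theorem theorem2:
  fixes \<alpha> :: real
  assumes "0 \<le> \<alpha>" and "\<alpha> \<le> 1"
  shows "\<exists>c>0. \<forall>n\<ge>1. \<forall>x :: nat \<Rightarrow> real^2.
           cluster n x \<and> property_P \<alpha> n x \<longrightarrow>
             (MAX i\<in>{1..n}. hit_prob \<alpha> n x i) \<le> c * real n powr ((\<alpha> - 1) / (2 * \<alpha> + 2))"
proof -
  \<comment> \<open>For \<alpha> = 1 the first expression would divide by zero.\<close>
  define c where "c = (if \<alpha> < 1 then 2250 * exp (5/2) / (1 - \<alpha>) else 1)"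
  have c: "c > 0" by (simp add: c_def)
  have "(MAX i\<in>{1..n}. hit_prob \<alpha> n x i) \<le> c * real n powr ((\<alpha> - 1) / (2 * \<alpha> + 2))"
    if n: "n \<ge> 1" and x: "cluster n x" for n and x :: "nat \<Rightarrow> real^2"
  proof -
    interpret cluster_flow \<alpha> n x using assms x by unfold_locales
    have "hit_prob \<alpha> n x i \<le> c * real n powr ((\<alpha> - 1) / (2 * \<alpha> + 2))" if i: "i \<in> {1..n}" for i
    proof (cases "\<alpha> < 1")
      case True
      \<comment> \<open>As 2 \<alpha> + 2 \<ge> 2, the exponent obtained is at most the claimed one,
        and n \<ge> 1.\<close>
      have "(1 - \<alpha>) / (2 * \<alpha> + 2) \<le> (1 - \<alpha>) / 2" using assms True by (intro divide_left_mono) auto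
      moreover have "(\<alpha> - 1) / 2 = - ((1 - \<alpha>) / 2)" "(\<alpha> - 1) / (2 * \<alpha> + 2) = - ((1 - \<alpha>) / (2 * \<alpha> + 2))"
        by (simp_all add: minus_divide_left)
      ultimately have "(\<alpha> - 1) / 2 \<le> (\<alpha> - 1) / (2 * \<alpha> + 2)" by linarith
      then have "real n powr ((\<alpha> - 1) / 2) \<le> real n powr ((\<alpha> - 1) / (2 * \<alpha> + 2))"
        using n by (intro powr_mono) auto
      then have "c * real n powr ((\<alpha> - 1) / 2) \<le> c * real n powr ((\<alpha> - 1) / (2 * \<alpha> + 2))"
        using c by (intro mult_left_mono) auto
      then show ?thesis using hit_prob_le[OF i True] True by (simp add: c_def)
    next
      \<comment> \<open>The exponent vanishes at \<alpha> = 1, so it suffices that a hitting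
        probability is at most 1.\<close>
      case False
      then have "\<alpha> = 1" using assms by simp
      then show ?thesis using hit_prob_bounds(1)[OF i] n by (simp add: c_def)
    qed
    then show ?thesis using n by (intro Max.boundedI) auto
  qed
  then show ?thesis using c by blast
qed

end
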